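(* Consider the two-stage transfer learning setting (pre-training ERM producing $\hat h$, then downstream ERM producing $\hat f^{\mathrm d}$) described in the context. Assume: (Realizability) there exist $h\in\mathcal H$, $f^{\mathrm p}\in\mathcal F^{\mathrm p}$, $f^{\mathrm d}\in\mathcal F^{\mathrm d}$ such that $g^{\mathrm p}=f^{\mathrm p}\circ h$ and $g^{\mathrm d}=f^{\mathrm d}\circ h$, where $g^{\mathrm p}$, $g^{\mathrm d}$ are the optimal predictors of the pre-training and downstream tasks. (Regularity) (i) the pre-training loss $\ell(\cdot,\cdot)$ is $B^{\mathrm p}$-bounded and $\ell(\cdot,y)$ is $L^{\mathrm p}$-Lipschitz for all $y$; (ii) the downstream loss $\ell(\cdot,y)$ is $B^{\mathrm d}$-bounded and $L^{\mathrm d}$-Lipschitz for all $y$; (iii) every $f\in\mathcal F^{\mathrm p}$ is $L(\mathcal F^{\mathrm p})$-Lipschitz with respect to the Euclidean distance; (iv) $\|f\circ h'(x)\|\le D_{\mathcal X^{\mathrm p}}$ for all $x\in\mathcal X^{\mathrm p}$, $h'\in\mathcal H$, $f\in\mathcal F^{\mathrm p}$, and $\|f\circ h'(x)\|\le D_{\mathcal X^{\mathrm d}}$ for all $x\in\mathcal X^{\mathrm d}$, $h'\in\mathcal H$, $f\in\mathcal F^{\mathrm d}$. Let $\nu>0$ be the diversity parameter. Then there is a universal constant $C>0$ such that for every fixed failure probability $\delta\in(0,1)$, with probability at least $1-\delta$, $$R_{\mathrm d}(\hat f^{\mathrm d},\hat h)-\mathbb E_{x^{\mathrm d},y^{\mathrm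 d}}\big[\ell(g^{\mathrm d}(x^{\mathrm d}),y^{\mathrm d})\big]\le C\Bigg(\frac1\nu\Bigg\{L^{\mathrm p}\Big[\log(n)\big[L(\mathcal F^{\mathrm p})G_n(\mathcal H)+\bar G_n(\mathcal F^{\mathrm p})\big]+\frac{\sqrt k\,D_{\mathcal X^{\mathrm p}}}{n^2}\Big]+B^{\mathrm p}\sqrt{\frac{\log(1/\delta)}{n}}\Bigg\}+L^{\mathrm d}\,\bar G_m(\mathcal F^{\mathrm d})+B^{\mathrm d}\sqrt{\frac{\log(1/\delta)}{m}}\Bigg).$$
   Context: Setting. The pre-training task is a $k$-class classification task with $n$ i.i.d. samples $(x_i^{\mathrm p},y_i^{\mathrm p})$, $x_i^{\mathrm p}\in\mathcal X^{\mathrm p}\subset\mathbb R^d$, where $y_i^{\mathrm p}\in\{0,1\}^{k-1}$ is a one-hot label (the all-zero vector encodes class $k$). The downstream task is a $k'$-class classification task with $m$ i.i.d. samples $(x_i^{\mathrm d},y_i^{\mathrm d})$, $x_i^{\mathrm d}\in\mathcal X^{\mathrm d}\subset\mathbb R^d$, $y_i^{\mathrm d}\in\{0,1\}^{k'-1}$ one-hot in the same sense; downstream samples are independent of the pre-training ones. Function classes: representations $\mathcal H\subset\{\mathbb R^d\to\mathbb R^r\}$, predictors $\mathcal F^{\mathrm p}\subset\{\mathbb R^r\to\mathbb R^{k-1}\}$ and $\mathcal F^{\mathrm d}\subset\{\mathbb R^r\to\mathbb R^{k'-1}\}$. The symbol $\ell$ denotes both the pre-training loss $\mathbb R^{k-1}\times\{0,1\}^{k-1}\to\mathbb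 R$ and the downstream loss $\mathbb R^{k'-1}\times\{0,1\}^{k'-1}\to\mathbb R$. ERM. $\hat h\in\arg\min_{h\in\mathcal H}\min_{f\in\mathcal F^{\mathrm p}}\frac1n\sum_{i=1}^n\ell(f\circ h(x_i^{\mathrm p}),y_i^{\mathrm p})$, and then, with $\hat h$ fixed, $\hat f^{\mathrm d}\in\arg\min_{f\in\mathcal F^{\mathrm d}}\frac1m\sum_{i=1}^m\ell(f\circ\hat h(x_i^{\mathrm d}),y_i^{\mathrm d})$. Risk: $R_{\mathrm d}(f,h)=\mathbb E_{x^{\mathrm d},y^{\mathrm d}}[\ell(f\circ h(x^{\mathrm d}),y^{\mathrm d})]$. Optimal predictors: $g^{\mathrm p}=\arg\min_{g:\mathbb R^d\to\mathbb R^{k-1}}\mathbb E[\ell(g(x^{\mathrm p}),y^{\mathrm p})]$, $g^{\mathrm d}=\arg\min_{g:\mathbb R^d\to\mathbb R^{k'-1}}\mathbb E[\ell(g(x^{\mathrm d}),y^{\mathrm d})]$. The left side of the bound is called the Transfer Learning Risk. Representation differences. With $h$ the optimal representation, $f^{\mathrm p}$ the optimal pre-training predictor on top of $h$, and $h'\in\mathcal H$ arbitrary, $$d_{\mathcal F^{\mathrm p},f^{\mathrm p}}(h';h)=\inf_{f'\in\mathcal F^{\mathrm p}}\mathbb E_{x^{\mathrm p},y^{\mathrm p}}\big[\ell(f'\circ h'(x^{\mathrm p}),y^{\mathrm p})-\ell(f^{\mathrm p}\circ h(x^{\mathrm p}),y^{\mathrm p})\big],$$ $$d_{\mathcal F^{\mathrm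 d}}(h';h)=\sup_{f^{\mathrm d}}\inf_{f'\in\mathcal F^{\mathrm d}}\mathbb E_{x^{\mathrm d},y^{\mathrm d}}\big[\ell(f'\circ h'(x^{\mathrm d}),y^{\mathrm d})-\ell(f^{\mathrm d}\circ h(x^{\mathrm d}),y^{\mathrm d})\big],$$ the supremum being over $f^{\mathrm d}\in\mathcal F^{\mathrm d}$ that are optimal (downstream) predictors on top of $h$. The diversity parameter $\nu>0$ is the largest constant with $d_{\mathcal F^{\mathrm d}}(h';h)\le d_{\mathcal F^{\mathrm p},f^{\mathrm p}}(h';h)/\nu$ for all $h'\in\mathcal H$. Gaussian complexity. For a class $\mathcal Q$ of functions into $\mathbb R^q$ and points $x_1,\dots,x_N$, $\hat G_N(\mathcal Q)=\mathbb E_g\big[\sup_{Q\in\mathcal Q}\frac1N\sum_{j=1}^q\sum_{i=1}^N g_{ji}Q_j(x_i)\big]$ with $g_{ji}$ i.i.d. $\mathcal N(0,1)$; $G_N(\mathcal Q)=\mathbb E\,\hat G_N(\mathcal Q)$, expectation over i.i.d. points ($G_n(\mathcal H)$ uses the pre-training input distribution). Worst-case versions: $\bar G_n(\mathcal F^{\mathrm p})=\max\hat G_n(\mathcal F^{\mathrm p}\mid h(x_1),\dots,h(x_n))$, i.e. the empirical complexity of $\mathcal F^{\mathrm p}$ at the points $h(x_1),\dots,h(x_n)$, maximized over $h\in\mathcal H$, $x_i\in\mathcal X^{\mathrm p}$; $\bar G_m(\mathcal F^{\mathrm d})$ is defined likewise with $\mathcal F^{\mathrm d},\mathcal X^{\mathrm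 d},m$.
   Formalization: All functions in H, F^p, F^d are Borel; H (on X^p) and F^d are assumed pointwise separable (each member is a pointwise limit of a sequence from a countable subclass), since the claim can fail without this; the Transfer Learning Risk is assumed measurable. *)

theory Defs
  imports "HOL-Probability.Probability"
begin

text \<open>The dimensions occur under the quantifier of the universal constant, so they are numbers and
  not types: an element of \<open>\<real>\<^sup>q\<close> is a function on the naturals that is extensional on \<open>{..<q}\<close>,
  and \<open>space (Rn q)\<close> is \<open>\<real>\<^sup>q\<close> with its Borel sets. A map out of \<open>\<real>\<^sup>q\<close> is a total HOL function
  whose values outside \<open>space (Rn q)\<close> are irrelevant.\<close>

type_synonym vec = "nat \<Rightarrow> real"
type_synonym sample = "nat \<Rightarrow> vec \<times> vec"

definition Rn :: "nat \<Rightarrow> vec measure" where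
  "Rn q = PiM {..<q} (\<lambda>_. borel)"

definition euclid_norm :: "nat \<Rightarrow> vec \<Rightarrow> real" where
  "euclid_norm q u = L2_set u {..<q}"

definition euclid_dist :: "nat \<Rightarrow> vec \<Rightarrow> vec \<Rightarrow> real" where
  "euclid_dist q u v = L2_set (\<lambda>i. u i - v i) {..<q}"

definition cube :: "nat \<Rightarrow> vec set" where
  "cube q = {..<q} \<rightarrow>\<^sub>E {0, 1}"

text \<open>Labels of a task with \<open>q + 1\<close> classes; the index \<open>c = q\<close> yields the zero vector, which
  encodes the last class.\<close>

definition one_hot :: "nat \<Rightarrow> vec set" where
  "one_hot q = (\<lambda>c. \<lambda>i\<in>{..<q}. if i = c then 1 else 0) ` {..q}"

text \<open>A task on \<open>X \<subseteq> \<real>\<^sup>d\<close> with labels in \<open>{0,1}\<^sup>q\<close> is the law of a pair (input, label). The equality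
  of \<open>\<sigma>\<close>-algebras includes \<open>space P = X \<times> one_hot q\<close>. \<open>X\<close> need not be a Borel set: it carries the
  trace \<open>\<sigma>\<close>-algebra.\<close>

definition input_space :: "nat \<Rightarrow> vec set \<Rightarrow> vec measure" where
  "input_space d X = restrict_space (Rn d) X"

definition classification_task :: "nat \<Rightarrow> nat \<Rightarrow> vec set \<Rightarrow> (vec \<times> vec) measure \<Rightarrow> bool" where
  "classification_task d q X P \<longleftrightarrow>
     X \<subseteq> space (Rn d) \<and> prob_space P \<and>
     sets P = sets (input_space d X \<Otimes>\<^sub>M count_space (one_hot q))"

definition input_marginal :: "nat \<Rightarrow> vec set \<Rightarrow> (vec \<times> vec) measure \<Rightarrow> vec measure" where
  "input_marginal d X P = distr P (input_space d X) fst"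

definition bounded_loss :: "nat \<Rightarrow> real \<Rightarrow> (vec \<Rightarrow> vec \<Rightarrow> real) \<Rightarrow> bool" where
  "bounded_loss q B l \<longleftrightarrow> (\<forall>u\<in>space (Rn q). \<forall>y\<in>cube q. \<bar>l u y\<bar> \<le> B)"

definition lipschitz_loss :: "nat \<Rightarrow> real \<Rightarrow> (vec \<Rightarrow> vec \<Rightarrow> real) \<Rightarrow> bool" where
  "lipschitz_loss q L l \<longleftrightarrow> 0 \<le> L \<and>
     (\<forall>y\<in>cube q. \<forall>u\<in>space (Rn q). \<forall>v\<in>space (Rn q). \<bar>l u y - l v y\<bar> \<le> L * euclid_dist q u v)"

definition lipschitz_map :: "nat \<Rightarrow> nat \<Rightarrow> real \<Rightarrow> (vec \<Rightarrow> vec) \<Rightarrow> bool" where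
  "lipschitz_map r q L f \<longleftrightarrow> 0 \<le> L \<and>
     (\<forall>u\<in>space (Rn r). \<forall>v\<in>space (Rn r). euclid_dist q (f u) (f v) \<le> L * euclid_dist r u v)"

definition risk :: "(vec \<times> vec) measure \<Rightarrow> (vec \<Rightarrow> vec \<Rightarrow> real) \<Rightarrow> (vec \<Rightarrow> vec) \<Rightarrow> real" where
  "risk P l g = (\<integral>z. l (g (fst z)) (snd z) \<partial>P)"

definition emp_risk :: "nat \<Rightarrow> (vec \<Rightarrow> vec \<Rightarrow> real) \<Rightarrow> sample \<Rightarrow> (vec \<Rightarrow> vec) \<Rightarrow> real" where
  "emp_risk N l S g = (\<Sum>i<N. l (g (fst (S i))) (snd (S i))) / real N"

definition optimal_predictor ::
  "nat \<Rightarrow> nat \<Rightarrow> (vec \<times> vec) measure \<Rightarrow> (vec \<Rightarrow> vec \<Rightarrow> real) \<Rightarrow> (vec \<Rightarrow> vec) \<Rightarrow> bool" where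
  "optimal_predictor d q P l g \<longleftrightarrow> is_arg_min (risk P l) (\<lambda>g. g \<in> Rn d \<rightarrow>\<^sub>M Rn q) g"

text \<open>The inner minimum over \<open>F\<close> is written as an infimum, so it need not be attained.\<close>

definition erm_representation ::
  "nat \<Rightarrow> (vec \<Rightarrow> vec \<Rightarrow> real) \<Rightarrow> (vec \<Rightarrow> vec) set \<Rightarrow> (vec \<Rightarrow> vec) set \<Rightarrow> sample \<Rightarrow> (vec \<Rightarrow> vec) \<Rightarrow> bool" where
  "erm_representation n l F H S h \<longleftrightarrow>
     is_arg_min (\<lambda>h. INF f\<in>F. emp_risk n l S (f \<circ> h)) (\<lambda>h. h \<in> H) h"

definition erm_predictor ::
  "nat \<Rightarrow> (vec \<Rightarrow> vec \<Rightarrow> real) \<Rightarrow> (vec \<Rightarrow> vec) set \<Rightarrow> (vec \<Rightarrow> vec) \<Rightarrow> sample \<Rightarrow> (vec \<Rightarrow> vec) \<Rightarrow> bool" where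
  "erm_predictor m l F h S f \<longleftrightarrow>
     is_arg_min (\<lambda>f. emp_risk m l S (f \<circ> h)) (\<lambda>f. f \<in> F) f"

definition rep_difference ::
  "(vec \<times> vec) measure \<Rightarrow> (vec \<Rightarrow> vec \<Rightarrow> real) \<Rightarrow> (vec \<Rightarrow> vec) set \<Rightarrow> (vec \<Rightarrow> vec)
    \<Rightarrow> (vec \<Rightarrow> vec) \<Rightarrow> (vec \<Rightarrow> vec) \<Rightarrow> real" where
  "rep_difference P l F f h' h =
     (INF f'\<in>F. \<integral>z. l (f' (h' (fst z))) (snd z) - l (f (h (fst z))) (snd z) \<partial>P)"

definition worst_rep_difference ::
  "(vec \<times> vec) measure \<Rightarrow> (vec \<Rightarrow> vec \<Rightarrow> real) \<Rightarrow> (vec \<Rightarrow> vec) set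
    \<Rightarrow> (vec \<Rightarrow> vec) \<Rightarrow> (vec \<Rightarrow> vec) \<Rightarrow> real" where
  "worst_rep_difference P l F h' h =
     (SUP f\<in>{f. is_arg_min (\<lambda>f. risk P l (f \<circ> h)) (\<lambda>f. f \<in> F) f}. rep_difference P l F f h' h)"

definition diversity_parameter ::
  "(vec \<times> vec) measure \<Rightarrow> (vec \<Rightarrow> vec \<Rightarrow> real) \<Rightarrow> (vec \<Rightarrow> vec) set \<Rightarrow> (vec \<Rightarrow> vec)
    \<Rightarrow> (vec \<times> vec) measure \<Rightarrow> (vec \<Rightarrow> vec \<Rightarrow> real) \<Rightarrow> (vec \<Rightarrow> vec) set
    \<Rightarrow> (vec \<Rightarrow> vec) set \<Rightarrow> (vec \<Rightarrow> vec) \<Rightarrow> real \<Rightarrow> bool" where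
  "diversity_parameter P lp Fp fp Q ld Fd H h \<nu> \<longleftrightarrow>
     is_arg_max (\<lambda>\<nu>. \<nu>)
       (\<lambda>\<nu>. 0 < \<nu> \<and> (\<forall>h'\<in>H. worst_rep_difference Q ld Fd h' h \<le> rep_difference P lp Fp fp h' h / \<nu>)) \<nu>"

text \<open>Expectation of an extended-real random variable. The Gaussian complexity of a class that is not
  bounded on the sample can be \<open>\<infinity>\<close>, and for such a class the Bochner integral (and the supremum
  in \<open>real\<close>) would return a meaningless finite value.\<close>

definition eexpectation :: "'a measure \<Rightarrow> ('a \<Rightarrow> ereal) \<Rightarrow> ereal" where
  "eexpectation M X =
     enn2ereal (\<integral>\<^sup>+\<omega>. e2ennreal (X \<omega>) \<partial>M) - enn2ereal (\<integral>\<^sup>+\<omega>. e2ennreal (- X \<omega>) \<partial>M)"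

definition emp_gaussian_complexity :: "nat \<Rightarrow> nat \<Rightarrow> (vec \<Rightarrow> vec) set \<Rightarrow> (nat \<Rightarrow> vec) \<Rightarrow> ereal" where
  "emp_gaussian_complexity N q \<Q> x =
     eexpectation (PiM ({..<q} \<times> {..<N}) (\<lambda>_. std_normal_distribution))
       (\<lambda>g. SUP f\<in>\<Q>. ereal (1 / real N * (\<Sum>j<q. \<Sum>i<N. g (j, i) * f (x i) j)))"

definition gaussian_complexity :: "nat \<Rightarrow> nat \<Rightarrow> (vec \<Rightarrow> vec) set \<Rightarrow> vec measure \<Rightarrow> ereal" where
  "gaussian_complexity N q \<Q> D =
     eexpectation (PiM {..<N} (\<lambda>_. D)) (emp_gaussian_complexity N q \<Q>)"

definition worst_gaussian_complexity ::
  "nat \<Rightarrow> nat \<Rightarrow> (vec \<Rightarrow> vec) set \<Rightarrow> (vec \<Rightarrow> vec) set \<Rightarrow> vec set \<Rightarrow> ereal" where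
  "worst_gaussian_complexity N q F H X =
     (SUP h\<in>H. SUP x\<in>{..<N} \<rightarrow>\<^sub>E X. emp_gaussian_complexity N q F (\<lambda>i. h (x i)))"

text \<open>The usual pointwise measurability of a function class. It makes the suprema over the class,
  whose expectations enter the Gaussian complexities, random variables.\<close>

definition pointwise_separable :: "nat \<Rightarrow> vec set \<Rightarrow> (vec \<Rightarrow> vec) set \<Rightarrow> bool" where
  "pointwise_separable q X \<Q> \<longleftrightarrow>
     (\<exists>\<Q>\<^sub>0\<subseteq>\<Q>. countable \<Q>\<^sub>0 \<and>
       (\<forall>f\<in>\<Q>. \<exists>s. range s \<subseteq> \<Q>\<^sub>0 \<and> (\<forall>x\<in>X. \<forall>j<q. (\<lambda>t. s t x j) \<longlonglongrightarrow> f x j)))"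

text \<open>Predictors of the \<open>k\<close>-class pre-training task take values in \<open>\<real>\<^sup>k\<^sup>-\<^sup>1\<close>, those of the \<open>k'\<close>-class
  downstream task in \<open>\<real>\<close> to the power \<open>k' - 1\<close>. \<open>P\<close> and \<open>Q\<close> are the laws of one pre-training and one
  downstream example. The algorithm's output \<open>h_hat\<close> depends on the pre-training sample only,
  \<open>f_hat\<close> on both samples.\<close>

locale transfer_learning =
  fixes d r k k' n m :: nat
    and Xp Xd :: "vec set"
    and P Q :: "(vec \<times> vec) measure"
    and lp ld :: "vec \<Rightarrow> vec \<Rightarrow> real"
    and H Fp Fd :: "(vec \<Rightarrow> vec) set"
    and Bp Bd Lp Ld LF Dp Dd :: real
    and gp gd h fp fd :: "vec \<Rightarrow> vec"
    and \<nu> :: real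
    and h_hat :: "sample \<Rightarrow> vec \<Rightarrow> vec"
    and f_hat :: "sample \<Rightarrow> sample \<Rightarrow> vec \<Rightarrow> vec"
  assumes sizes: "1 \<le> k" "1 \<le> k'" "1 \<le> n" "1 \<le> m"
    and tasks: "classification_task d (k - 1) Xp P" "classification_task d (k' - 1) Xd Q"
    and classes: "H \<subseteq> Rn d \<rightarrow>\<^sub>M Rn r" "Fp \<subseteq> Rn r \<rightarrow>\<^sub>M Rn (k - 1)" "Fd \<subseteq> Rn r \<rightarrow>\<^sub>M Rn (k' - 1)"
    and separable: "pointwise_separable r Xp H" "pointwise_separable (k' - 1) (space (Rn r)) Fd"
    and optimal: "optimal_predictor d (k - 1) P lp gp" "optimal_predictor d (k' - 1) Q ld gd"
    and realizable: "h \<in> H" "fp \<in> Fp" "fd \<in> Fd"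
      "\<forall>x\<in>space (Rn d). gp x = fp (h x)" "\<forall>x\<in>space (Rn d). gd x = fd (h x)"
    and pretraining_loss: "bounded_loss (k - 1) Bp lp" "lipschitz_loss (k - 1) Lp lp"
    and downstream_loss: "bounded_loss (k' - 1) Bd ld" "lipschitz_loss (k' - 1) Ld ld"
    and lipschitz_predictors: "\<forall>f\<in>Fp. lipschitz_map r (k - 1) LF f"
    and bounded_pretraining: "\<forall>x\<in>Xp. \<forall>h'\<in>H. \<forall>f\<in>Fp. euclid_norm (k - 1) (f (h' x)) \<le> Dp"
    and bounded_downstream: "\<forall>x\<in>Xd. \<forall>h'\<in>H. \<forall>f\<in>Fd. euclid_norm (k' - 1) (f (h' x)) \<le> Dd"
    and diversity: "diversity_parameter P lp Fp fp Q ld Fd H h \<nu>"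
    and erm: "\<forall>S\<in>space (PiM {..<n} (\<lambda>_. P)). erm_representation n lp Fp H S (h_hat S)"
      "\<forall>S\<in>space (PiM {..<n} (\<lambda>_. P)). \<forall>T\<in>space (PiM {..<m} (\<lambda>_. Q)).
         erm_predictor m ld Fd (h_hat S) T (f_hat S T)"
    and random_risk: "(\<lambda>(S, T). risk Q ld (f_hat S T \<circ> h_hat S))
         \<in> borel_measurable (PiM {..<n} (\<lambda>_. P) \<Otimes>\<^sub>M PiM {..<m} (\<lambda>_. Q))"

end

theory Submission
  imports Defs
begin

text \<open>Since \<open>g\<^sup>d\<close> is optimal and realizable on top of \<open>h\<close>, the excess risk is at most
  \<open>A(S) / \<nu> + B(S, T)\<close>, where \<open>A(S)\<close> is the representation difference of the empirical minimizer,
  hence at most a uniform deviation of empirical from true risk over \<open>F\<^sup>p \<circ> H\<close>, and \<open>B(S, T)\<close>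
  is a uniform deviation over \<open>F\<^sup>d \<circ> h_hat S\<close>. Both have subgaussian exponential moments by bounded
  differences, and their means are bounded by symmetrization and contraction in terms of Gaussian
  widths. The moments are multiplied by integrating over \<open>T\<close> first, and Chernoff's bound is
  applied once: a union bound over two events would replace \<open>ln (1 / \<delta>)\<close> by
  \<open>ln (2 / \<delta>)\<close>, which is not comparable to it as \<open>\<delta>\<close> tends to 1.

  The width of \<open>F\<^sup>p \<circ> H\<close> is bounded by chaining over \<open>O(log n)\<close> scales. A net of \<open>F\<^sup>p \<circ> H\<close> is
  assembled from a net of \<open>H\<close> and, for each of its elements, a net of \<open>F\<^sup>p\<close>; Sudakov's minoration
  bounds the size of both by the widths of \<open>H\<close> and \<open>F\<^sup>p\<close>, so that every scale contributes the
  same amount, and the finest scale leaves the remainder of order \<open>1 / n\<^sup>2\<close>.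

  All suprema are taken over finite subclasses exhausting a countable dense one, and the limit is
  taken in the exponential moments by monotone convergence.\<close>

section \<open>Gaussian vectors\<close>

text \<open>Three obstacles shape the estimates. The bound contains the complexities of
  \<open>H\<close> and \<open>Fp\<close> separately, while the sample sees only compositions;
  \<open>worst_gaussian_complexity\<close> controls \<open>Fp\<close> at one frozen representation
  at a time, so nets of \<open>Fp\<close> are rebuilt at every element of a net of \<open>H\<close>.
  Sudakov's bound gives logarithms of covering numbers of order
  \<open>(V / \<epsilon>)\<^sup>2\<close>, for which the entropy integral diverges logarithmically
  at 0; hence the chain is cut at a finest scale, and \<open>ln n\<close> counts the dyadic scales
  above it. Finally, complexities live in \<open>ereal\<close> and may be infinite, where
  \<open>0 * \<infinity> = 0\<close>, so vanishing Lipschitz constants and \<open>n = 1\<close>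
  require separate arguments.

  The main constant is a product: 2005 per scale, 5 for the number of scales in units of
  \<open>ln n\<close>, and 3 for \<open>sqrt (2 * pi)\<close> in the contraction. This gives 30075,
  rounded up to 40000.\<close>

abbreviation gaussian :: "'i set \<Rightarrow> ('i \<Rightarrow> real) measure" where
  "gaussian I \<equiv> PiM I (\<lambda>_. std_normal_distribution)"

definition dotp :: "'i set \<Rightarrow> ('i \<Rightarrow> real) \<Rightarrow> ('i \<Rightarrow> real) \<Rightarrow> real" where
  "dotp I g v = (\<Sum>i\<in>I. g i * v i)"

lemma dotp_diff_right: "dotp I g (\<lambda>i. u i - v i) = dotp I g u - dotp I g v"
  and dotp_uminus_right: "dotp I g (\<lambda>i. - u i) = - dotp I g u"
  and dotp_scale_right: "dotp I g (\<lambda>i. c * u i) = c * dotp I g u"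
  by (simp_all add: dotp_def sum_subtractf sum.distrib algebra_simps sum_negf sum_distrib_left)

lemma dotp_cong: "(\<And>i. i \<in> I \<Longrightarrow> g i = g' i) \<Longrightarrow> (\<And>i. i \<in> I \<Longrightarrow> v i = v' i) \<Longrightarrow> dotp I g v = dotp I g' v'"
  by (simp add: dotp_def)

lemma dotp_le_L2: "dotp I g v \<le> L2_set g I * L2_set v I"
proof -
  have "dotp I g v \<le> (\<Sum>i\<in>I. \<bar>g i\<bar> * \<bar>v i\<bar>)"
    unfolding dotp_def by (intro sum_mono) (metis abs_ge_self abs_mult)
  also have "\<dots> \<le> L2_set g I * L2_set v I" by (rule L2_set_mult_ineq)
  finally show ?thesis .
qed

interpretation std_normal: prob_space std_normal_distribution
  using real_dist_normal_dist real_distribution.axioms(1) by blast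

interpretation std_normal_product: product_sigma_finite "\<lambda>_. std_normal_distribution"
  by (intro product_sigma_finite.intro std_normal.sigma_finite_measure_axioms)

lemma prob_space_gaussian [simp]: "prob_space (gaussian I)"
  by (intro prob_space_PiM std_normal.prob_space_axioms)

lemma measurable_gaussian_component: "i \<in> I \<Longrightarrow> (\<lambda>g. g i) \<in> borel_measurable (gaussian I)"
  using measurable_component_singleton[of i I "\<lambda>_. std_normal_distribution"] by simp

lemma measurable_dotp [measurable]: "(\<lambda>g. dotp I g v) \<in> borel_measurable (gaussian I)"
  unfolding dotp_def by (intro borel_measurable_sum borel_measurable_times measurable_gaussian_component) auto

section \<open>Moments of Gaussian linear forms\<close>

lemma nn_integral_std_normal_exp:
  "(\<integral>\<^sup>+x. ennreal (exp (a * x)) \<partial>std_normal_distribution) = ennreal (exp (a\<^sup>2 / 2))"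
proof -
  have "(\<integral>\<^sup>+x. ennreal (exp (a * x)) \<partial>std_normal_distribution)
      = (\<integral>\<^sup>+x. ennreal (std_normal_density x) * ennreal (exp (a * x)) \<partial>lborel)"
    by (subst nn_integral_density) auto
  also have "\<dots> = (\<integral>\<^sup>+x. ennreal (exp (a\<^sup>2 / 2)) * ennreal (normal_density a 1 x) \<partial>lborel)"
  proof (intro nn_integral_cong)
    fix x :: real
    have "std_normal_density x * exp (a * x) = exp (a\<^sup>2 / 2) * normal_density a 1 x"
    proof -
      have "- x\<^sup>2 / 2 + a * x = a\<^sup>2 / 2 + - (x - a)\<^sup>2 / 2"
        by (simp add: power2_eq_square field_simps)
      then have "exp (- x\<^sup>2 / 2) * exp (a * x) = exp (a\<^sup>2 / 2) * exp (- (x - a)\<^sup>2 / 2)"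
        by (metis exp_add)
      then show ?thesis by (simp add: normal_density_def)
    qed
    then show "ennreal (std_normal_density x) * ennreal (exp (a * x)) = ennreal (exp (a\<^sup>2 / 2)) * ennreal (normal_density a 1 x)"
      by (simp add: ennreal_mult[symmetric])
  qed
  also have "\<dots> = ennreal (exp (a\<^sup>2 / 2)) * (\<integral>\<^sup>+x. ennreal (normal_density a 1 x) \<partial>lborel)"
    by (subst nn_integral_cmult) auto
  also have "(\<integral>\<^sup>+x. ennreal (normal_density a 1 x) \<partial>lborel) = 1"
    using prob_space.emeasure_space_1[OF prob_space_normal_density[of 1 a]]
    by (simp add: emeasure_density)
  finally show ?thesis by simp
qed

lemma nn_integral_gaussian_exp:
  assumes [simp]: "finite I"
  shows "(\<integral>\<^sup>+g. ennreal (exp (dotp I g v)) \<partial>gaussian I) = ennreal (exp ((L2_set v I)\<^sup>2 / 2))"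
proof -
  have "(\<integral>\<^sup>+g. ennreal (exp (dotp I g v)) \<partial>gaussian I)
      = (\<integral>\<^sup>+g. (\<Prod>i\<in>I. ennreal (exp (v i * g i))) \<partial>gaussian I)"
    by (simp add: dotp_def exp_sum prod_ennreal mult.commute)
  also have "\<dots> = (\<Prod>i\<in>I. \<integral>\<^sup>+x. ennreal (exp (v i * x)) \<partial>std_normal_distribution)"
    by (subst std_normal_product.product_nn_integral_prod) auto
  also have "\<dots> = (\<Prod>i\<in>I. ennreal (exp ((v i)\<^sup>2 / 2)))"
    by (simp only: nn_integral_std_normal_exp)
  also have "\<dots> = ennreal (exp ((L2_set v I)\<^sup>2 / 2))"
    by (simp add: prod_ennreal L2_set_def sum_nonneg exp_sum sum_divide_distrib)
  finally show ?thesis .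
qed

lemma integrable_gaussian_exp:
  assumes "finite I" shows "integrable (gaussian I) (\<lambda>g. exp (dotp I g v))"
proof (rule integrableI_bounded)
  show "(\<lambda>g. exp (dotp I g v)) \<in> borel_measurable (gaussian I)" by measurable
  show "(\<integral>\<^sup>+g. ennreal (norm (exp (dotp I g v))) \<partial>gaussian I) < \<infinity>"
    using nn_integral_gaussian_exp[OF assms, of v] by simp
qed

lemma integral_gaussian_exp:
  assumes "finite I" shows "(\<integral>g. exp (dotp I g v) \<partial>gaussian I) = exp ((L2_set v I)\<^sup>2 / 2)"
  using nn_integral_gaussian_exp[OF assms, of v]
  by (subst integral_eq_nn_integral) simp_all

lemma integrable_gaussian_component:
  assumes "i \<in> I" shows "integrable (gaussian I) (\<lambda>g. g i ^ k)"
proof -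
  have "integrable std_normal_distribution (\<lambda>x. x ^ k)"
    by (rule integrable_std_normal_distribution_moment)
  then have "integrable (distr (gaussian I) std_normal_distribution (\<lambda>g. g i)) (\<lambda>x. x ^ k)"
    using distr_PiM_component[of I "\<lambda>_. std_normal_distribution" i] assms by (simp add: std_normal.prob_space_axioms)
  then show ?thesis
    by (rule integrable_distr[rotated]) (use assms in measurable)
qed

lemma integrable_dotp: "integrable (gaussian I) (\<lambda>g. dotp I g v)"
  unfolding dotp_def
  by (intro Bochner_Integration.integrable_sum integrable_mult_left)
     (use integrable_gaussian_component[where k = 1] in simp)

lemma integral_gaussian_component_power2:
  assumes "i \<in> I" shows "(\<integral>g. (g i)\<^sup>2 \<partial>gaussian I) = 1"
proof -
  have "(\<integral>g. (g i)\<^sup>2 \<partial>gaussian I) = (\<integral>x. x\<^sup>2 \<partial>distr (gaussian I) std_normal_distribution (\<lambda>g. g i))"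
    by (subst integral_distr) (use assms in \<open>auto intro!: measurable_component_singleton\<close>)
  also have "\<dots> = (\<integral>x. x\<^sup>2 \<partial>std_normal_distribution)"
    using distr_PiM_component[of I "\<lambda>_. std_normal_distribution" i] assms by (simp add: std_normal.prob_space_axioms)
  also have "\<dots> = 1"
    using std_normal_distribution_even_moments(1)[of 1] by simp
  finally show ?thesis .
qed

text \<open>Reflection and translation, the two changes of variables used below, act on each
  coordinate separately with a density on each factor. Both sides therefore factor on boxes, and
  boxes determine a finite measure on the product.\<close>

lemma distr_gaussian_componentwise:
  assumes [simp]: "finite I" and T: "\<And>i. i \<in> I \<Longrightarrow> T i \<in> borel_measurable borel"
    and eq: "\<And>i. i \<in> I \<Longrightarrow> distr std_normal_distribution borel (T i) = density std_normal_distribution (\<lambda>x. ennreal (\<phi> i x))"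
    and \<phi>: "\<And>i. i \<in> I \<Longrightarrow> \<phi> i \<in> borel_measurable borel" "\<And>i x. 0 \<le> \<phi> i x"
  shows "distr (gaussian I) (gaussian I) (\<lambda>g. \<lambda>i\<in>I. T i (g i)) = density (gaussian I) (\<lambda>g. ennreal (\<Prod>i\<in>I. \<phi> i (g i)))"
proof -
  note T[measurable] \<phi>(1)[measurable]
  have [measurable]: "(\<lambda>g. \<lambda>i\<in>I. T i (g i)) \<in> gaussian I \<rightarrow>\<^sub>M gaussian I"
    by (intro measurable_restrict) simp
  have box: "emeasure (distr (gaussian I) (gaussian I) (\<lambda>g. \<lambda>i\<in>I. T i (g i))) (Pi\<^sub>E I A)
      = emeasure (density (gaussian I) (\<lambda>g. ennreal (\<Prod>i\<in>I. \<phi> i (g i)))) (Pi\<^sub>E I A)"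
    if A: "\<And>i. i \<in> I \<Longrightarrow> A i \<in> sets std_normal_distribution" for A
  proof -
    have A': "\<And>i. i \<in> I \<Longrightarrow> A i \<in> sets borel" using A by simp
    note A'[measurable]
    have "(\<lambda>g. \<lambda>i\<in>I. T i (g i)) -` (Pi\<^sub>E I A) \<inter> space (gaussian I) = (\<Pi>\<^sub>E i\<in>I. T i -` A i)"
      by (auto simp: space_PiM PiE_iff extensional_def split: if_splits)
    then have "emeasure (distr (gaussian I) (gaussian I) (\<lambda>g. \<lambda>i\<in>I. T i (g i))) (Pi\<^sub>E I A)
        = emeasure (gaussian I) (\<Pi>\<^sub>E i\<in>I. T i -` A i)"
      using A by (subst emeasure_distr) (auto intro!: sets_PiM_I_finite)
    also have "\<dots> = (\<Prod>i\<in>I. emeasure std_normal_distribution (T i -` A i))"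
      using T A' by (subst std_normal_product.emeasure_PiM) (auto intro!: measurable_sets_borel[where M = borel])
    also have "\<dots> = (\<Prod>i\<in>I. emeasure (distr std_normal_distribution borel (T i)) (A i))"
      using T A' by (intro prod.cong refl) (subst emeasure_distr, auto)
    also have "\<dots> = (\<Prod>i\<in>I. \<integral>\<^sup>+x. ennreal (\<phi> i x) * indicator (A i) x \<partial>std_normal_distribution)"
      using \<phi> A' by (intro prod.cong refl) (simp add: eq, subst emeasure_density, auto)
    also have "\<dots> = (\<integral>\<^sup>+g. (\<Prod>i\<in>I. ennreal (\<phi> i (g i)) * indicator (A i) (g i)) \<partial>gaussian I)"
      by (subst std_normal_product.product_nn_integral_prod) auto
    also have "\<dots> = (\<integral>\<^sup>+g. ennreal (\<Prod>i\<in>I. \<phi> i (g i)) * indicator (Pi\<^sub>E I A) g \<partial>gaussian I)"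
    proof (intro nn_integral_cong)
      fix g assume g: "g \<in> space (gaussian I)"
      have "(\<Prod>i\<in>I. indicator (A i) (g i) :: ennreal) = indicator (Pi\<^sub>E I A) g"
      proof (cases "g \<in> Pi\<^sub>E I A")
        case False
        then obtain i where "i \<in> I" "g i \<notin> A i"
          using g by (auto simp: space_PiM PiE_iff)
        then have "(\<Prod>i\<in>I. indicator (A i) (g i) :: ennreal) = 0"
          by (intro prod_zero) (auto intro!: bexI[of _ i])
        then show ?thesis using False by simp
      qed (auto simp: PiE_iff)
      then show "(\<Prod>i\<in>I. ennreal (\<phi> i (g i)) * indicator (A i) (g i)) = ennreal (\<Prod>i\<in>I. \<phi> i (g i)) * indicator (Pi\<^sub>E I A) g"
        by (simp add: prod.distrib prod_ennreal \<phi>(2))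
    qed
    also have "\<dots> = emeasure (density (gaussian I) (\<lambda>g. ennreal (\<Prod>i\<in>I. \<phi> i (g i)))) (Pi\<^sub>E I A)"
      using A by (subst emeasure_density) (auto intro!: sets_PiM_I_finite borel_measurable_prod measurable_compose[OF measurable_gaussian_component \<phi>(1)])
    finally show ?thesis .
  qed
  show ?thesis
  proof (rule measure_eqI_PiM_finite[OF assms(1) _ _ box, where A = "\<lambda>_. space (gaussian I)"])
    show "range (\<lambda>_. space (gaussian I)) \<subseteq> prod_algebra I (\<lambda>_. std_normal_distribution)"
      by (auto simp: space_PiM intro!: prod_algebraI_finite)
    show "emeasure (distr (gaussian I) (gaussian I) (\<lambda>g. \<lambda>i\<in>I. T i (g i))) (space (gaussian I)) \<noteq> \<infinity>"
      using prob_space.emeasure_space_1[OF prob_space.prob_space_distr[OF prob_space_gaussian, of "\<lambda>g. \<lambda>i\<in>I. T i (g i)" I "gaussian I"]]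
      by simp
  qed auto
qed

text \<open>One-dimensional Cameron-Martin formula: the density relative to the original law is read
  off from the expansion of \<open>(x + u)\<^sup>2\<close>.\<close>

lemma distr_std_normal_shift:
  "distr std_normal_distribution borel (\<lambda>x. x - u) = density std_normal_distribution (\<lambda>x. ennreal (exp (- u * x - u\<^sup>2 / 2)))"
proof -
  have "distr std_normal_distribution borel (\<lambda>x. x - u) = density lborel (\<lambda>x. ennreal (std_normal_density (x + u)))"
  proof (rule measure_eqI)
    fix A :: "real set" assume "A \<in> sets (distr std_normal_distribution borel (\<lambda>x. x - u))"
    then have [measurable]: "A \<in> sets borel" by simp
    have "emeasure (distr std_normal_distribution borel (\<lambda>x. x - u)) A
       = (\<integral>\<^sup>+x. ennreal (std_normal_density x) * indicator A (x - u) \<partial>lborel)"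
      by (subst emeasure_distr, simp, simp, subst emeasure_density)
         (auto intro!: nn_integral_cong measurable_sets_borel[where M = borel] simp: indicator_def)
    also have "\<dots> = (\<integral>\<^sup>+x. ennreal (std_normal_density (u + 1 * x)) * indicator A ((u + 1 * x) - u) \<partial>lborel)"
      by (subst nn_integral_real_affine[where c = 1 and t = u]) auto
    also have "\<dots> = emeasure (density lborel (\<lambda>x. ennreal (std_normal_density (x + u)))) A"
      by (subst emeasure_density) (auto simp: add.commute)
    finally show "emeasure (distr std_normal_distribution borel (\<lambda>x. x - u)) A
      = emeasure (density lborel (\<lambda>x. ennreal (std_normal_density (x + u)))) A" .
  qed simp
  also have "\<dots> = density lborel (\<lambda>x. ennreal (std_normal_density x) * ennreal (exp (- u * x - u\<^sup>2 / 2)))"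
  proof (intro density_cong AE_I2 impI)
    fix x :: real
    have "- (x + u)\<^sup>2 / 2 = - x\<^sup>2 / 2 + (- u * x - u\<^sup>2 / 2)"
      by (simp add: power2_eq_square field_simps)
    then have "exp (- (x + u)\<^sup>2 / 2) = exp (- x\<^sup>2 / 2) * exp (- u * x - u\<^sup>2 / 2)"
      by (metis exp_add)
    then show "ennreal (std_normal_density (x + u)) = ennreal (std_normal_density x) * ennreal (exp (- u * x - u\<^sup>2 / 2))"
      by (simp add: normal_density_def ennreal_mult[symmetric])
  qed auto
  also have "\<dots> = density std_normal_distribution (\<lambda>x. ennreal (exp (- u * x - u\<^sup>2 / 2)))"
    by (subst density_density_eq) auto
  finally show ?thesis .
qed

text \<open>The reflected law is written as a density with constant factor 1 to fit the format of
  \<open>distr_gaussian_componentwise\<close>.\<close>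

lemma distr_std_normal_uminus:
  "distr std_normal_distribution borel uminus = density std_normal_distribution (\<lambda>x. ennreal 1)"
proof -
  have "distr std_normal_distribution borel uminus = std_normal_distribution"
  proof (rule measure_eqI)
    fix A :: "real set" assume "A \<in> sets (distr std_normal_distribution borel uminus)"
    then have [measurable]: "A \<in> sets borel" by simp
    have "emeasure (distr std_normal_distribution borel uminus) A
       = (\<integral>\<^sup>+x. ennreal (std_normal_density x) * indicator A (- x) \<partial>lborel)"
      by (subst emeasure_distr, simp, simp, subst emeasure_density)
         (auto intro!: nn_integral_cong measurable_sets_borel[where M = borel] simp: indicator_def)
    also have "\<dots> = (\<integral>\<^sup>+x. ennreal (std_normal_density (0 + (-1) * x)) * indicator A (- (0 + (-1) * x)) \<partial>lborel)"
      by (subst nn_integral_real_affine[where c = "-1" and t = 0]) auto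
    also have "\<dots> = emeasure std_normal_distribution A"
      by (subst emeasure_density) (auto simp: normal_density_def)
    finally show "emeasure (distr std_normal_distribution borel uminus) A = emeasure std_normal_distribution A" .
  qed simp
  then show ?thesis by (simp add: density_1)
qed

lemma distr_gaussian_uminus:
  assumes "finite I"
  shows "distr (gaussian I) (gaussian I) (\<lambda>g. \<lambda>i\<in>I. - g i) = gaussian I"
  using distr_gaussian_componentwise[OF assms, of "\<lambda>_. uminus" "\<lambda>_ _. 1"]
  by (simp add: distr_std_normal_uminus density_1)

text \<open>Cameron-Martin formula in finite dimension, the source of the translation estimate
  behind Sudakov's minoration.\<close>

lemma distr_gaussian_shift:
  assumes "finite I"
  shows "distr (gaussian I) (gaussian I) (\<lambda>g. \<lambda>i\<in>I. g i - u i)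
      = density (gaussian I) (\<lambda>g. ennreal (exp (- dotp I g u - (L2_set u I)\<^sup>2 / 2)))"
proof -
  have *: "(\<Prod>i\<in>I. exp (- (u i * g i) - (u i)\<^sup>2 / 2)) = exp (- dotp I g u - (L2_set u I)\<^sup>2 / 2)" for g
    using assms
    by (simp add: exp_sum[symmetric] dotp_def L2_set_def sum_nonneg sum_subtractf sum_negf sum_divide_distrib mult.commute)
  show ?thesis
    using distr_gaussian_componentwise[OF assms, of "\<lambda>i x. x - u i" "\<lambda>i x. exp (- u i * x - (u i)\<^sup>2 / 2)"]
    by (simp add: distr_std_normal_shift * del: exp_diff)
qed

lemma integral_gaussian_uminus:
  fixes f :: "('i \<Rightarrow> real) \<Rightarrow> real"
  assumes "finite I" "f \<in> borel_measurable (gaussian I)"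
  shows "(\<integral>g. f (\<lambda>i\<in>I. - g i) \<partial>gaussian I) = (\<integral>g. f g \<partial>gaussian I)"
proof -
  have "(\<lambda>g. \<lambda>i\<in>I. - g i) \<in> gaussian I \<rightarrow>\<^sub>M gaussian I"
    by (intro measurable_restrict) simp
  then show ?thesis
    using integral_distr[of "\<lambda>g. \<lambda>i\<in>I. - g i" "gaussian I" "gaussian I" f] assms
    by (simp add: distr_gaussian_uminus)
qed

section \<open>Maxima of finite families\<close>

lemma Max_image_diff_le:
  fixes f g :: "'a \<Rightarrow> real"
  assumes "finite A" "A \<noteq> {}" "\<And>a. a \<in> A \<Longrightarrow> f a \<le> g a + c"
  shows "(MAX a\<in>A. f a) \<le> (MAX a\<in>A. g a) + c"
proof (rule Max.boundedI)
  fix y assume "y \<in> f ` A"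
  then obtain a where "a \<in> A" "y = f a" by auto
  moreover have "g a \<le> (MAX a\<in>A. g a)" using assms \<open>a \<in> A\<close> by simp
  ultimately show "y \<le> (MAX a\<in>A. g a) + c" using assms(3)[of a] by simp
qed (use assms in auto)

lemma Max_image_obtain:
  fixes f :: "'a \<Rightarrow> real"
  assumes "finite A" "A \<noteq> {}"
  obtains a where "a \<in> A" "(MAX a\<in>A. f a) = f a"
proof -
  have "(MAX a\<in>A. f a) \<in> f ` A" using assms by (intro Max_in) auto
  then show ?thesis using that by blast
qed

lemma abs_Max_image_le:
  fixes f :: "'a \<Rightarrow> real"
  assumes "finite A" "A \<noteq> {}"
  shows "\<bar>MAX a\<in>A. f a\<bar> \<le> (\<Sum>a\<in>A. \<bar>f a\<bar>)"
proof -
  obtain a where "a \<in> A" "(MAX a\<in>A. f a) = f a"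
    by (rule Max_image_obtain[OF assms])
  then show ?thesis using assms(1) member_le_sum[of a A "\<lambda>a. \<bar>f a\<bar>"] by auto
qed

lemma integrable_Max_image:
  fixes f :: "'a \<Rightarrow> 'b \<Rightarrow> real"
  assumes "finite A" "A \<noteq> {}" and int: "\<And>a. a \<in> A \<Longrightarrow> integrable M (f a)"
  shows "integrable M (\<lambda>x. MAX a\<in>A. f a x)"
proof (rule Bochner_Integration.integrable_bound)
  show "integrable M (\<lambda>x. \<Sum>a\<in>A. \<bar>f a x\<bar>)" using int by simp
  show "(\<lambda>x. MAX a\<in>A. f a x) \<in> borel_measurable M"
    using assms(1) int by (intro borel_measurable_Max) auto
  show "AE x in M. norm (MAX a\<in>A. f a x) \<le> norm (\<Sum>a\<in>A. \<bar>f a x\<bar>)"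
    using abs_Max_image_le[OF assms(1,2)] by (auto intro!: AE_I2 simp: order.trans[OF _ abs_ge_self])
qed

lemma ennreal_integral_le_nn_integral:
  fixes f :: "'a \<Rightarrow> real"
  assumes "integrable M f"
  shows "ennreal (\<integral>x. f x \<partial>M) \<le> (\<integral>\<^sup>+x. ennreal (f x) \<partial>M)"
proof -
  have "ennreal (\<integral>x. f x \<partial>M) \<le> ennreal (\<integral>x. max 0 (f x) \<partial>M)"
    using assms by (intro ennreal_leI integral_mono) auto
  also have "\<dots> = (\<integral>\<^sup>+x. ennreal (max 0 (f x)) \<partial>M)"
    using assms by (subst nn_integral_eq_integral) auto
  also have "\<dots> = (\<integral>\<^sup>+x. ennreal (f x) \<partial>M)"
    by (intro nn_integral_cong) (auto simp: max_def ennreal_neg)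
  finally show ?thesis .
qed

section \<open>Expected modulus of a Gaussian linear form\<close>

lemma (in prob_space) integral_abs_normal:
  assumes "distributed M lborel X (normal_density 0 \<sigma>)" "0 < \<sigma>"
  shows "(\<integral>x. \<bar>X x\<bar> \<partial>M) = sqrt (2 / pi) * \<sigma>"
proof -
  have "(\<integral>x. \<bar>X x\<bar> \<partial>M) = (\<integral>x. normal_density 0 \<sigma> x * \<bar>x\<bar> \<partial>lborel)"
    using assms by (subst distributed_integral[symmetric, where g = abs]) auto
  also have "\<dots> = sqrt (2 / pi) * \<sigma>"
    using integral_normal_moment_abs_odd[of \<sigma> 0 0] assms(2) by simp
  finally show ?thesis .
qed

lemma distributed_gaussian_component:
  assumes "i \<in> I" "0 < c"
  shows "distributed (gaussian I) lborel (\<lambda>g. g i * c) (normal_density 0 c)"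
proof -
  interpret prob_space "gaussian I" by simp
  have "distr (gaussian I) lborel (\<lambda>g. g i) = distr (gaussian I) std_normal_distribution (\<lambda>g. g i)"
    by (intro distr_cong) auto
  also have "\<dots> = std_normal_distribution"
    using distr_PiM_component[of I "\<lambda>_. std_normal_distribution" i] assms by (simp add: std_normal.prob_space_axioms)
  finally have "distributed (gaussian I) lborel (\<lambda>g. g i) std_normal_density"
    using measurable_gaussian_component[OF assms(1)] by (auto simp: distributed_def)
  from normal_density_affine[OF this, of c 0] show ?thesis
    using assms by (simp add: mult.commute)
qed

text \<open>The form is a centred normal variable with standard deviation \<open>L2_set v I\<close>,
  and \<open>sqrt (2 / pi)\<close> is the mean modulus of a standard normal one. This identity turns
  Euclidean distances into Gaussian expectations, both in the two-point bound for the width and in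
  the contraction step.\<close>

lemma integral_abs_dotp:
  assumes [simp]: "finite I"
  shows "(\<integral>g. \<bar>dotp I g v\<bar> \<partial>gaussian I) = sqrt (2 / pi) * L2_set v I"
proof -
  interpret prob_space "gaussian I" by simp
  \<comment> \<open>A coordinate with \<open>v i = 0\<close> contributes a degenerate normal
    variable without density, so summation of independent normals is applied to the others
    only.\<close>
  define J where "J = {i\<in>I. v i \<noteq> 0}"
  have J: "finite J" "J \<subseteq> I" by (auto simp: J_def)
  have L2: "L2_set v I = sqrt (\<Sum>i\<in>J. \<bar>v i\<bar>\<^sup>2)"
    unfolding L2_set_def J_def by (intro arg_cong[where f = sqrt] sum.mono_neutral_cong_right) auto
  show ?thesis
  proof (cases "J = {}")
    case True
    then have "\<And>i. i \<in> I \<Longrightarrow> v i = 0" by (auto simp: J_def)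
    then show ?thesis using L2 True by (simp add: dotp_def)
  next
    case False
    have dist: "distributed (gaussian I) lborel (\<lambda>g. g i * v i) (normal_density 0 \<bar>v i\<bar>)" if "i \<in> J" for i
    proof -
      have *: "distributed (gaussian I) lborel (\<lambda>g. g i * 1) (normal_density 0 1)"
        using that J by (intro distributed_gaussian_component) auto
      show ?thesis
        using normal_density_affine[OF *, of "v i" 0] that J_def by (simp add: mult.commute)
    qed
    have ind: "indep_vars (\<lambda>_. std_normal_distribution) (\<lambda>i g. g i) J"
    proof (rule indep_vars_subset[OF _ J(2)])
      show "indep_vars (\<lambda>_. std_normal_distribution) (\<lambda>i g. g i) I"
      proof (subst indep_vars_iff_distr_eq_PiM')
        show "I \<noteq> {}" using False J by auto
        have "distr (gaussian I) (gaussian I) (\<lambda>g. \<lambda>i\<in>I. g i) = distr (gaussian I) (gaussian I) (\<lambda>g. g)"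
          by (intro distr_cong refl) (auto simp: space_PiM PiE_restrict)
        also have "\<dots> = PiM I (\<lambda>i. distr (gaussian I) std_normal_distribution (\<lambda>g. g i))"
          using distr_PiM_component[of I "\<lambda>_. std_normal_distribution"]
          by (auto intro!: PiM_cong simp: distr_id2 std_normal.prob_space_axioms)
        finally show "distr (gaussian I) (gaussian I) (\<lambda>g. \<lambda>i\<in>I. g i)
            = PiM I (\<lambda>i. distr (gaussian I) std_normal_distribution (\<lambda>g. g i))" .
      qed (rule measurable_component_singleton)
    qed
    have "indep_vars (\<lambda>_. borel) (\<lambda>i g. g i * v i) J"
      by (rule indep_vars_compose2[OF ind, where Y = "\<lambda>i x. x * v i"]) simp
    from sum_indep_normal[OF J(1) False this _ dist]
    have "distributed (gaussian I) lborel (\<lambda>g. \<Sum>i\<in>J. g i * v i) (normal_density 0 (L2_set v I))"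
      by (simp add: L2 J_def)
    moreover have "dotp I g v = (\<Sum>i\<in>J. g i * v i)" for g
      unfolding dotp_def J_def by (intro sum.mono_neutral_cong_right) auto
    moreover have "0 < L2_set v I"
      unfolding L2 using J(1) False by (auto intro!: sum_pos simp: J_def)
    ultimately show ?thesis using integral_abs_normal by simp
  qed
qed

lemma integral_dotp [simp]:
  assumes "finite I" shows "(\<integral>g. dotp I g v \<partial>gaussian I) = 0"
proof -
  have "(\<integral>g. dotp I g v \<partial>gaussian I) = (\<integral>g. dotp I (\<lambda>i\<in>I. - g i) v \<partial>gaussian I)"
    by (rule integral_gaussian_uminus[symmetric, OF assms]) measurable
  also have "\<dots> = - (\<integral>g. dotp I g v \<partial>gaussian I)"
    by (simp add: dotp_def sum_negf)
  finally show ?thesis by simp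
qed

text \<open>The family is indexed by \<open>A\<close> rather than given as a set of vectors, so that
  approximations of one family at several scales share an index set. The width is not divided by the
  sample size.\<close>

definition gaussian_width :: "'i set \<Rightarrow> 'a set \<Rightarrow> ('a \<Rightarrow> 'i \<Rightarrow> real) \<Rightarrow> real" where
  "gaussian_width I A t = (\<integral>g. (MAX a\<in>A. dotp I g (t a)) \<partial>gaussian I)"

lemma integrable_Max_dotp:
  "finite A \<Longrightarrow> A \<noteq> {} \<Longrightarrow> integrable (gaussian I) (\<lambda>g. MAX a\<in>A. dotp I g (t a))"
  by (intro integrable_Max_image integrable_dotp)

lemma gaussian_width_subset:
  assumes "finite A" "B \<subseteq> A" "B \<noteq> {}"
  shows "gaussian_width I B t \<le> gaussian_width I A t"
  unfolding gaussian_width_def using assms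
  by (intro integral_mono integrable_Max_dotp) (auto intro!: Max_mono dest: finite_subset)

lemma gaussian_width_nonneg:
  assumes "finite I" "finite A" "A \<noteq> {}" shows "0 \<le> gaussian_width I A t"
proof -
  obtain a where "a \<in> A" using assms by auto
  then have "gaussian_width I {a} t \<le> gaussian_width I A t" using assms by (intro gaussian_width_subset) auto
  then show ?thesis using assms(1) by (simp add: gaussian_width_def)
qed

lemma gaussian_width_uminus:
  assumes "finite I" "finite A"
  shows "gaussian_width I A (\<lambda>a i. - t a i) = gaussian_width I A t"
proof -
  have "gaussian_width I A t = (\<integral>g. (MAX a\<in>A. dotp I (\<lambda>i\<in>I. - g i) (t a)) \<partial>gaussian I)"
    unfolding gaussian_width_def using assms
    by (intro integral_gaussian_uminus[symmetric] borel_measurable_Max) measurable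
  then show ?thesis by (simp add: gaussian_width_def dotp_def sum_negf)
qed

text \<open>The larger of two numbers is their mean plus half the modulus of their difference. In
  expectation the mean vanishes, which leaves \<open>sqrt (2 / pi) / 2\<close> times the distance;
  the inverse of this factor is \<open>sqrt (2 * pi)\<close>.\<close>

lemma gaussian_width_two_points:
  assumes "finite I" "finite A" "a \<in> A" "b \<in> A"
  shows "L2_set (\<lambda>i. t a i - t b i) I \<le> sqrt (2 * pi) * gaussian_width I A t"
proof -
  have "(\<integral>g. (dotp I g (t a) + dotp I g (t b) + \<bar>dotp I g (\<lambda>i. t a i - t b i)\<bar>) / 2 \<partial>gaussian I)
      \<le> gaussian_width I A t"
    unfolding gaussian_width_def
  proof (intro integral_mono integrable_Max_dotp)
    fix g
    have "dotp I g (t a) \<le> (MAX a\<in>A. dotp I g (t a))" "dotp I g (t b) \<le> (MAX a\<in>A. dotp I g (t a))"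
      using assms by auto
    then show "(dotp I g (t a) + dotp I g (t b) + \<bar>dotp I g (\<lambda>i. t a i - t b i)\<bar>) / 2 \<le> (MAX a\<in>A. dotp I g (t a))"
      by (auto simp: dotp_diff_right abs_if)
    show "integrable (gaussian I) (\<lambda>g. (dotp I g (t a) + dotp I g (t b) + \<bar>dotp I g (\<lambda>i. t a i - t b i)\<bar>) / 2)"
      using integrable_dotp[of I] by simp
  qed (use assms in auto)
  also have "(\<integral>g. (dotp I g (t a) + dotp I g (t b) + \<bar>dotp I g (\<lambda>i. t a i - t b i)\<bar>) / 2 \<partial>gaussian I)
      = sqrt (2 / pi) * L2_set (\<lambda>i. t a i - t b i) I / 2"
    using assms(1) integrable_dotp[of I]
    by (simp add: integral_abs_dotp)
  finally have "sqrt (2 * pi) * (sqrt (2 / pi) * L2_set (\<lambda>i. t a i - t b i) I / 2) \<le> sqrt (2 * pi) * gaussian_width I A t"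
    by (intro mult_left_mono) auto
  moreover have "sqrt (2 * pi) * sqrt (2 / pi) = 2"
    by (simp add: real_sqrt_mult[symmetric])
  ultimately show ?thesis by (simp add: mult.assoc[symmetric])
qed

text \<open>The logarithm is bounded by its tangent at the expectation of the partition function, which
  takes the place of Jensen's inequality.\<close>

lemma gaussian_width_le_card:
  assumes fin: "finite I" "finite A" "A \<noteq> {}" and \<sigma>: "\<And>a. a \<in> A \<Longrightarrow> L2_set (t a) I \<le> \<sigma>" and "0 < \<theta>"
  shows "gaussian_width I A t \<le> ln (card A) / \<theta> + \<theta> * \<sigma>\<^sup>2 / 2"
proof -
  \<comment> \<open>\<open>c\<close> is an upper bound for the expected partition function, and
    \<open>z / c - 1 + ln c\<close> is the tangent of the logarithm at \<open>c\<close>: after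
    integration the first term is at most 1, and only \<open>ln c\<close> remains.\<close>
  define c where "c = card A * exp ((\<theta> * \<sigma>)\<^sup>2 / 2)"
  have "0 < card A" using fin by (simp add: card_gt_0_iff)
  then have c: "0 < c" "ln c = ln (card A) + (\<theta> * \<sigma>)\<^sup>2 / 2"
    by (simp_all add: c_def ln_mult)
  have "\<theta> * gaussian_width I A t = (\<integral>g. \<theta> * (MAX a\<in>A. dotp I g (t a)) \<partial>gaussian I)"
    by (simp add: gaussian_width_def)
  also have "\<dots> \<le> (\<integral>g. (\<Sum>a\<in>A. exp (dotp I g (\<lambda>i. \<theta> * t a i))) / c - 1 + ln c \<partial>gaussian I)"
  proof (intro integral_mono)
    interpret prob_space "gaussian I" by simp
    show "integrable (gaussian I) (\<lambda>g. (\<Sum>a\<in>A. exp (dotp I g (\<lambda>i. \<theta> * t a i))) / c - 1 + ln c)"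
      by (intro Bochner_Integration.integrable_add Bochner_Integration.integrable_diff integrable_divide
          Bochner_Integration.integrable_sum integrable_gaussian_exp fin integrable_const)
    show "integrable (gaussian I) (\<lambda>g. \<theta> * (MAX a\<in>A. dotp I g (t a)))"
      using fin by (intro integrable_mult_right integrable_Max_dotp)
    fix g
    obtain a where a: "a \<in> A" "(MAX a\<in>A. dotp I g (t a)) = dotp I g (t a)"
      using Max_image_obtain[OF fin(2,3)] by metis
    have "exp (dotp I g (\<lambda>i. \<theta> * t a i)) \<le> (\<Sum>a\<in>A. exp (dotp I g (\<lambda>i. \<theta> * t a i)))"
      using a fin by (intro member_le_sum) auto
    then have "exp (\<theta> * dotp I g (t a)) / c \<le> (\<Sum>a\<in>A. exp (dotp I g (\<lambda>i. \<theta> * t a i))) / c"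
      using c by (intro divide_right_mono) (auto simp: dotp_scale_right)
    moreover have "ln (exp (\<theta> * dotp I g (t a)) / c) \<le> exp (\<theta> * dotp I g (t a)) / c - 1"
      using c by (intro ln_le_minus_one) auto
    moreover have "ln (exp (\<theta> * dotp I g (t a)) / c) = \<theta> * dotp I g (t a) - ln c"
      using c by (subst ln_div) auto
    ultimately show "\<theta> * (MAX a\<in>A. dotp I g (t a)) \<le> (\<Sum>a\<in>A. exp (dotp I g (\<lambda>i. \<theta> * t a i))) / c - 1 + ln c"
      using a by simp
  qed
  also have "\<dots> = (\<Sum>a\<in>A. exp ((L2_set (\<lambda>i. \<theta> * t a i) I)\<^sup>2 / 2)) / c - 1 + ln c"
  proof -
    interpret prob_space "gaussian I" by simp
    show ?thesis using fin by (simp add: integral_gaussian_exp integrable_gaussian_exp prob_space)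
  qed
  also have "\<dots> \<le> ln c"
  proof -
    have "exp ((L2_set (\<lambda>i. \<theta> * t a i) I)\<^sup>2 / 2) \<le> exp ((\<theta> * \<sigma>)\<^sup>2 / 2)" if "a \<in> A" for a
      using \<sigma>[OF that] \<open>0 < \<theta>\<close>
      by (auto intro!: divide_right_mono power_mono mult_left_mono simp: L2_set_right_distrib[symmetric])
    then have "(\<Sum>a\<in>A. exp ((L2_set (\<lambda>i. \<theta> * t a i) I)\<^sup>2 / 2)) \<le> c"
      unfolding c_def by (intro sum_bounded_above) auto
    then show ?thesis using c by (simp add: divide_le_eq)
  qed
  finally have "\<theta> * gaussian_width I A t \<le> ln (card A) + (\<theta> * \<sigma>)\<^sup>2 / 2" using c by simp
  then have "gaussian_width I A t \<le> (ln (card A) + (\<theta> * \<sigma>)\<^sup>2 / 2) / \<theta>"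
    using \<open>0 < \<theta>\<close> by (simp add: le_divide_eq mult.commute)
  also have "\<dots> = ln (card A) / \<theta> + \<theta> * \<sigma>\<^sup>2 / 2"
    using \<open>0 < \<theta>\<close> by (simp add: field_simps power2_eq_square)
  finally show ?thesis .
qed

text \<open>By the Cameron-Martin formula the translation introduces the density
  \<open>exp (- dotp I g u - (L2_set u I)\<^sup>2 / 2)\<close>. Since \<open>exp (- s)\<close> is at
  least \<open>1 - s\<close>, and the linear term integrates to 0 over a symmetric set, only the
  constant factor is lost.\<close>

lemma measure_gaussian_shift_ge:
  assumes [simp]: "finite I" and K[measurable]: "Measurable.pred (gaussian I) K"
    and sym: "\<And>g. K (\<lambda>i\<in>I. - g i) \<longleftrightarrow> K g"
  shows "exp (- (L2_set u I)\<^sup>2 / 2) * measure (gaussian I) {g\<in>space (gaussian I). K g}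
      \<le> measure (gaussian I) {g\<in>space (gaussian I). K (\<lambda>i\<in>I. g i - u i)}"
proof -
  interpret prob_space "gaussian I" by simp
  define c where "c = exp (- (L2_set u I)\<^sup>2 / 2)"
  define k where "k g = (if K g then 1 else 0 :: real)" for g
  have [measurable]: "k \<in> borel_measurable (gaussian I)" unfolding k_def by measurable
  have T[measurable]: "(\<lambda>g. \<lambda>i\<in>I. g i - u i) \<in> gaussian I \<rightarrow>\<^sub>M gaussian I"
    by (intro measurable_restrict) simp
  have k_sym: "k (\<lambda>i\<in>I. - g i) = k g" for g by (simp add: k_def sym)
  have int_k: "integrable (gaussian I) k"
    by (intro integrable_const_bound[where B = 1]) (auto simp: k_def)
  have int_kd: "integrable (gaussian I) (\<lambda>g. k g * dotp I g u)"
    by (intro Bochner_Integration.integrable_bound[OF integrable_dotp[of I u]]) (auto simp: k_def)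
  \<comment> \<open>The integrand is odd because \<open>k\<close> is even, so the integral equals
    its own negative.\<close>
  have "(\<integral>g. k g * dotp I g u \<partial>gaussian I) = (\<integral>g. k (\<lambda>i\<in>I. - g i) * dotp I (\<lambda>i\<in>I. - g i) u \<partial>gaussian I)"
    by (rule integral_gaussian_uminus[symmetric]) auto
  also have "\<dots> = - (\<integral>g. k g * dotp I g u \<partial>gaussian I)"
    unfolding k_sym by (simp add: dotp_def sum_negf)
  finally have odd: "(\<integral>g. k g * dotp I g u \<partial>gaussian I) = 0" by simp
  have e: "exp (- dotp I g u - (L2_set u I)\<^sup>2 / 2) = c * exp (- dotp I g u)" for g
    by (simp add: c_def exp_add[symmetric])
  have "(\<integral>\<^sup>+g. ennreal (k (\<lambda>i\<in>I. g i - u i)) \<partial>gaussian I)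
      = (\<integral>\<^sup>+g. ennreal (k g) \<partial>distr (gaussian I) (gaussian I) (\<lambda>g. \<lambda>i\<in>I. g i - u i))"
    by (subst nn_integral_distr) auto
  also have "\<dots> = (\<integral>\<^sup>+g. ennreal (c * exp (- dotp I g u)) * ennreal (k g) \<partial>gaussian I)"
    unfolding distr_gaussian_shift[OF assms(1)] e by (subst nn_integral_density) auto
  also have "\<dots> \<ge> (\<integral>\<^sup>+g. ennreal (c * (k g - k g * dotp I g u)) \<partial>gaussian I)"
  proof (intro nn_integral_mono)
    fix g
    have "1 - dotp I g u \<le> exp (- dotp I g u)" using exp_ge_add_one_self[of "- dotp I g u"] by simp
    then have "c * ((1 - dotp I g u) * k g) \<le> c * (exp (- dotp I g u) * k g)"
      by (intro mult_left_mono mult_right_mono) (auto simp: c_def k_def)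
    then have "ennreal (c * (k g - k g * dotp I g u)) \<le> ennreal (c * exp (- dotp I g u) * k g)"
      by (intro ennreal_leI) (simp add: algebra_simps)
    then show "ennreal (c * (k g - k g * dotp I g u)) \<le> ennreal (c * exp (- dotp I g u)) * ennreal (k g)"
      by (simp add: ennreal_mult[symmetric] c_def k_def)
  qed
  also (xtrans) have "(\<integral>\<^sup>+g. ennreal (c * (k g - k g * dotp I g u)) \<partial>gaussian I)
     \<ge> ennreal (\<integral>g. c * (k g - k g * dotp I g u) \<partial>gaussian I)"
    using int_k int_kd by (intro ennreal_integral_le_nn_integral) auto
  also (xtrans) have "(\<integral>g. c * (k g - k g * dotp I g u) \<partial>gaussian I) = c * (\<integral>g. k g \<partial>gaussian I)"
    using int_k int_kd odd by simp
  finally have main: "ennreal (c * (\<integral>g. k g \<partial>gaussian I)) \<le> (\<integral>\<^sup>+g. ennreal (k (\<lambda>i\<in>I. g i - u i)) \<partial>gaussian I)" .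
  have 1: "(\<integral>g. k g \<partial>gaussian I) = measure (gaussian I) {g\<in>space (gaussian I). K g}"
    by (subst Bochner_Integration.integral_cong[OF refl, where g = "indicator {g\<in>space (gaussian I). K g}"])
       (auto simp: k_def indicator_def)
  have 2: "(\<integral>\<^sup>+g. ennreal (k (\<lambda>i\<in>I. g i - u i)) \<partial>gaussian I)
      = ennreal (measure (gaussian I) {g\<in>space (gaussian I). K (\<lambda>i\<in>I. g i - u i)})"
    by (subst nn_integral_cong[where v = "indicator {g\<in>space (gaussian I). K (\<lambda>i\<in>I. g i - u i)}"])
       (auto simp: k_def indicator_def emeasure_eq_measure)
  show ?thesis using main unfolding 1 2 c_def by (simp add: ennreal_le_iff)
qed

section \<open>Sudakov minoration and chaining\<close>

definition l2_dist :: "'i set \<Rightarrow> ('i \<Rightarrow> real) \<Rightarrow> ('i \<Rightarrow> real) \<Rightarrow> real" where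
  "l2_dist I u v = L2_set (\<lambda>i. u i - v i) I"

lemma l2_dist_nonneg [simp]: "0 \<le> l2_dist I u v" by (simp add: l2_dist_def)
lemma l2_dist_self [simp]: "l2_dist I u u = 0" by (simp add: l2_dist_def L2_set_def)
lemma l2_dist_commute: "l2_dist I u v = l2_dist I v u" by (simp add: l2_dist_def L2_set_def power2_commute)
lemma l2_dist_triangle: "l2_dist I u w \<le> l2_dist I u v + l2_dist I v w"
  using L2_set_triangle_ineq[of "\<lambda>i. u i - v i" "\<lambda>i. v i - w i" I] by (simp add: l2_dist_def)

text \<open>The translates of the symmetric body \<open>K\<close> by large multiples of the separated points are
  disjoint, while the Gaussian measure of each is bounded below by the translation estimate.\<close>

lemma sudakov_local:
  assumes fin: "finite I" "finite S" and "0 < \<epsilon>"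
    and sep: "\<And>a b. a \<in> S \<Longrightarrow> b \<in> S \<Longrightarrow> a \<noteq> b \<Longrightarrow> \<epsilon> < l2_dist I (t a) (t b)"
    and near: "\<And>a. a \<in> S \<Longrightarrow> l2_dist I (t a) c \<le> 2 * \<epsilon>"
    and w: "S \<noteq> {} \<Longrightarrow> gaussian_width I S t \<le> w"
  shows "card S \<le> exp (300 * (w / \<epsilon>)\<^sup>2)"
proof (cases "\<exists>a\<in>S. \<exists>b\<in>S. a \<noteq> b")
  case False
  then have "card S \<le> 1" using fin by (auto simp: card_le_Suc0_iff_eq)
  moreover have "1 \<le> exp (300 * (w / \<epsilon>)\<^sup>2)" by simp
  ultimately show ?thesis by (meson order.trans of_nat_le_1_iff)
next
  case True
  then obtain a b where ab: "a \<in> S" "b \<in> S" "a \<noteq> b" by auto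
  then have "S \<noteq> {}" by auto
  interpret prob_space "gaussian I" by simp
  have "\<epsilon> < sqrt (2 * pi) * w"
  proof -
    have "\<epsilon> < l2_dist I (t a) (t b)" using sep ab by blast
    also have "\<dots> \<le> sqrt (2 * pi) * gaussian_width I S t"
      unfolding l2_dist_def using fin ab by (intro gaussian_width_two_points) auto
    also have "\<dots> \<le> sqrt (2 * pi) * w" using w[OF \<open>S \<noteq> {}\<close>] by (intro mult_left_mono) auto
    finally show ?thesis .
  qed
  then have "0 < w" using \<open>0 < \<epsilon>\<close> by (smt (verit) mult_nonneg_nonpos real_sqrt_ge_zero pi_ge_zero)
  \<comment> \<open>Two separated points bound \<open>w / \<epsilon>\<close> from below. This lets
    the factor 2, lost at the end because \<open>K\<close> is only known to have half of the mass,
    be absorbed by the exponent: 288 + 12 = 300.\<close>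
  have large: "1 \<le> 12 * (w / \<epsilon>)\<^sup>2"
  proof -
    have "1 < sqrt (2 * pi) * w / \<epsilon>" using \<open>\<epsilon> < sqrt (2 * pi) * w\<close> \<open>0 < \<epsilon>\<close> by simp
    then have "1\<^sup>2 \<le> (sqrt (2 * pi) * w / \<epsilon>)\<^sup>2" by (intro power_mono) auto
    also have "\<dots> = 2 * pi * (w / \<epsilon>)\<^sup>2" by (simp add: power_mult_distrib power_divide)
    also have "\<dots> \<le> 12 * (w / \<epsilon>)\<^sup>2" using pi_less_4 by (intro mult_right_mono) auto
    finally show ?thesis by simp
  qed
  \<comment> \<open>\<open>K\<close> is a multiple of the polar body of the differences
    \<open>t a - t b\<close>. The threshold is twice the bound \<open>2 * w\<close> on the expected
    spread, so Markov's inequality leaves \<open>K\<close> at least half of the mass.\<close>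
  define K where "K g \<longleftrightarrow> (\<forall>a\<in>S. \<forall>b\<in>S. \<bar>dotp I g (\<lambda>i. t a i - t b i)\<bar> \<le> 4 * w)" for g
  have K_meas[measurable]: "Measurable.pred (gaussian I) K"
    unfolding K_def using fin(2) by measurable
  have "dotp I (\<lambda>i\<in>I. - g i) v = - dotp I g v" for g v by (simp add: dotp_def sum_negf)
  then have K_sym: "K (\<lambda>i\<in>I. - g i) \<longleftrightarrow> K g" for g by (simp add: K_def)
  have half: "1 / 2 \<le> measure (gaussian I) {g\<in>space (gaussian I). K g}"
  proof -
    define M where "M g = (MAX a\<in>S. dotp I g (t a)) + (MAX a\<in>S. dotp I g (\<lambda>i. - t a i))" for g
    have M_ge: "\<bar>dotp I g (\<lambda>i. t a i - t b i)\<bar> \<le> M g" if "a \<in> S" "b \<in> S" for a b g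
    proof -
      have "dotp I g (t c) \<le> (MAX a\<in>S. dotp I g (t a))" "dotp I g (\<lambda>i. - t c i) \<le> (MAX a\<in>S. dotp I g (\<lambda>i. - t a i))"
        if "c \<in> S" for c using fin that by auto
      from this[OF that(1)] this[OF that(2)] show ?thesis
        by (auto simp: M_def dotp_diff_right dotp_uminus_right)
    qed
    have M_int: "integrable (gaussian I) M"
      unfolding M_def using fin \<open>S \<noteq> {}\<close> by (intro Bochner_Integration.integrable_add integrable_Max_dotp)
    have "(\<integral>g. M g \<partial>gaussian I) = gaussian_width I S t + gaussian_width I S (\<lambda>a i. - t a i)"
      unfolding M_def gaussian_width_def using fin \<open>S \<noteq> {}\<close>
      by (intro Bochner_Integration.integral_add integrable_Max_dotp)
    then have M_exp: "(\<integral>g. M g \<partial>gaussian I) \<le> 2 * w"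
      using w[OF \<open>S \<noteq> {}\<close>] fin by (simp add: gaussian_width_uminus)
    have "measure (gaussian I) {g\<in>space (gaussian I). \<not> K g} \<le> measure (gaussian I) {g\<in>space (gaussian I). 4 * w \<le> M g}"
    proof (rule finite_measure_mono)
      show "{g\<in>space (gaussian I). \<not> K g} \<subseteq> {g\<in>space (gaussian I). 4 * w \<le> M g}"
      proof safe
        fix g assume "\<not> K g"
        then obtain a b where "a \<in> S" "b \<in> S" "4 * w < \<bar>dotp I g (\<lambda>i. t a i - t b i)\<bar>"
          by (auto simp: K_def not_le)
        with M_ge[of a b g] show "4 * w \<le> M g" by simp
      qed
      show "{g\<in>space (gaussian I). 4 * w \<le> M g} \<in> sets (gaussian I)"
        using borel_measurable_integrable[OF M_int] by measurable
    qed
    also have "\<dots> \<le> (\<integral>g. M g \<partial>gaussian I) / (4 * w)"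
      using M_int M_ge[OF ab(1,1)] \<open>0 < w\<close>
      by (intro integral_Markov_inequality_measure[where A = "{}"]) (auto intro!: AE_I2 order.trans[OF abs_ge_zero])
    also have "\<dots> \<le> 1 / 2" using M_exp \<open>0 < w\<close> by (simp add: field_simps)
    finally show ?thesis by (subst (asm) prob_neg) auto
  qed
  \<comment> \<open>For distinct points the translation vectors differ by
    \<open>12 * w / \<epsilon>\<^sup>2\<close> times \<open>t a - t b\<close>; testing with
    \<open>t a - t b\<close> gives at least \<open>12 * w\<close>, whereas two points of
    \<open>K\<close> can differ by at most \<open>8 * w\<close> there. Centring at \<open>c\<close>
    keeps the vectors of length at most \<open>24 * (w / \<epsilon>)\<close>, and half of 24 squared
    is 288.\<close>
  define u where "u a i = 12 * w / \<epsilon>\<^sup>2 * (t a i - c i)" for a i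
  define E where "E a = {g\<in>space (gaussian I). K (\<lambda>i\<in>I. g i - u a i)}" for a
  have [measurable]: "(\<lambda>g. \<lambda>i\<in>I. g i - u a i) \<in> gaussian I \<rightarrow>\<^sub>M gaussian I" for a
    by (intro measurable_restrict) simp
  have E_sets: "E a \<in> sets (gaussian I)" for a unfolding E_def by measurable
  have E_ge: "exp (- 288 * (w / \<epsilon>)\<^sup>2) / 2 \<le> measure (gaussian I) (E a)" if "a \<in> S" for a
  proof -
    have "L2_set (u a) I = 12 * w / \<epsilon>\<^sup>2 * l2_dist I (t a) c"
      unfolding u_def l2_dist_def using \<open>0 < w\<close> by (intro L2_set_right_distrib[symmetric]) auto
    also have "\<dots> \<le> 12 * w / \<epsilon>\<^sup>2 * (2 * \<epsilon>)"
      using near[OF that] \<open>0 < w\<close> by (intro mult_left_mono) auto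
    also have "\<dots> = 24 * (w / \<epsilon>)" using \<open>0 < \<epsilon>\<close> by (simp add: field_simps power2_eq_square)
    finally have "(L2_set (u a) I)\<^sup>2 \<le> (24 * (w / \<epsilon>))\<^sup>2" by (intro power_mono) auto
    also have "(24 * (w / \<epsilon>))\<^sup>2 = 576 * (w / \<epsilon>)\<^sup>2" unfolding power_mult_distrib by simp
    finally have "exp (- 288 * (w / \<epsilon>)\<^sup>2) \<le> exp (- (L2_set (u a) I)\<^sup>2 / 2)" by simp
    then have "exp (- 288 * (w / \<epsilon>)\<^sup>2) * (1 / 2) \<le> exp (- (L2_set (u a) I)\<^sup>2 / 2) * measure (gaussian I) {g\<in>space (gaussian I). K g}"
      using half by (intro mult_mono) auto
    also have "\<dots> \<le> measure (gaussian I) (E a)"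
      unfolding E_def by (rule measure_gaussian_shift_ge[OF fin(1) K_meas K_sym])
    finally show ?thesis by simp
  qed
  have disj: "disjoint_family_on E S"
    unfolding disjoint_family_on_def
  proof (intro ballI impI, rule ccontr)
    fix a b assume ab: "a \<in> S" "b \<in> S" "a \<noteq> b" and "E a \<inter> E b \<noteq> {}"
    then obtain g where "K (\<lambda>i\<in>I. g i - u a i)" "K (\<lambda>i\<in>I. g i - u b i)" by (auto simp: E_def)
    then have *: "\<bar>dotp I (\<lambda>i\<in>I. g i - u a i) (\<lambda>i. t a i - t b i)\<bar> \<le> 4 * w"
      "\<bar>dotp I (\<lambda>i\<in>I. g i - u b i) (\<lambda>i. t a i - t b i)\<bar> \<le> 4 * w"
      using ab by (auto simp: K_def)
    have "dotp I (\<lambda>i\<in>I. g i - u b i) (\<lambda>i. t a i - t b i) - dotp I (\<lambda>i\<in>I. g i - u a i) (\<lambda>i. t a i - t b i)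
        = (\<Sum>i\<in>I. 12 * w / \<epsilon>\<^sup>2 * (t a i - t b i)\<^sup>2)"
      unfolding dotp_def sum_subtractf[symmetric]
    proof (intro sum.cong refl)
      fix i assume "i \<in> I"
      have "(g i - u b i) * (t a i - t b i) - (g i - u a i) * (t a i - t b i) = (u a i - u b i) * (t a i - t b i)"
        by (simp add: algebra_simps)
      also have "u a i - u b i = 12 * w / \<epsilon>\<^sup>2 * (t a i - t b i)"
        unfolding u_def by (simp add: right_diff_distrib[symmetric] del: times_divide_eq_left)
      finally show "(\<lambda>i\<in>I. g i - u b i) i * (t a i - t b i) - (\<lambda>i\<in>I. g i - u a i) i * (t a i - t b i)
          = 12 * w / \<epsilon>\<^sup>2 * (t a i - t b i)\<^sup>2"
        using \<open>i \<in> I\<close> by (simp add: power2_eq_square mult.assoc)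
    qed
    also have "\<dots> = 12 * w / \<epsilon>\<^sup>2 * (l2_dist I (t a) (t b))\<^sup>2"
      by (simp add: l2_dist_def L2_set_def sum_nonneg sum_distrib_left)
    finally have "12 * w / \<epsilon>\<^sup>2 * (l2_dist I (t a) (t b))\<^sup>2 \<le> 8 * w" using * by linarith
    moreover have "12 * w / \<epsilon>\<^sup>2 * \<epsilon>\<^sup>2 \<le> 12 * w / \<epsilon>\<^sup>2 * (l2_dist I (t a) (t b))\<^sup>2"
      using sep[OF ab] \<open>0 < w\<close> \<open>0 < \<epsilon>\<close> by (intro mult_left_mono power_mono) auto
    ultimately show False using \<open>0 < w\<close> \<open>0 < \<epsilon>\<close> by simp
  qed
  have "card S * (exp (- 288 * (w / \<epsilon>)\<^sup>2) / 2) \<le> (\<Sum>a\<in>S. measure (gaussian I) (E a))"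
    using E_ge by (intro sum_bounded_below) auto
  also have "\<dots> = measure (gaussian I) (\<Union>a\<in>S. E a)"
    using fin disj E_sets by (intro finite_measure_finite_Union[symmetric]) auto
  also have "\<dots> \<le> 1" by simp
  finally have "card S \<le> 2 * exp (288 * (w / \<epsilon>)\<^sup>2)"
    by (simp add: exp_minus field_simps)
  also have "2 * exp (288 * (w / \<epsilon>)\<^sup>2) \<le> exp (12 * (w / \<epsilon>)\<^sup>2) * exp (288 * (w / \<epsilon>)\<^sup>2)"
  proof (rule mult_right_mono)
    have "2 \<le> 1 + 12 * (w / \<epsilon>)\<^sup>2" using large by linarith
    also have "\<dots> \<le> exp (12 * (w / \<epsilon>)\<^sup>2)" by (rule exp_ge_add_one_self)
    finally show "2 \<le> exp (12 * (w / \<epsilon>)\<^sup>2)" .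
  qed simp
  also have "\<dots> = exp (300 * (w / \<epsilon>)\<^sup>2)" by (simp add: exp_add[symmetric])
  finally show ?thesis .
qed

text \<open>A point farther than \<open>\<epsilon>\<close> from the net built so far joins it; any
  other point is covered already. The bound \<open>max 0 \<epsilon>\<close> accounts for negative
  \<open>\<epsilon>\<close>, since a net point lies at distance 0 from itself.\<close>

lemma finite_separated_net:
  assumes "finite A"
  shows "\<exists>S\<subseteq>A. (\<forall>a\<in>S. \<forall>b\<in>S. a \<noteq> b \<longrightarrow> \<epsilon> < l2_dist I (t a) (t b)) \<and> (\<forall>a\<in>A. \<exists>s\<in>S. l2_dist I (t a) (t s) \<le> max 0 \<epsilon>)"
  using assms
proof (induction A)
  case (insert x A)
  then obtain S where S: "S \<subseteq> A" "\<forall>a\<in>S. \<forall>b\<in>S. a \<noteq> b \<longrightarrow> \<epsilon> < l2_dist I (t a) (t b)"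
    "\<forall>a\<in>A. \<exists>s\<in>S. l2_dist I (t a) (t s) \<le> max 0 \<epsilon>" by auto
  show ?case
  proof (cases "\<exists>s\<in>S. l2_dist I (t x) (t s) \<le> \<epsilon>")
    case True
    then have "\<exists>s\<in>S. l2_dist I (t x) (t s) \<le> max 0 \<epsilon>" by (auto intro: max.coboundedI2)
    with S show ?thesis by (intro exI[of _ S]) auto
  next
    case False
    then have "\<forall>s\<in>S. \<epsilon> < l2_dist I (t x) (t s) \<and> \<epsilon> < l2_dist I (t s) (t x)" by (auto simp: l2_dist_commute)
    with S show ?thesis by (intro exI[of _ "insert x S"]) (auto simp: subset_insertI2)
  qed
qed auto

lemma card_UN_bounded:
  fixes c :: real
  assumes "finite S" "\<And>a. a \<in> S \<Longrightarrow> card (T a) \<le> c"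
  shows "card (\<Union>a\<in>S. T a) \<le> card S * c"
proof -
  have "card (\<Union>a\<in>S. T a) \<le> (\<Sum>a\<in>S. card (T a))" by (rule card_UN_le[OF assms(1)])
  then have "real (card (\<Union>a\<in>S. T a)) \<le> (\<Sum>a\<in>S. real (card (T a)))" by (metis of_nat_le_iff of_nat_sum)
  also have "\<dots> \<le> card S * c" using assms(2) by (intro sum_bounded_above)
  finally show ?thesis .
qed

text \<open>Sudakov's minoration. Passing from scale \<open>2\<epsilon>\<close> to \<open>\<epsilon>\<close> costs a factor
  \<open>exp (300 (w / \<epsilon>)\<^sup>2)\<close>, and the exponents form a geometric series.\<close>

lemma sudakov_net_aux:
  assumes fin: "finite I" "finite A" and w: "gaussian_width I A t \<le> w"
    and "0 < \<epsilon>" "c \<in> A" "\<And>a. a \<in> A \<Longrightarrow> l2_dist I (t a) (t c) \<le> 2 ^ k * \<epsilon>"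
  shows "\<exists>S\<subseteq>A. card S \<le> exp (400 * (w / \<epsilon>)\<^sup>2) \<and> (\<forall>a\<in>A. \<exists>s\<in>S. l2_dist I (t a) (t s) \<le> \<epsilon>)"
  using assms(4-)
proof (induction k arbitrary: \<epsilon>)
  case 0
  then show ?case by (intro exI[of _ "{c}"]) auto
next
  case (Suc k)
  have "\<exists>S\<subseteq>A. card S \<le> exp (400 * (w / (2 * \<epsilon>))\<^sup>2) \<and> (\<forall>a\<in>A. \<exists>s\<in>S. l2_dist I (t a) (t s) \<le> 2 * \<epsilon>)"
    using Suc.prems by (intro Suc.IH) (auto simp: mult_ac)
  then obtain S where S: "S \<subseteq> A" "card S \<le> exp (400 * (w / (2 * \<epsilon>))\<^sup>2)" "\<And>a. a \<in> A \<Longrightarrow> \<exists>s\<in>S. l2_dist I (t a) (t s) \<le> 2 * \<epsilon>"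
    by auto
  have "\<forall>s. \<exists>T. T \<subseteq> {a\<in>A. l2_dist I (t a) (t s) \<le> 2 * \<epsilon>} \<and> (\<forall>a\<in>T. \<forall>b\<in>T. a \<noteq> b \<longrightarrow> \<epsilon> < l2_dist I (t a) (t b))
      \<and> (\<forall>a\<in>{a\<in>A. l2_dist I (t a) (t s) \<le> 2 * \<epsilon>}. \<exists>s\<in>T. l2_dist I (t a) (t s) \<le> \<epsilon>)"
    using finite_separated_net[of "{a\<in>A. l2_dist I (t a) (t s) \<le> 2 * \<epsilon>}" \<epsilon> I t for s] fin(2) Suc.prems(1)
    by (simp add: max_def)
  then obtain T where "\<forall>s. T s \<subseteq> {a\<in>A. l2_dist I (t a) (t s) \<le> 2 * \<epsilon>} \<and> (\<forall>a\<in>T s. \<forall>b\<in>T s. a \<noteq> b \<longrightarrow> \<epsilon> < l2_dist I (t a) (t b))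
      \<and> (\<forall>a\<in>{a\<in>A. l2_dist I (t a) (t s) \<le> 2 * \<epsilon>}. \<exists>s\<in>T s. l2_dist I (t a) (t s) \<le> \<epsilon>)"
    by (subst (asm) choice_iff) blast
  then have T: "\<And>s. T s \<subseteq> {a\<in>A. l2_dist I (t a) (t s) \<le> 2 * \<epsilon>}"
    "\<And>s a b. a \<in> T s \<Longrightarrow> b \<in> T s \<Longrightarrow> a \<noteq> b \<Longrightarrow> \<epsilon> < l2_dist I (t a) (t b)"
    "\<And>s a. a \<in> A \<Longrightarrow> l2_dist I (t a) (t s) \<le> 2 * \<epsilon> \<Longrightarrow> \<exists>s'\<in>T s. l2_dist I (t a) (t s') \<le> \<epsilon>"
    by simp_all
  have card_T: "card (T s) \<le> exp (300 * (w / \<epsilon>)\<^sup>2)" for s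
  proof (rule sudakov_local[where c = "t s" and t = t, OF fin(1) _ Suc.prems(1) T(2)])
    show "finite (T s)" using T(1)[of s] fin(2) by (auto intro: finite_subset)
    show "gaussian_width I (T s) t \<le> w" if "T s \<noteq> {}"
      using gaussian_width_subset[OF fin(2) _ that, of I t] T(1)[of s] w by fastforce
  qed (use T(1)[of s] in auto)
  have "card (\<Union>s\<in>S. T s) \<le> card S * exp (300 * (w / \<epsilon>)\<^sup>2)"
    using finite_subset[OF S(1) fin(2)] card_T by (rule card_UN_bounded)
  also have "\<dots> \<le> exp (400 * (w / (2 * \<epsilon>))\<^sup>2) * exp (300 * (w / \<epsilon>)\<^sup>2)"
    using S(2) by (intro mult_right_mono) auto
  \<comment> \<open>400 solves \<open>c / 4 + 300 = c\<close>: doubling the scale divides the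
    exponent by 4, and the local step adds 300.\<close>
  also have "\<dots> = exp (400 * (w / \<epsilon>)\<^sup>2)"
    by (simp add: exp_add[symmetric] power_divide power_mult_distrib)
  finally have "card (\<Union>s\<in>S. T s) \<le> exp (400 * (w / \<epsilon>)\<^sup>2)" .
  moreover have "\<exists>s\<in>(\<Union>s\<in>S. T s). l2_dist I (t a) (t s) \<le> \<epsilon>" if "a \<in> A" for a
    using S(3)[OF that] T(3)[OF that] by fastforce
  moreover have "(\<Union>s\<in>S. T s) \<subseteq> A" using T(1) by auto
  ultimately show ?case by blast
qed

text \<open>The two-point bound caps the diameter, so finitely many doublings of
  \<open>\<epsilon>\<close> reach a scale at which one ball covers \<open>A\<close>. Their number
  does not enter the estimate.\<close>

lemma sudakov_net:
  assumes fin: "finite I" "finite A" "A \<noteq> {}" and w: "gaussian_width I A t \<le> w" and "0 < \<epsilon>"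
  shows "\<exists>S\<subseteq>A. card S \<le> exp (400 * (w / \<epsilon>)\<^sup>2) \<and> (\<forall>a\<in>A. \<exists>s\<in>S. l2_dist I (t a) (t s) \<le> \<epsilon>)"
proof -
  obtain c where "c \<in> A" using fin by auto
  obtain k where "sqrt (2 * pi) * gaussian_width I A t / \<epsilon> < 2 ^ k" using real_arch_pow[of 2] by auto
  then have "sqrt (2 * pi) * gaussian_width I A t \<le> 2 ^ k * \<epsilon>" using \<open>0 < \<epsilon>\<close> by (simp add: divide_less_eq)
  moreover have "l2_dist I (t a) (t c) \<le> sqrt (2 * pi) * gaussian_width I A t" if "a \<in> A" for a
    unfolding l2_dist_def using fin that \<open>c \<in> A\<close> by (intro gaussian_width_two_points)
  ultimately show ?thesis
    by (intro sudakov_net_aux[OF fin(1,2) w \<open>0 < \<epsilon>\<close> \<open>c \<in> A\<close>, of k]) force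
qed

text \<open>A pair \<open>(f, a)\<close> is moved to \<open>(f, a')\<close>, at a cost controlled by
  the Lipschitz bound, and from there to \<open>(f', a')\<close> with \<open>a'\<close> kept fixed,
  where \<open>wF\<close> applies. Each move may cost \<open>\<epsilon> / 2\<close>, whence 1600
  instead of 400. As both widths are nonnegative, the sum of the squares in the exponents is at most
  the square of the sum.\<close>

lemma composition_net:
  assumes fin: "finite I" "finite J" "finite F" "F \<noteq> {}" "finite A" "A \<noteq> {}" and "0 \<le> L" "0 \<le> w\<^sub>A" "0 \<le> w\<^sub>F" "0 < \<epsilon>"
    and lip: "\<And>f a a'. f \<in> F \<Longrightarrow> a \<in> A \<Longrightarrow> a' \<in> A \<Longrightarrow> l2_dist I (t f a) (t f a') \<le> L * l2_dist J (s a) (s a')"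
    and wA: "gaussian_width J A s \<le> w\<^sub>A"
    and wF: "\<And>a. a \<in> A \<Longrightarrow> gaussian_width I F (\<lambda>f. t f a) \<le> w\<^sub>F"
  shows "\<exists>N\<subseteq>F \<times> A. card N \<le> exp (1600 * ((L * w\<^sub>A + w\<^sub>F) / \<epsilon>)\<^sup>2) \<and>
    (\<forall>f\<in>F. \<forall>a\<in>A. \<exists>(f', a')\<in>N. l2_dist I (t f a) (t f' a') \<le> \<epsilon>)"
proof -
  have "\<exists>S\<subseteq>A. card S \<le> exp (1600 * (L * w\<^sub>A / \<epsilon>)\<^sup>2) \<and> (\<forall>a\<in>A. \<exists>a'\<in>S. L * l2_dist J (s a) (s a') \<le> \<epsilon> / 2)"
  proof (cases "L = 0")
    \<comment> \<open>For \<open>L = 0\<close> the radius \<open>\<epsilon> / (2 * L)\<close> is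
      meaningless, but then a single representation covers all.\<close>
    case True
    obtain a where "a \<in> A" using fin by auto
    with True \<open>0 < \<epsilon>\<close> show ?thesis by (intro exI[of _ "{a}"]) auto
  next
    case False
    then have "0 < L" using \<open>0 \<le> L\<close> by simp
    then obtain S where "S \<subseteq> A" "card S \<le> exp (400 * (w\<^sub>A / (\<epsilon> / (2 * L)))\<^sup>2)" "\<forall>a\<in>A. \<exists>a'\<in>S. l2_dist J (s a) (s a') \<le> \<epsilon> / (2 * L)"
      using sudakov_net[OF fin(2,5,6) wA, of "\<epsilon> / (2 * L)"] \<open>0 < \<epsilon>\<close> by auto
    moreover have "400 * (w\<^sub>A / (\<epsilon> / (2 * L)))\<^sup>2 = 1600 * (L * w\<^sub>A / \<epsilon>)\<^sup>2"
      by (simp add: power_divide power_mult_distrib)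
    ultimately show ?thesis using \<open>0 < L\<close> by (intro exI[of _ S]) (auto simp: field_simps)
  qed
  then obtain S where S: "S \<subseteq> A" "card S \<le> exp (1600 * (L * w\<^sub>A / \<epsilon>)\<^sup>2)" "\<And>a. a \<in> A \<Longrightarrow> \<exists>a'\<in>S. L * l2_dist J (s a) (s a') \<le> \<epsilon> / 2"
    by auto
  have "\<forall>a\<in>A. \<exists>T\<subseteq>F. card T \<le> exp (400 * (w\<^sub>F / (\<epsilon> / 2))\<^sup>2) \<and> (\<forall>f\<in>F. \<exists>f'\<in>T. l2_dist I (t f a) (t f' a) \<le> \<epsilon> / 2)"
    using sudakov_net[OF fin(1,3,4) wF, of _ "\<epsilon> / 2"] \<open>0 < \<epsilon>\<close> by simp
  then obtain T where T: "\<And>a. a \<in> A \<Longrightarrow> T a \<subseteq> F" "\<And>a. a \<in> A \<Longrightarrow> card (T a) \<le> exp (400 * (w\<^sub>F / (\<epsilon> / 2))\<^sup>2)"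
    "\<And>a f. a \<in> A \<Longrightarrow> f \<in> F \<Longrightarrow> \<exists>f'\<in>T a. l2_dist I (t f a) (t f' a) \<le> \<epsilon> / 2"
    by (subst (asm) bchoice_iff) blast
  define N where "N = (\<Union>a\<in>S. T a \<times> {a})"
  have "finite S" using S(1) fin by (auto intro: finite_subset)
  have "card N \<le> card S * exp (400 * (w\<^sub>F / (\<epsilon> / 2))\<^sup>2)"
    unfolding N_def using \<open>finite S\<close> S(1) T(2) by (intro card_UN_bounded) (auto simp: card_cartesian_product)
  also have "\<dots> \<le> exp (1600 * (L * w\<^sub>A / \<epsilon>)\<^sup>2) * exp (1600 * (w\<^sub>F / \<epsilon>)\<^sup>2)"
    using S(2) by (intro mult_mono) (auto simp: power_divide power_mult_distrib)
  also have "\<dots> = exp (1600 * ((L * w\<^sub>A / \<epsilon>)\<^sup>2 + (w\<^sub>F / \<epsilon>)\<^sup>2))"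
    by (simp add: exp_add[symmetric] algebra_simps)
  also have "\<dots> \<le> exp (1600 * ((L * w\<^sub>A + w\<^sub>F) / \<epsilon>)\<^sup>2)"
  proof -
    have "0 \<le> (L * w\<^sub>A / \<epsilon>) * (w\<^sub>F / \<epsilon>)" using assms by (intro mult_nonneg_nonneg divide_nonneg_pos) auto
    then show ?thesis by (simp add: add_divide_distrib power2_sum)
  qed
  finally have "card N \<le> exp (1600 * ((L * w\<^sub>A + w\<^sub>F) / \<epsilon>)\<^sup>2)" .
  moreover have "N \<subseteq> F \<times> A" using S(1) T(1) by (auto simp: N_def)
  moreover have "\<exists>(f', a')\<in>N. l2_dist I (t f a) (t f' a') \<le> \<epsilon>" if "f \<in> F" "a \<in> A" for f a
  proof -
    obtain a' where a': "a' \<in> S" "L * l2_dist J (s a) (s a') \<le> \<epsilon> / 2" using S(3)[OF \<open>a \<in> A\<close>] by auto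
    then have "a' \<in> A" using S(1) by auto
    then obtain f' where f': "f' \<in> T a'" "l2_dist I (t f a') (t f' a') \<le> \<epsilon> / 2" using T(3) \<open>f \<in> F\<close> by blast
    have "l2_dist I (t f a) (t f' a') \<le> \<epsilon>"
      using l2_dist_triangle[of I "t f a" "t f' a'" "t f a'"] lip[OF that \<open>a' \<in> A\<close>] a' f' by linarith
    then show ?thesis using a' f' by (auto simp: N_def)
  qed
  ultimately show ?thesis by blast
qed

section \<open>Chaining over dyadic scales\<close>

lemma integral_L2_gaussian_le:
  assumes [simp]: "finite I"
  shows "integrable (gaussian I) (\<lambda>g. L2_set g I)" "(\<integral>g. L2_set g I \<partial>gaussian I) \<le> sqrt (card I)"
proof -
  interpret prob_space "gaussian I" by simp
  have sq: "integrable (gaussian I) (\<lambda>g. (L2_set g I)\<^sup>2)"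
    by (auto simp: L2_set_def sum_nonneg intro!: integrable_gaussian_component)
  have "(\<lambda>g. \<Sum>i\<in>I. (g i)\<^sup>2) \<in> borel_measurable (gaussian I)"
    by (intro borel_measurable_sum borel_measurable_power measurable_gaussian_component)
  then have meas: "(\<lambda>g. L2_set g I) \<in> borel_measurable (gaussian I)"
    unfolding L2_set_def by (rule measurable_compose[OF _ borel_measurable_sqrt])
  show int: "integrable (gaussian I) (\<lambda>g. L2_set g I)"
    by (rule square_integrable_imp_integrable[OF meas sq])
  have sq1: "(\<integral>g. (L2_set g I)\<^sup>2 \<partial>gaussian I) = card I"
    using integrable_gaussian_component[of _ I 2] integral_gaussian_component_power2[of _ I]
    by (simp add: L2_set_def sum_nonneg)
  have "(\<integral>g. L2_set g I \<partial>gaussian I)\<^sup>2 \<le> (\<integral>g. (L2_set g I)\<^sup>2 \<partial>gaussian I)"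
    using variance_positive[of "\<lambda>g. L2_set g I"] variance_eq[OF int sq] by simp
  then show "(\<integral>g. L2_set g I \<partial>gaussian I) \<le> sqrt (card I)"
    unfolding sq1 by (rule real_le_rsqrt)
qed

lemma gaussian_width_reindex:
  "gaussian_width I A (\<lambda>a. f (h a)) = gaussian_width I (h ` A) f"
  by (simp add: gaussian_width_def image_image)

text \<open>The number of increments between adjacent scales is at most the product of the two net
  sizes, with exponent \<open>1600 + 1600 / 4 = 2000\<close>, and each increment has length at most
  \<open>3 * \<epsilon>\<close>. Length times the root of the log-cardinality is of order
  \<open>V\<close>, whatever the scale.\<close>

lemma chaining_step:
  assumes fin: "finite I" "finite X" "X \<noteq> {}" and "0 < V" "0 < \<epsilon>"
    and p: "card (p ` X) \<le> exp (1600 * (V / \<epsilon>)\<^sup>2)" "\<And>x. x \<in> X \<Longrightarrow> l2_dist I (b x) (p x) \<le> \<epsilon>"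
    and p': "card (p' ` X) \<le> exp (1600 * (V / (2 * \<epsilon>))\<^sup>2)" "\<And>x. x \<in> X \<Longrightarrow> l2_dist I (b x) (p' x) \<le> 2 * \<epsilon>"
  shows "gaussian_width I X (\<lambda>x i. p x i - p' x i) \<le> 2005 * V"
proof -
  define Y where "Y = (\<lambda>x. (p x, p' x)) ` X"
  have "Y \<subseteq> p ` X \<times> p' ` X" by (auto simp: Y_def)
  then have "card Y \<le> card (p ` X) * card (p' ` X)"
    using card_mono[of "p ` X \<times> p' ` X" Y] fin by (simp add: card_cartesian_product)
  then have "real (card Y) \<le> card (p ` X) * card (p' ` X)" by (metis of_nat_le_iff of_nat_mult)
  also have "\<dots> \<le> exp (1600 * (V / \<epsilon>)\<^sup>2) * exp (1600 * (V / (2 * \<epsilon>))\<^sup>2)"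
    unfolding of_nat_mult using p(1) p'(1) by (intro mult_mono) auto
  also have "\<dots> = exp (2000 * (V / \<epsilon>)\<^sup>2)"
    by (simp add: exp_add[symmetric] power_divide power_mult_distrib)
  finally have "card Y \<le> exp (2000 * (V / \<epsilon>)\<^sup>2)" .
  moreover have Y: "finite Y" "Y \<noteq> {}" using fin by (auto simp: Y_def)
  ultimately have ln: "ln (card Y) \<le> 2000 * (V / \<epsilon>)\<^sup>2"
    by (metis card_gt_0_iff exp_gt_zero ln_exp ln_le_cancel_iff of_nat_0_less_iff)
  have "gaussian_width I X (\<lambda>x i. p x i - p' x i) = gaussian_width I Y (\<lambda>y i. fst y i - snd y i)"
    unfolding Y_def gaussian_width_reindex[symmetric] by simp
  \<comment> \<open>The parameter \<open>V / \<epsilon>\<^sup>2\<close> turns both terms into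
    multiples of \<open>V\<close>, with factors at most 2000 and 4.5.\<close>
  also have "\<dots> \<le> ln (card Y) / (V / \<epsilon>\<^sup>2) + V / \<epsilon>\<^sup>2 * (3 * \<epsilon>)\<^sup>2 / 2"
  proof (rule gaussian_width_le_card[OF fin(1) Y])
    fix y assume "y \<in> Y"
    then obtain x where x: "x \<in> X" "y = (p x, p' x)" by (auto simp: Y_def)
    have "l2_dist I (p x) (p' x) \<le> 3 * \<epsilon>"
      using l2_dist_triangle[of I "p x" "p' x" "b x"] p(2)[OF x(1)] p'(2)[OF x(1)] l2_dist_commute[of I "p x" "b x"] by simp
    then show "L2_set (\<lambda>i. fst y i - snd y i) I \<le> 3 * \<epsilon>" using x by (simp add: l2_dist_def)
  qed (use \<open>0 < V\<close> \<open>0 < \<epsilon>\<close> in auto)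
  also have "\<dots> \<le> 2000 * (V / \<epsilon>)\<^sup>2 / (V / \<epsilon>\<^sup>2) + V / \<epsilon>\<^sup>2 * (3 * \<epsilon>)\<^sup>2 / 2"
    using ln \<open>0 < V\<close> \<open>0 < \<epsilon>\<close> by (intro add_right_mono divide_right_mono) auto
  also have "\<dots> \<le> 2005 * V"
    using \<open>0 < V\<close> \<open>0 < \<epsilon>\<close> by (simp add: field_simps power2_eq_square)
  finally show ?thesis .
qed

text \<open>Each vector telescopes from 0 through its approximations down to scale
  \<open>R / 2 ^ k\<close>. The unresolved part is estimated by Cauchy-Schwarz, which costs the
  expected Euclidean norm of a Gaussian vector, at most \<open>sqrt (card I)\<close>.\<close>

lemma chaining:
  assumes fin: "finite I" "finite X" "X \<noteq> {}" and "0 < V" "0 < R"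
    and R: "\<And>x. x \<in> X \<Longrightarrow> L2_set (b x) I \<le> R"
    and net: "\<And>\<epsilon>. 0 < \<epsilon> \<Longrightarrow> \<exists>N\<subseteq>X. card N \<le> exp (1600 * (V / \<epsilon>)\<^sup>2) \<and> (\<forall>x\<in>X. \<exists>y\<in>N. l2_dist I (b x) (b y) \<le> \<epsilon>)"
  shows "gaussian_width I X b \<le> 2005 * real k * V + R / 2 ^ k * sqrt (card I)"
proof -
  define \<epsilon> where "\<epsilon> j = R / 2 ^ j" for j :: nat
  have \<epsilon>: "0 < \<epsilon> j" "\<epsilon> j = 2 * \<epsilon> (Suc j)" for j using \<open>0 < R\<close> by (auto simp: \<epsilon>_def)
  have "\<forall>j. \<exists>p. card (p ` X) \<le> exp (1600 * (V / \<epsilon> j)\<^sup>2) \<and> (\<forall>x\<in>X. l2_dist I (b x) (p x) \<le> \<epsilon> j) \<and> (j = 0 \<longrightarrow> p = (\<lambda>_ _. 0))"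
  proof
    fix j
    show "\<exists>p. card (p ` X) \<le> exp (1600 * (V / \<epsilon> j)\<^sup>2) \<and> (\<forall>x\<in>X. l2_dist I (b x) (p x) \<le> \<epsilon> j) \<and> (j = 0 \<longrightarrow> p = (\<lambda>_ _. 0))"
    proof (cases j)
      \<comment> \<open>At the coarsest scale the approximation is the zero vector, within
        \<open>R\<close> of every \<open>b x\<close>. Approximations are vectors rather than
        indices, so it may lie outside the family.\<close>
      case 0
      have "card ((\<lambda>_ _. 0 :: real) ` X) \<le> exp (1600 * (V / \<epsilon> j)\<^sup>2)" using fin by (simp add: image_constant_conv)
      with 0 R show ?thesis by (intro exI[of _ "\<lambda>_ _. 0"]) (auto simp: \<epsilon>_def l2_dist_def)
    next
      case (Suc j')
      obtain N where N: "N \<subseteq> X" "card N \<le> exp (1600 * (V / \<epsilon> j)\<^sup>2)" "\<forall>x\<in>X. \<exists>y\<in>N. l2_dist I (b x) (b y) \<le> \<epsilon> j"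
        using net[OF \<epsilon>(1)] by blast
      then obtain q where q: "\<And>x. x \<in> X \<Longrightarrow> q x \<in> N" "\<And>x. x \<in> X \<Longrightarrow> l2_dist I (b x) (b (q x)) \<le> \<epsilon> j" by metis
      have "finite N" using N(1) fin by (auto intro: finite_subset)
      have "card ((\<lambda>x. b (q x)) ` X) \<le> card (b ` N)" using q \<open>finite N\<close> by (intro card_mono) auto
      also have "\<dots> \<le> card N" by (rule card_image_le[OF \<open>finite N\<close>])
      finally have "real (card ((\<lambda>x. b (q x)) ` X)) \<le> exp (1600 * (V / \<epsilon> j)\<^sup>2)" using N(2) by linarith
      with q Suc show ?thesis by (intro exI[of _ "\<lambda>x. b (q x)"]) auto
    qed
  qed
  then obtain p where p: "\<And>j. card (p j ` X) \<le> exp (1600 * (V / \<epsilon> j)\<^sup>2)" "\<And>j x. x \<in> X \<Longrightarrow> l2_dist I (b x) (p j x) \<le> \<epsilon> j"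
    "p 0 = (\<lambda>_ _. 0)"
    by (subst (asm) choice_iff) blast
  have step: "gaussian_width I X (\<lambda>x i. p (Suc j) x i - p j x i) \<le> 2005 * V" for j
    using p(1)[of "Suc j"] p(1)[of j] p(2)[of _ "Suc j"] p(2)[of _ j] \<open>0 < V\<close> \<epsilon>(1)[of "Suc j"] \<epsilon>(2)[of j]
    by (intro chaining_step[OF fin, where b = b and \<epsilon> = "\<epsilon> (Suc j)"]) auto
  have "gaussian_width I X b \<le> (\<integral>g. L2_set g I * \<epsilon> k + (\<Sum>j<k. MAX x\<in>X. dotp I g (\<lambda>i. p (Suc j) x i - p j x i)) \<partial>gaussian I)"
    unfolding gaussian_width_def
  proof (intro integral_mono)
    fix g
    show "(MAX x\<in>X. dotp I g (b x)) \<le> L2_set g I * \<epsilon> k + (\<Sum>j<k. MAX x\<in>X. dotp I g (\<lambda>i. p (Suc j) x i - p j x i))"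
    proof (rule Max.boundedI)
      fix y assume "y \<in> (\<lambda>x. dotp I g (b x)) ` X"
      then obtain x where x: "x \<in> X" "y = dotp I g (b x)" by auto
      have "(\<Sum>j<k. dotp I g (\<lambda>i. p (Suc j) x i - p j x i)) = dotp I g (p k x) - dotp I g (p 0 x)"
        unfolding dotp_diff_right by (rule sum_lessThan_telescope)
      then have "y = dotp I g (\<lambda>i. b x i - p k x i) + (\<Sum>j<k. dotp I g (\<lambda>i. p (Suc j) x i - p j x i))"
        using x p(3) by (simp add: dotp_diff_right) (simp add: dotp_def)
      moreover have "dotp I g (\<lambda>i. b x i - p k x i) \<le> L2_set g I * \<epsilon> k"
        using dotp_le_L2[of I g "\<lambda>i. b x i - p k x i"] p(2)[OF x(1), of k]
        unfolding l2_dist_def by (rule order.trans[OF _ mult_left_mono]) simp_all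
      moreover have "(\<Sum>j<k. dotp I g (\<lambda>i. p (Suc j) x i - p j x i)) \<le> (\<Sum>j<k. MAX x\<in>X. dotp I g (\<lambda>i. p (Suc j) x i - p j x i))"
        using x fin by (intro sum_mono Max_ge) auto
      ultimately show "y \<le> L2_set g I * \<epsilon> k + (\<Sum>j<k. MAX x\<in>X. dotp I g (\<lambda>i. p (Suc j) x i - p j x i))" by simp
    qed (use fin in auto)
  qed (intro integrable_Max_dotp Bochner_Integration.integrable_add integrable_mult_left integral_L2_gaussian_le
      Bochner_Integration.integrable_sum fin)+
  also have "\<dots> = (\<integral>g. L2_set g I \<partial>gaussian I) * \<epsilon> k + (\<Sum>j<k. gaussian_width I X (\<lambda>x i. p (Suc j) x i - p j x i))"
    unfolding gaussian_width_def using fin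
    by (simp add: integrable_Max_dotp integral_L2_gaussian_le(1))
  also have "\<dots> \<le> sqrt (card I) * \<epsilon> k + real (card {..<k}) * (2005 * V)"
    using step \<epsilon>(1)[of k] integral_L2_gaussian_le(2)[OF fin(1)]
    by (intro add_mono mult_right_mono sum_bounded_above) auto
  finally show ?thesis by (simp add: \<epsilon>_def mult_ac)
qed

lemma gaussian_width_composition:
  assumes fin: "finite I" "finite J" "finite F" "F \<noteq> {}" "finite A" "A \<noteq> {}" and "0 \<le> L" "0 \<le> w\<^sub>A" "0 \<le> w\<^sub>F" "0 \<le> R"
    and lip: "\<And>f a a'. f \<in> F \<Longrightarrow> a \<in> A \<Longrightarrow> a' \<in> A \<Longrightarrow> l2_dist I (t f a) (t f a') \<le> L * l2_dist J (s a) (s a')"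
    and wA: "gaussian_width J A s \<le> w\<^sub>A"
    and wF: "\<And>a. a \<in> A \<Longrightarrow> gaussian_width I F (\<lambda>f. t f a) \<le> w\<^sub>F"
    and R: "\<And>f a. f \<in> F \<Longrightarrow> a \<in> A \<Longrightarrow> L2_set (t f a) I \<le> R"
  shows "gaussian_width I (F \<times> A) (\<lambda>(f, a). t f a) \<le> 2005 * real k * (L * w\<^sub>A + w\<^sub>F) + R / 2 ^ k * sqrt (card I)"
proof (rule field_le_epsilon)
  fix e :: real assume "0 < e"
  \<comment> \<open>\<open>chaining\<close> asks for a positive width bound and a positive radius,
    so both are enlarged by \<open>\<eta>\<close>; \<open>c\<close> is the total coefficient with
    which \<open>\<eta>\<close> enters the estimate.\<close>
  define c where "c = 2005 * real k + sqrt (card I) / 2 ^ k"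
  define \<eta> where "\<eta> = e / (c + 1)"
  have "0 \<le> c" by (simp add: c_def)
  then have "0 < \<eta>" "c * \<eta> \<le> e" using \<open>0 < e\<close> by (auto simp: \<eta>_def field_simps)
  have "gaussian_width I (F \<times> A) (\<lambda>(f, a). t f a)
      \<le> 2005 * real k * (L * w\<^sub>A + (w\<^sub>F + \<eta>)) + (R + \<eta>) / 2 ^ k * sqrt (card I)"
  proof (rule chaining)
    fix \<epsilon> :: real assume "0 < \<epsilon>"
    have "gaussian_width I F (\<lambda>f. t f a) \<le> w\<^sub>F + \<eta>" if "a \<in> A" for a using wF[OF that] \<open>0 < \<eta>\<close> by simp
    note wF' = this
    obtain N where "N \<subseteq> F \<times> A" "card N \<le> exp (1600 * ((L * w\<^sub>A + (w\<^sub>F + \<eta>)) / \<epsilon>)\<^sup>2)"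
      and N: "\<And>f a. f \<in> F \<Longrightarrow> a \<in> A \<Longrightarrow> \<exists>(f', a')\<in>N. l2_dist I (t f a) (t f' a') \<le> \<epsilon>"
      using composition_net[where t = t and s = s, OF fin assms(7,8) _ \<open>0 < \<epsilon>\<close> lip wA wF'] \<open>0 < \<eta>\<close> assms(9)
      by auto
    moreover have "\<exists>y\<in>N. l2_dist I (case x of (f, a) \<Rightarrow> t f a) (case y of (f, a) \<Rightarrow> t f a) \<le> \<epsilon>" if "x \<in> F \<times> A" for x
      using N[of "fst x" "snd x"] that by (auto simp: case_prod_beta')
    ultimately
    show "\<exists>N\<subseteq>F \<times> A. card N \<le> exp (1600 * ((L * w\<^sub>A + (w\<^sub>F + \<eta>)) / \<epsilon>)\<^sup>2)
        \<and> (\<forall>x\<in>F \<times> A. \<exists>y\<in>N. l2_dist I (case x of (f, a) \<Rightarrow> t f a) (case y of (f, a) \<Rightarrow> t f a) \<le> \<epsilon>)"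
      by blast
  next
    show "L2_set (case x of (f, a) \<Rightarrow> t f a) I \<le> R + \<eta>" if "x \<in> F \<times> A" for x
      using R[of "fst x" "snd x"] that \<open>0 < \<eta>\<close> by (auto simp: case_prod_beta')
  qed (use fin assms(7-10) \<open>0 < \<eta>\<close> in \<open>auto intro: add_nonneg_pos\<close>)
  also have "\<dots> = 2005 * real k * (L * w\<^sub>A + w\<^sub>F) + R / 2 ^ k * sqrt (card I) + c * \<eta>"
    by (simp add: c_def algebra_simps add_divide_distrib)
  finally show "gaussian_width I (F \<times> A) (\<lambda>(f, a). t f a)
      \<le> 2005 * real k * (L * w\<^sub>A + w\<^sub>F) + R / 2 ^ k * sqrt (card I) + e"
    using \<open>c * \<eta> \<le> e\<close> by simp
qed

section \<open>Bounded differences, symmetrization and contraction\<close>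

context prob_space
begin

lemma product_sigma_finite_same: "product_sigma_finite (\<lambda>_. M)"
  by (intro product_sigma_finite.intro sigma_finite_measure_axioms)

lemma prob_space_PiM_same: "prob_space (PiM J (\<lambda>_. M))"
  by (intro prob_space_PiM prob_space_axioms)

lemma integrable_bounded:
  fixes f :: "'a \<Rightarrow> real"
  assumes "f \<in> borel_measurable M" "\<And>x. x \<in> space M \<Longrightarrow> \<bar>f x\<bar> \<le> B"
  shows "integrable M f"
  using assms by (intro integrable_const_bound[where B = B]) (auto intro!: AE_I2)

lemma
  fixes f :: "('i \<Rightarrow> 'a) \<Rightarrow> real"
  assumes J: "finite J" "i \<notin> J"
    and f: "f \<in> borel_measurable (PiM (insert i J) (\<lambda>_. M))"
    and bound: "\<And>S. S \<in> space (PiM (insert i J) (\<lambda>_. M)) \<Longrightarrow> \<bar>f S\<bar> \<le> B"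
  shows integral_PiM_insert: "(\<integral>S. f S \<partial>PiM (insert i J) (\<lambda>_. M)) = (\<integral>S. (\<integral>z. f (S(i := z)) \<partial>M) \<partial>PiM J (\<lambda>_. M))"
    and integral_PiM_insert_rev: "(\<integral>S. f S \<partial>PiM (insert i J) (\<lambda>_. M)) = (\<integral>z. (\<integral>S. f (S(i := z)) \<partial>PiM J (\<lambda>_. M)) \<partial>M)"
    and integrable_PiM_insert_inner: "integrable (PiM J (\<lambda>_. M)) (\<lambda>S. \<integral>z. f (S(i := z)) \<partial>M)"
      "integrable M (\<lambda>z. \<integral>S. f (S(i := z)) \<partial>PiM J (\<lambda>_. M))"
proof -
  interpret P: product_sigma_finite "\<lambda>_::'i. M" by (rule product_sigma_finite_same)
  interpret IJ: prob_space "PiM (insert i J) (\<lambda>_. M)" by (rule prob_space_PiM_same)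
  interpret J: prob_space "PiM J (\<lambda>_. M)" by (rule prob_space_PiM_same)
  interpret pair_prob_space "PiM J (\<lambda>_. M)" M ..
  have "(\<lambda>(S, z). S(i := z)) \<in> PiM J (\<lambda>_. M) \<Otimes>\<^sub>M M \<rightarrow>\<^sub>M PiM (insert i J) (\<lambda>_. M)"
    by (rule measurable_add_dim)
  from measurable_compose[OF this f]
  have m: "(\<lambda>(S, z). f (S(i := z))) \<in> borel_measurable (PiM J (\<lambda>_. M) \<Otimes>\<^sub>M M)"
    by (simp add: case_prod_beta')
  have int: "integrable (PiM J (\<lambda>_. M) \<Otimes>\<^sub>M M) (\<lambda>(S, z). f (S(i := z)))"
  proof (rule P.integrable_bounded[OF m, of B])
    fix x assume "x \<in> space (PiM J (\<lambda>_. M) \<Otimes>\<^sub>M M)"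
    then have "(fst x)(i := snd x) \<in> space (PiM (insert i J) (\<lambda>_. M))"
      by (auto simp: space_pair_measure space_PiM PiE_iff extensional_def)
    from bound[OF this] show "\<bar>case x of (S, z) \<Rightarrow> f (S(i := z))\<bar> \<le> B" by (simp add: case_prod_beta')
  qed
  show 1: "(\<integral>S. f S \<partial>PiM (insert i J) (\<lambda>_. M)) = (\<integral>S. (\<integral>z. f (S(i := z)) \<partial>M) \<partial>PiM J (\<lambda>_. M))"
    by (rule P.product_integral_insert[OF J IJ.integrable_bounded[OF f bound]])
  show "(\<integral>S. f S \<partial>PiM (insert i J) (\<lambda>_. M)) = (\<integral>z. (\<integral>S. f (S(i := z)) \<partial>PiM J (\<lambda>_. M)) \<partial>M)"
    unfolding 1 by (rule Fubini_integral[OF int, symmetric])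
  show "integrable (PiM J (\<lambda>_. M)) (\<lambda>S. \<integral>z. f (S(i := z)) \<partial>M)"
    "integrable M (\<lambda>z. \<integral>S. f (S(i := z)) \<partial>PiM J (\<lambda>_. M))"
    using integrable_fst'[OF int] integrable_snd[OF int] by simp_all
qed

text \<open>Only the oscillation of \<open>f\<close> is bounded, so the interval of length
  \<open>c\<close> required by Hoeffding's lemma is located by the infimum of
  \<open>f\<close>.\<close>

lemma exp_deviation_one_coordinate:
  fixes f :: "'a \<Rightarrow> real"
  assumes f: "f \<in> borel_measurable M" and c: "\<And>x y. x \<in> space M \<Longrightarrow> y \<in> space M \<Longrightarrow> \<bar>f x - f y\<bar> \<le> c" and "0 \<le> l"
  shows "(\<integral>\<^sup>+x. ennreal (exp (l * f x)) \<partial>M) \<le> ennreal (exp (l * (\<integral>x. f x \<partial>M) + l\<^sup>2 * c\<^sup>2 / 8))"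
proof (cases "l = 0")
  case True
  then show ?thesis by (simp add: emeasure_space_1)
next
  case False
  obtain x0 where x0: "x0 \<in> space M" using not_empty by auto
  define a where "a = Inf (f ` space M)"
  have bdd: "bdd_below (f ` space M)"
  proof (rule bdd_belowI2)
    show "f x0 - c \<le> f x" if "x \<in> space M" for x using c[OF x0 that] by linarith
  qed
  have upper: "f x \<le> a + c" if "x \<in> space M" for x
  proof -
    have "f x - c \<le> a" unfolding a_def using x0
    proof (intro cINF_greatest)
      show "f x - c \<le> f y" if "y \<in> space M" for y using c[OF \<open>x \<in> space M\<close> that] by linarith
    qed auto
    then show ?thesis by simp
  qed
  interpret interval_bounded_random_variable M f a "a + c"
    using f upper bdd by unfold_locales (auto intro!: AE_I2 cINF_lower simp: a_def)
  have "(\<integral>\<^sup>+x. ennreal (exp (l * f x)) \<partial>M) = (\<integral>\<^sup>+x. ennreal (exp (l * expectation f)) * ennreal (exp (l * (f x - expectation f))) \<partial>M)"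
    by (intro nn_integral_cong) (simp add: ennreal_mult[symmetric] exp_add[symmetric] algebra_simps)
  also have "\<dots> = ennreal (exp (l * expectation f)) * (\<integral>\<^sup>+x. ennreal (exp (l * (f x - expectation f))) \<partial>M)"
    using f by (intro nn_integral_cmult) measurable
  also have "\<dots> \<le> ennreal (exp (l * expectation f)) * ennreal (exp (l\<^sup>2 * ((a + c) - a)\<^sup>2 / 8))"
    using Hoeffdings_lemma_nn_integral[of l] \<open>0 \<le> l\<close> False by (intro mult_left_mono) (auto simp: algebra_simps)
  also have "\<dots> = ennreal (exp (l * (\<integral>x. f x \<partial>M) + l\<^sup>2 * c\<^sup>2 / 8))"
    by (simp add: ennreal_mult[symmetric] exp_add)
  finally show ?thesis .
qed

text \<open>Integrating out the last coordinate by Hoeffding's lemma costs the factor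
  \<open>exp (l\<^sup>2 * c\<^sup>2 / 8)\<close> and leaves the partial mean, a function of one
  coordinate fewer that inherits both the bound \<open>B\<close> and the differences
  \<open>c\<close>.\<close>

lemma mcdiarmid_exponential:
  fixes f :: "(nat \<Rightarrow> 'a) \<Rightarrow> real"
  assumes "f \<in> borel_measurable (PiM {..<N} (\<lambda>_. M))"
    and "\<And>S. S \<in> space (PiM {..<N} (\<lambda>_. M)) \<Longrightarrow> \<bar>f S\<bar> \<le> B"
    and "\<And>S i z. S \<in> space (PiM {..<N} (\<lambda>_. M)) \<Longrightarrow> i < N \<Longrightarrow> z \<in> space M \<Longrightarrow> \<bar>f S - f (S(i := z))\<bar> \<le> c"
    and "0 \<le> l"
  shows "(\<integral>\<^sup>+S. ennreal (exp (l * f S)) \<partial>PiM {..<N} (\<lambda>_. M))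
      \<le> ennreal (exp (l * (\<integral>S. f S \<partial>PiM {..<N} (\<lambda>_. M)) + real N * l\<^sup>2 * c\<^sup>2 / 8))"
  using assms
proof (induction N arbitrary: f)
  case 0
  show ?case by (simp add: PiM_empty lebesgue_integral_count_space_finite nn_integral_count_space_finite)
next
  case (Suc N)
  interpret P: product_sigma_finite "\<lambda>_::nat. M" by (rule product_sigma_finite_same)
  interpret PN: prob_space "PiM {..<N} (\<lambda>_. M)" by (rule prob_space_PiM_same)
  let ?PN = "PiM {..<N} (\<lambda>_. M)"
  have ins: "{..<Suc N} = insert N {..<N}" by auto
  note f = Suc.prems(1)[unfolded ins] and bound = Suc.prems(2)[unfolded ins]
  have upd: "S(N := z) \<in> space (PiM (insert N {..<N}) (\<lambda>_. M))" if "S \<in> space ?PN" "z \<in> space M" for S z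
    using that by (auto simp: space_PiM PiE_iff extensional_def)
  have upd2: "S(i := z) \<in> space ?PN" if "S \<in> space ?PN" "z \<in> space M" "i < N" for S z i
    using that by (auto simp: space_PiM PiE_iff extensional_def)
  have meas_z: "(\<lambda>z. f (S(N := z))) \<in> borel_measurable M" if "S \<in> space ?PN" for S
    by (rule measurable_compose[OF measurable_component_update[OF that] f]) simp
  define g where "g S = (\<integral>z. f (S(N := z)) \<partial>M)" for S
  have g_int: "integrable ?PN g"
    unfolding g_def by (rule integrable_PiM_insert_inner[OF _ _ f bound]) auto
  have int_z: "integrable M (\<lambda>z. f (S(N := z)))" if "S \<in> space ?PN" for S
    using meas_z[OF that] bound[OF upd[OF that]] by (rule integrable_bounded)
  have "(\<integral>\<^sup>+S. ennreal (exp (l * f S)) \<partial>PiM {..<Suc N} (\<lambda>_. M))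
      = (\<integral>\<^sup>+S. (\<integral>\<^sup>+z. ennreal (exp (l * f (S(N := z)))) \<partial>M) \<partial>?PN)"
    unfolding ins using f by (intro P.product_nn_integral_insert) auto
  also have "\<dots> \<le> (\<integral>\<^sup>+S. ennreal (exp (l\<^sup>2 * c\<^sup>2 / 8)) * ennreal (exp (l * g S)) \<partial>?PN)"
  proof (intro nn_integral_mono)
    fix S assume S: "S \<in> space ?PN"
    have "(\<integral>\<^sup>+z. ennreal (exp (l * f (S(N := z)))) \<partial>M) \<le> ennreal (exp (l * (\<integral>z. f (S(N := z)) \<partial>M) + l\<^sup>2 * c\<^sup>2 / 8))"
    proof (rule exp_deviation_one_coordinate[OF meas_z[OF S] _ \<open>0 \<le> l\<close>])
      fix x y assume "x \<in> space M" "y \<in> space M"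
      then have "\<bar>f (S(N := x)) - f ((S(N := x))(N := y))\<bar> \<le> c"
        using upd[OF S] by (intro Suc.prems(3)) (simp_all only: ins lessI)
      then show "\<bar>f (S(N := x)) - f (S(N := y))\<bar> \<le> c" by (simp only: fun_upd_upd)
    qed
    also have "\<dots> = ennreal (exp (l\<^sup>2 * c\<^sup>2 / 8)) * ennreal (exp (l * g S))"
      by (simp add: g_def ennreal_mult[symmetric] exp_add)
    finally show "(\<integral>\<^sup>+z. ennreal (exp (l * f (S(N := z)))) \<partial>M) \<le> ennreal (exp (l\<^sup>2 * c\<^sup>2 / 8)) * ennreal (exp (l * g S))" .
  qed
  also have "\<dots> = ennreal (exp (l\<^sup>2 * c\<^sup>2 / 8)) * (\<integral>\<^sup>+S. ennreal (exp (l * g S)) \<partial>?PN)"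
    using borel_measurable_integrable[OF g_int] by (intro nn_integral_cmult) measurable
  also have "\<dots> \<le> ennreal (exp (l\<^sup>2 * c\<^sup>2 / 8)) * ennreal (exp (l * (\<integral>S. g S \<partial>?PN) + real N * l\<^sup>2 * c\<^sup>2 / 8))"
  proof (intro mult_left_mono Suc.IH \<open>0 \<le> l\<close>)
    show "g \<in> borel_measurable ?PN" using g_int by auto
    show "\<bar>g S\<bar> \<le> B" if "S \<in> space ?PN" for S
    proof -
      have "\<bar>g S\<bar> \<le> (\<integral>z. \<bar>f (S(N := z))\<bar> \<partial>M)" unfolding g_def by (rule integral_abs_bound)
      also have "\<dots> \<le> (\<integral>z. B \<partial>M)"
        using int_z[OF that] by (intro integral_mono bound upd that) auto
      finally show ?thesis by (simp add: prob_space)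
    qed
    show "\<bar>g S - g (S(i := z))\<bar> \<le> c" if "S \<in> space ?PN" "i < N" "z \<in> space M" for S i z
    proof -
      have "g S - g (S(i := z)) = (\<integral>y. f (S(N := y)) - f (S(i := z, N := y)) \<partial>M)"
        unfolding g_def using int_z[OF that(1)] int_z[OF upd2[OF that(1,3,2)]]
        by (rule Bochner_Integration.integral_diff[symmetric])
      also have "\<bar>\<dots>\<bar> \<le> (\<integral>y. \<bar>f (S(N := y)) - f (S(i := z, N := y))\<bar> \<partial>M)" by (rule integral_abs_bound)
      also have "\<dots> \<le> (\<integral>y. c \<partial>M)"
      proof (intro integral_mono)
        show "integrable M (\<lambda>y. \<bar>f (S(N := y)) - f (S(i := z, N := y))\<bar>)"
          using int_z[OF that(1)] int_z[OF upd2[OF that(1,3,2)]] by simp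
        fix y assume "y \<in> space M"
        then have "\<bar>f (S(N := y)) - f ((S(N := y))(i := z))\<bar> \<le> c"
          using upd[OF that(1)] that by (intro Suc.prems(3)) (simp_all only: ins less_SucI)
        moreover have "S(i := z, N := y) = S(N := y, i := z)" using that by (intro fun_upd_twist) auto
        ultimately show "\<bar>f (S(N := y)) - f (S(i := z, N := y))\<bar> \<le> c" by (simp only:)
      qed auto
      finally show ?thesis by (simp add: prob_space)
    qed
  qed auto
  also have "(\<integral>S. g S \<partial>?PN) = (\<integral>S. f S \<partial>PiM {..<Suc N} (\<lambda>_. M))"
    unfolding g_def ins by (rule integral_PiM_insert[OF _ _ f bound, symmetric]) auto
  finally show ?case
    by (simp add: ennreal_mult[symmetric] exp_add[symmetric] algebra_simps add_divide_distrib)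
qed

end

text \<open>The average over all signs \<open>\<epsilon>\<close> of the maximum of \<open>A u + 2 (\<Sum>i<N. \<epsilon> i * l i u)\<close>, in a form
  suited to treating one coordinate at a time; the factor 2 is the one lost in symmetrization.\<close>

fun rademacher_avg :: "nat \<Rightarrow> (nat \<Rightarrow> 'u \<Rightarrow> real) \<Rightarrow> 'u set \<Rightarrow> ('u \<Rightarrow> real) \<Rightarrow> real" where
  "rademacher_avg 0 l U A = (MAX u\<in>U. A u)"
| "rademacher_avg (Suc N) l U A
    = (rademacher_avg N l U (\<lambda>u. A u + 2 * l N u) + rademacher_avg N l U (\<lambda>u. A u - 2 * l N u)) / 2"

lemma rademacher_avg_cong: "(\<And>i. i < N \<Longrightarrow> l i = l' i) \<Longrightarrow> rademacher_avg N l U A = rademacher_avg N l' U A"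
  by (induction N arbitrary: A) auto

lemma measurable_rademacher_avg:
  assumes "finite U" "\<And>i u. i < N \<Longrightarrow> u \<in> U \<Longrightarrow> (\<lambda>x. l x i u) \<in> borel_measurable M" "\<And>u. u \<in> U \<Longrightarrow> (\<lambda>x. A x u) \<in> borel_measurable M"
  shows "(\<lambda>x. rademacher_avg N (l x) U (A x)) \<in> borel_measurable M"
  using assms
proof (induction N arbitrary: A)
  case (Suc N)
  have "(\<lambda>x. rademacher_avg N (l x) U (\<lambda>u. A x u + 2 * l x N u)) \<in> borel_measurable M"
    "(\<lambda>x. rademacher_avg N (l x) U (\<lambda>u. A x u - 2 * l x N u)) \<in> borel_measurable M"
    using Suc.prems by (intro Suc.IH; auto)+
  then show ?case by simp
qed (auto intro!: borel_measurable_Max)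

lemma abs_rademacher_avg_le:
  assumes "finite U" "U \<noteq> {}" "\<And>i u. i < N \<Longrightarrow> u \<in> U \<Longrightarrow> \<bar>l i u\<bar> \<le> B" "\<And>u. u \<in> U \<Longrightarrow> \<bar>A u\<bar> \<le> a"
  shows "\<bar>rademacher_avg N l U A\<bar> \<le> a + 2 * real N * B"
  using assms(3,4)
proof (induction N arbitrary: A a)
  case 0
  obtain u where "u \<in> U" "(MAX u\<in>U. A u) = A u" by (rule Max_image_obtain[OF assms(1,2)])
  with 0 show ?case by simp
next
  case (Suc N)
  have "\<bar>A u + 2 * l N u\<bar> \<le> a + 2 * B" "\<bar>A u - 2 * l N u\<bar> \<le> a + 2 * B" if "u \<in> U" for u
    using Suc.prems(1)[of N u] Suc.prems(2)[of u] that by auto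
  then have "\<bar>rademacher_avg N l U (\<lambda>u. A u + 2 * l N u)\<bar> \<le> a + 2 * B + 2 * real N * B"
    "\<bar>rademacher_avg N l U (\<lambda>u. A u - 2 * l N u)\<bar> \<le> a + 2 * B + 2 * real N * B"
    using Suc.prems(1) by (auto intro!: Suc.IH)
  then show ?case by (simp add: algebra_simps)
qed

section \<open>Symmetrization\<close>

context prob_space
begin

text \<open>The mean is replaced by the loss at an independent copy \<open>z'\<close>, which
  Jensen's inequality for the maximum permits, and the roles of \<open>z\<close> and
  \<open>z'\<close> are then exchanged. The offset \<open>A\<close> stands for whatever the other
  coordinates contribute.\<close>

lemma symmetrization_one_coordinate:
  fixes l :: "'u \<Rightarrow> 'a \<Rightarrow> real"
  assumes U: "finite U" "U \<noteq> {}"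
    and l: "\<And>u. u \<in> U \<Longrightarrow> l u \<in> borel_measurable M" "\<And>u z. u \<in> U \<Longrightarrow> z \<in> space M \<Longrightarrow> \<bar>l u z\<bar> \<le> B"
  shows "(\<integral>z. (MAX u\<in>U. (\<integral>z. l u z \<partial>M) - l u z + A u) \<partial>M)
    \<le> (\<integral>z. ((MAX u\<in>U. A u + 2 * l u z) + (MAX u\<in>U. A u - 2 * l u z)) / 2 \<partial>M)"
proof -
  define \<Phi> where "\<Phi> z z' = (MAX u\<in>U. l u z' - l u z + A u)" for z z'
  define \<Psi> where "\<Psi> z = ((MAX u\<in>U. A u + 2 * l u z) + (MAX u\<in>U. A u - 2 * l u z)) / 2" for z
  interpret PP: pair_prob_space M M ..
  have l_int: "integrable M (l u)" if "u \<in> U" for u using l that by (auto intro!: integrable_bounded)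
  have int_pair: "integrable (M \<Otimes>\<^sub>M M) (\<lambda>(z, z'). \<Phi> z z')"
  proof -
    have "integrable (M \<Otimes>\<^sub>M M) (\<lambda>x. l u (snd x) - l u (fst x) + A u)" if "u \<in> U" for u
    proof (rule PP.P.integrable_bounded[where B = "2 * B + \<bar>A u\<bar>"])
      show "(\<lambda>x. l u (snd x) - l u (fst x) + A u) \<in> borel_measurable (M \<Otimes>\<^sub>M M)"
        using l(1)[OF that] by measurable
      fix x assume "x \<in> space (M \<Otimes>\<^sub>M M)"
      then have "\<bar>l u (fst x)\<bar> \<le> B" "\<bar>l u (snd x)\<bar> \<le> B" using l(2)[OF that] by (auto simp: space_pair_measure)
      then show "\<bar>l u (snd x) - l u (fst x) + A u\<bar> \<le> 2 * B + \<bar>A u\<bar>" by linarith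
    qed
    then show ?thesis unfolding \<Phi>_def case_prod_beta' using U by (intro integrable_Max_image)
  qed
  have \<Psi>_int: "integrable M \<Psi>"
    unfolding \<Psi>_def using U l_int by (intro integrable_divide Bochner_Integration.integrable_add integrable_Max_image) auto
  have inner: "integrable M (\<Phi> z)" for z
    unfolding \<Phi>_def using U l_int by (intro integrable_Max_image) auto
  have swap: "(\<integral>z. (\<integral>z'. \<Phi> z z' \<partial>M) \<partial>M) = (\<integral>z'. (\<integral>z. \<Phi> z z' \<partial>M) \<partial>M)"
    by (rule PP.Fubini_integral[OF int_pair, symmetric])
  have "(\<integral>z. (MAX u\<in>U. (\<integral>z. l u z \<partial>M) - l u z + A u) \<partial>M) \<le> (\<integral>z. (\<integral>z'. \<Phi> z z' \<partial>M) \<partial>M)"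
  proof (intro integral_mono)
    show "integrable M (\<lambda>z. MAX u\<in>U. (\<integral>z. l u z \<partial>M) - l u z + A u)"
      using U l_int by (intro integrable_Max_image) auto
    show "integrable M (\<lambda>z. \<integral>z'. \<Phi> z z' \<partial>M)" using PP.integrable_fst'[OF int_pair] by simp
    fix z
    show "(MAX u\<in>U. (\<integral>z. l u z \<partial>M) - l u z + A u) \<le> (\<integral>z'. \<Phi> z z' \<partial>M)"
    proof (rule Max.boundedI)
      fix y assume "y \<in> (\<lambda>u. (\<integral>z. l u z \<partial>M) - l u z + A u) ` U"
      then obtain u where u: "u \<in> U" "y = (\<integral>z. l u z \<partial>M) - l u z + A u" by auto
      have "y = (\<integral>z'. l u z' - l u z + A u \<partial>M)" using u l_int by (simp add: prob_space)
      also have "\<dots> \<le> (\<integral>z'. \<Phi> z z' \<partial>M)"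
      proof (intro integral_mono inner)
        show "integrable M (\<lambda>z'. l u z' - l u z + A u)" using u l_int by simp
        show "l u z' - l u z + A u \<le> \<Phi> z z'" for z' using u U by (simp add: \<Phi>_def)
      qed
      finally show "y \<le> (\<integral>z'. \<Phi> z z' \<partial>M)" .
    qed (use U in auto)
  qed
  also have "\<dots> = (\<integral>z. (\<integral>z'. (\<Phi> z z' + \<Phi> z' z) / 2 \<partial>M) \<partial>M)"
  proof -
    have int_swap: "integrable (M \<Otimes>\<^sub>M M) (\<lambda>(z, z'). \<Phi> z' z)"
      using PP.integrable_product_swap[OF int_pair] by (simp add: case_prod_beta')
    have "(\<integral>z. (\<integral>z'. (\<Phi> z z' + \<Phi> z' z) / 2 \<partial>M) \<partial>M) = (\<integral>x. (\<Phi> (fst x) (snd x) + \<Phi> (snd x) (fst x)) / 2 \<partial>(M \<Otimes>\<^sub>M M))"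
      using int_pair int_swap by (subst PP.integral_fst'[symmetric]) (auto simp: case_prod_beta')
    also have "\<dots> = ((\<integral>x. (case x of (z, z') \<Rightarrow> \<Phi> z z') \<partial>(M \<Otimes>\<^sub>M M)) + (\<integral>x. (case x of (z, z') \<Rightarrow> \<Phi> z' z) \<partial>(M \<Otimes>\<^sub>M M))) / 2"
      using int_pair int_swap by (simp add: case_prod_beta')
    also have "\<dots> = ((\<integral>z. (\<integral>z'. \<Phi> z z' \<partial>M) \<partial>M) + (\<integral>z. (\<integral>z'. \<Phi> z' z \<partial>M) \<partial>M)) / 2"
      using int_pair int_swap by (subst (1 2) PP.integral_fst'[symmetric]) auto
    finally show ?thesis using swap by simp
  qed
  also have "\<dots> \<le> (\<integral>z. (\<integral>z'. (\<Psi> z + \<Psi> z') / 2 \<partial>M) \<partial>M)"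
  proof -
    \<comment> \<open>\<open>l u z' - l u z + A u\<close> is the mean of
      \<open>A u + 2 * l u z'\<close> and \<open>A u - 2 * l u z\<close>. Splitting both maxima in
      this way separates the two points, at the price of the factor 2.\<close>
    have *: "(\<Phi> z z' + \<Phi> z' z) / 2 \<le> (\<Psi> z + \<Psi> z') / 2" for z z'
    proof -
      obtain u where u: "u \<in> U" "\<Phi> z z' = l u z' - l u z + A u" unfolding \<Phi>_def by (rule Max_image_obtain[OF U])
      obtain w where w: "w \<in> U" "\<Phi> z' z = l w z - l w z' + A w" unfolding \<Phi>_def by (rule Max_image_obtain[OF U])
      have "A v + 2 * l v y \<le> (MAX u\<in>U. A u + 2 * l u y)" "A v - 2 * l v y \<le> (MAX u\<in>U. A u - 2 * l u y)" if "v \<in> U" for v y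
        using U that by auto
      from this(1)[OF u(1), of z'] this(2)[OF u(1), of z] this(1)[OF w(1), of z] this(2)[OF w(1), of z']
      show ?thesis unfolding \<Psi>_def u(2) w(2) by argo
    qed
    have int_swap: "integrable (M \<Otimes>\<^sub>M M) (\<lambda>(z, z'). \<Phi> z' z)"
      using PP.integrable_product_swap[OF int_pair] by (simp add: case_prod_beta')
    have "integrable (M \<Otimes>\<^sub>M M) (\<lambda>(z, z'). (\<Phi> z z' + \<Phi> z' z) / 2)"
      using int_pair int_swap by (simp add: case_prod_beta')
    moreover have "integrable M (\<lambda>z'. \<Phi> z' z)" for z
      unfolding \<Phi>_def using U l_int by (intro integrable_Max_image) auto
    ultimately show ?thesis using * \<Psi>_int inner
      by (intro integral_mono) (auto simp: prob_space dest: PP.integrable_fst')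
  qed
  also have "\<dots> = (\<integral>z. \<Psi> z \<partial>M)" using \<Psi>_int by (simp add: prob_space add_divide_distrib)
  finally show ?thesis by (simp only: \<Psi>_def)
qed

text \<open>The last coordinate is symmetrized with the partial sum over the others in the offset.
  Once the integrals are exchanged, that coordinate is frozen and its signed loss moves into the
  offset, which is arbitrary in the induction hypothesis.\<close>

lemma symmetrization:
  fixes l :: "'u \<Rightarrow> 'a \<Rightarrow> real"
  assumes U: "finite U" "U \<noteq> {}"
    and l: "\<And>u. u \<in> U \<Longrightarrow> l u \<in> borel_measurable M" "\<And>u z. u \<in> U \<Longrightarrow> z \<in> space M \<Longrightarrow> \<bar>l u z\<bar> \<le> B"
  shows "(\<integral>S. (MAX u\<in>U. (\<Sum>i<N. (\<integral>z. l u z \<partial>M) - l u (S i)) + A u) \<partial>PiM {..<N} (\<lambda>_. M))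
    \<le> (\<integral>S. rademacher_avg N (\<lambda>i u. l u (S i)) U A \<partial>PiM {..<N} (\<lambda>_. M))"
proof (induction N arbitrary: A)
  case 0
  then show ?case by simp
next
  case (Suc N)
  interpret PN: prob_space "PiM {..<N} (\<lambda>_. M)" by (rule prob_space_PiM_same)
  let ?PN = "PiM {..<N} (\<lambda>_. M)"
  let ?PS = "PiM (insert N {..<N}) (\<lambda>_. M)"
  define E where "E u = (\<integral>z. l u z \<partial>M)" for u
  have ins: "{..<Suc N} = insert N {..<N}" by auto
  obtain u0 where "u0 \<in> U" using U by auto
  then have "0 \<le> B" using l(2) not_empty by (meson abs_ge_zero all_not_in_conv order.trans)
  have "\<bar>E u\<bar> \<le> B" if "u \<in> U" for u
  proof -
    have int: "integrable M (l u)" using l that by (auto intro!: integrable_bounded)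
    have "\<bar>E u\<bar> \<le> (\<integral>z. \<bar>l u z\<bar> \<partial>M)" unfolding E_def by (rule integral_abs_bound)
    also have "\<dots> \<le> (\<integral>z. B \<partial>M)" using int l that by (intro integral_mono) auto
    finally show ?thesis by (simp add: prob_space)
  qed
  note E_le = this
  define a where "a = (\<Sum>u\<in>U. \<bar>A u\<bar>)"
  have A_le: "\<bar>A u\<bar> \<le> a" if "u \<in> U" for u unfolding a_def using U that by (intro member_le_sum) auto
  have comp: "(\<lambda>S. l u (S i)) \<in> borel_measurable (PiM J (\<lambda>_. M))" if "u \<in> U" "i \<in> J" for u i and J :: "nat set"
    using measurable_compose[OF measurable_component_singleton[OF that(2)] l(1)[OF that(1)]] by simp
  have l_le: "\<bar>l u (S i)\<bar> \<le> B" if "u \<in> U" "S \<in> space (PiM J (\<lambda>_. M))" "i \<in> J" for u S i and J :: "nat set"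
    using l(2)[OF that(1)] that by (auto simp: space_PiM PiE_iff)
  have bound_max: "\<bar>MAX u\<in>U. g u\<bar> \<le> c" if "\<And>u. u \<in> U \<Longrightarrow> \<bar>g u\<bar> \<le> c" for c and g :: "'u \<Rightarrow> real"
    using Max_image_obtain[OF U, of g] that by metis
  have sum_le: "\<bar>\<Sum>i\<in>J. E u - l u (S i)\<bar> \<le> real (card J) * (2 * B)" if "u \<in> U" "S \<in> space (PiM K (\<lambda>_. M))" "J \<subseteq> K" for u S and J K :: "nat set"
  proof -
    have "\<bar>\<Sum>i\<in>J. E u - l u (S i)\<bar> \<le> (\<Sum>i\<in>J. \<bar>E u - l u (S i)\<bar>)" by (rule sum_abs)
    also have "\<dots> \<le> of_nat (card J) * (2 * B)"
    proof (rule sum_bounded_above)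
      fix i assume "i \<in> J"
      then show "\<bar>E u - l u (S i)\<bar> \<le> 2 * B"
        using l_le[OF that(1,2), of i] E_le[OF that(1)] that(3) by auto
    qed
    finally show ?thesis .
  qed
  define f where "f S = (MAX u\<in>U. (\<Sum>i<Suc N. E u - l u (S i)) + A u)" for S
  define f' where "f' S = ((MAX u\<in>U. (\<Sum>i<N. E u - l u (S i)) + A u + 2 * l u (S N))
      + (MAX u\<in>U. (\<Sum>i<N. E u - l u (S i)) + A u - 2 * l u (S N))) / 2" for S
  define f'' where "f'' S = rademacher_avg (Suc N) (\<lambda>i u. l u (S i)) U A" for S
  have f: "f \<in> borel_measurable ?PS" "\<And>S. S \<in> space ?PS \<Longrightarrow> \<bar>f S\<bar> \<le> real (Suc N) * (2 * B) + a"
  proof -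
    show "f \<in> borel_measurable ?PS" unfolding f_def
      using U by (intro borel_measurable_Max borel_measurable_add borel_measurable_sum borel_measurable_diff comp) auto
    fix S assume S: "S \<in> space ?PS"
    show "\<bar>f S\<bar> \<le> real (Suc N) * (2 * B) + a" unfolding f_def
    proof (rule bound_max)
      fix u assume "u \<in> U"
      then show "\<bar>(\<Sum>i<Suc N. E u - l u (S i)) + A u\<bar> \<le> real (Suc N) * (2 * B) + a"
        using sum_le[OF _ S, of u "{..<Suc N}"] A_le[of u] by (simp del: sum.lessThan_Suc add: ins)
    qed
  qed
  have f': "f' \<in> borel_measurable ?PS" "\<And>S. S \<in> space ?PS \<Longrightarrow> \<bar>f' S\<bar> \<le> real (Suc N) * (2 * B) + a"
  proof -
    show "f' \<in> borel_measurable ?PS" unfolding f'_def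
      using U by (intro borel_measurable_divide borel_measurable_Max borel_measurable_add borel_measurable_sum borel_measurable_diff borel_measurable_times comp) auto
    fix S assume S: "S \<in> space ?PS"
    have *: "\<bar>(\<Sum>i<N. E u - l u (S i)) + A u\<bar> + 2 * B \<le> real (Suc N) * (2 * B) + a" "\<bar>l u (S N)\<bar> \<le> B" if "u \<in> U" for u
    proof -
      have "\<bar>\<Sum>i<N. E u - l u (S i)\<bar> \<le> real N * (2 * B)"
        using sum_le[OF that S, of "{..<N}"] by auto
      then show "\<bar>(\<Sum>i<N. E u - l u (S i)) + A u\<bar> + 2 * B \<le> real (Suc N) * (2 * B) + a"
        using A_le[OF that] by (simp add: algebra_simps)
      show "\<bar>l u (S N)\<bar> \<le> B" using l_le[OF that S, of N] by auto
    qed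
    have "\<bar>MAX u\<in>U. (\<Sum>i<N. E u - l u (S i)) + A u + 2 * l u (S N)\<bar> \<le> real (Suc N) * (2 * B) + a"
    proof (rule bound_max)
      fix u assume "u \<in> U"
      from *[OF this] show "\<bar>(\<Sum>i<N. E u - l u (S i)) + A u + 2 * l u (S N)\<bar> \<le> real (Suc N) * (2 * B) + a" by linarith
    qed
    moreover have "\<bar>MAX u\<in>U. (\<Sum>i<N. E u - l u (S i)) + A u - 2 * l u (S N)\<bar> \<le> real (Suc N) * (2 * B) + a"
    proof (rule bound_max)
      fix u assume "u \<in> U"
      from *[OF this] show "\<bar>(\<Sum>i<N. E u - l u (S i)) + A u - 2 * l u (S N)\<bar> \<le> real (Suc N) * (2 * B) + a" by linarith
    qed
    ultimately show "\<bar>f' S\<bar> \<le> real (Suc N) * (2 * B) + a" unfolding f'_def abs_le_iff by argo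
  qed
  have f'': "f'' \<in> borel_measurable ?PS" "\<And>S. S \<in> space ?PS \<Longrightarrow> \<bar>f'' S\<bar> \<le> a + 2 * real (Suc N) * B"
  proof -
    show "f'' \<in> borel_measurable ?PS"
      unfolding f''_def using U by (intro measurable_rademacher_avg comp) auto
    fix S assume S: "S \<in> space ?PS"
    show "\<bar>f'' S\<bar> \<le> a + 2 * real (Suc N) * B"
      unfolding f''_def by (intro abs_rademacher_avg_le U A_le l_le[OF _ S]) auto
  qed
  have rad_meas: "integrable ?PN (\<lambda>S. rademacher_avg N (\<lambda>i u. l u (S i)) U A')" for A'
  proof (rule PN.integrable_bounded)
    show "(\<lambda>S. rademacher_avg N (\<lambda>i u. l u (S i)) U A') \<in> borel_measurable ?PN"
      using U by (intro measurable_rademacher_avg comp) auto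
    show "\<bar>rademacher_avg N (\<lambda>i u. l u (S i)) U A'\<bar> \<le> (\<Sum>u\<in>U. \<bar>A' u\<bar>) + 2 * real N * B" if "S \<in> space ?PN" for S
      using l_le[OF _ that] U by (intro abs_rademacher_avg_le U) (auto intro: member_le_sum)
  qed
  have max_int: "integrable ?PN (\<lambda>S. MAX u\<in>U. (\<Sum>i<N. E u - l u (S i)) + A' u)" for A'
  proof (rule integrable_Max_image[OF U])
    fix u assume "u \<in> U"
    then have "integrable ?PN (\<lambda>S. l u (S i))" if "i < N" for i
      using that comp l_le by (intro PN.integrable_bounded[where B = B]) auto
    then show "integrable ?PN (\<lambda>S. (\<Sum>i<N. E u - l u (S i)) + A' u)"
      by (intro Bochner_Integration.integrable_add Bochner_Integration.integrable_sum
          Bochner_Integration.integrable_diff PN.integrable_const) simp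
  qed
  note I_f = integral_PiM_insert[OF _ _ f] and I_f' = integral_PiM_insert[OF _ _ f'] integral_PiM_insert_rev[OF _ _ f']
    and I_f'' = integral_PiM_insert_rev[OF _ _ f'']
  have "(\<integral>S. f S \<partial>?PS) = (\<integral>S. (\<integral>z. f (S(N := z)) \<partial>M) \<partial>?PN)" by (rule I_f) auto
  also have "\<dots> \<le> (\<integral>S. (\<integral>z. f' (S(N := z)) \<partial>M) \<partial>?PN)"
  proof (rule integral_mono)
    show "integrable ?PN (\<lambda>S. \<integral>z. f (S(N := z)) \<partial>M)" by (rule integrable_PiM_insert_inner[OF _ _ f]) auto
    show "integrable ?PN (\<lambda>S. \<integral>z. f' (S(N := z)) \<partial>M)" by (rule integrable_PiM_insert_inner[OF _ _ f']) auto
    fix S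
    have "(\<integral>z. f (S(N := z)) \<partial>M) = (\<integral>z. (MAX u\<in>U. (\<integral>z. l u z \<partial>M) - l u z + ((\<Sum>i<N. E u - l u (S i)) + A u)) \<partial>M)"
      by (simp add: f_def E_def algebra_simps)
    also have "\<dots> \<le> (\<integral>z. ((MAX u\<in>U. ((\<Sum>i<N. E u - l u (S i)) + A u) + 2 * l u z)
        + (MAX u\<in>U. ((\<Sum>i<N. E u - l u (S i)) + A u) - 2 * l u z)) / 2 \<partial>M)"
      by (rule symmetrization_one_coordinate[OF U l])
    also have "\<dots> = (\<integral>z. f' (S(N := z)) \<partial>M)" by (simp add: f'_def)
    finally show "(\<integral>z. f (S(N := z)) \<partial>M) \<le> (\<integral>z. f' (S(N := z)) \<partial>M)" .
  qed
  also have "\<dots> = (\<integral>z. (\<integral>S. f' (S(N := z)) \<partial>?PN) \<partial>M)" using I_f' by simp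
  also have "\<dots> \<le> (\<integral>z. (\<integral>S. f'' (S(N := z)) \<partial>?PN) \<partial>M)"
  proof (rule integral_mono)
    show "integrable M (\<lambda>z. \<integral>S. f' (S(N := z)) \<partial>?PN)" by (rule integrable_PiM_insert_inner[OF _ _ f']) auto
    show "integrable M (\<lambda>z. \<integral>S. f'' (S(N := z)) \<partial>?PN)" by (rule integrable_PiM_insert_inner[OF _ _ f'']) auto
    fix z
    have rc: "rademacher_avg N (\<lambda>i u. l u (if i = N then z else S i)) U A' = rademacher_avg N (\<lambda>i u. l u (S i)) U A'" for S A'
      by (rule rademacher_avg_cong) auto
    have "(\<integral>S. f' (S(N := z)) \<partial>?PN) = ((\<integral>S. (MAX u\<in>U. (\<Sum>i<N. E u - l u (S i)) + (A u + 2 * l u z)) \<partial>?PN)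
      + (\<integral>S. (MAX u\<in>U. (\<Sum>i<N. E u - l u (S i)) + (A u - 2 * l u z)) \<partial>?PN)) / 2"
      using max_int by (simp add: f'_def add.assoc add_diff_eq[symmetric])
    also have "\<dots> \<le> ((\<integral>S. rademacher_avg N (\<lambda>i u. l u (S i)) U (\<lambda>u. A u + 2 * l u z) \<partial>?PN)
      + (\<integral>S. rademacher_avg N (\<lambda>i u. l u (S i)) U (\<lambda>u. A u - 2 * l u z) \<partial>?PN)) / 2"
      using Suc.IH[of "\<lambda>u. A u + 2 * l u z"] Suc.IH[of "\<lambda>u. A u - 2 * l u z"]
      unfolding E_def[symmetric] by simp
    also have "\<dots> = (\<integral>S. f'' (S(N := z)) \<partial>?PN)"
      using rad_meas by (simp add: f''_def rc)
    finally show "(\<integral>S. f' (S(N := z)) \<partial>?PN) \<le> (\<integral>S. f'' (S(N := z)) \<partial>?PN)" .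
  qed
  also have "\<dots> = (\<integral>S. f'' S \<partial>?PS)" using I_f'' by simp
  finally show ?case unfolding f_def f''_def E_def ins .
qed

end

text \<open>A distance is, up to a constant, the expected modulus of a Gaussian linear form, which allows
  to replace the loss by a Gaussian process without a comparison theorem.\<close>

lemma contraction_one_coordinate:
  assumes U: "finite U" "U \<noteq> {}" and "finite I" "0 \<le> L"
    and lip: "\<And>u w. u \<in> U \<Longrightarrow> w \<in> U \<Longrightarrow> l u - l w \<le> L * l2_dist I (v u) (v w)"
  shows "((MAX u\<in>U. A u + 2 * l u) + (MAX u\<in>U. A u - 2 * l u)) / 2
    \<le> (\<integral>g. (MAX u\<in>U. A u + sqrt (2 * pi) * L * dotp I g (v u)) \<partial>gaussian I)"
proof -
  \<comment> \<open>\<open>sqrt (2 * pi)\<close> is chosen so that \<open>c / 2\<close> times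
    \<open>sqrt (2 / pi)\<close>, the mean modulus per unit of distance, equals
    \<open>L\<close>.\<close>
  define c where "c = sqrt (2 * pi) * L"
  have "0 \<le> c" using \<open>0 \<le> L\<close> by (simp add: c_def)
  define M where "M g = (MAX u\<in>U. A u + c * dotp I g (v u))" for g
  define M' where "M' g = (MAX u\<in>U. A u - c * dotp I g (v u))" for g
  interpret prob_space "gaussian I" by simp
  have int: "integrable (gaussian I) M" "integrable (gaussian I) M'"
    unfolding M_def M'_def using U integrable_dotp[of I] by (auto intro!: integrable_Max_image)
  have "(\<integral>g. M' g \<partial>gaussian I) = (\<integral>g. M (\<lambda>i\<in>I. - g i) \<partial>gaussian I)"
    by (simp add: M_def M'_def dotp_def sum_negf)
  also have "\<dots> = (\<integral>g. M g \<partial>gaussian I)"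
    using int by (intro integral_gaussian_uminus \<open>finite I\<close>) auto
  finally have M': "(\<integral>g. M' g \<partial>gaussian I) = (\<integral>g. M g \<partial>gaussian I)" .
  obtain u where u: "u \<in> U" "(MAX u\<in>U. A u + 2 * l u) = A u + 2 * l u" by (rule Max_image_obtain[OF U])
  obtain w where w: "w \<in> U" "(MAX u\<in>U. A u - 2 * l u) = A w - 2 * l w" by (rule Max_image_obtain[OF U])
  have cc: "c * sqrt (2 / pi) = 2 * L"
    by (simp add: c_def real_sqrt_mult real_sqrt_divide)
  have "((MAX u\<in>U. A u + 2 * l u) + (MAX u\<in>U. A u - 2 * l u)) / 2 = (A u + A w) / 2 + (l u - l w)"
    using u w by (simp add: field_simps)
  also have "\<dots> \<le> (A u + A w) / 2 + L * l2_dist I (v u) (v w)" using lip[OF u(1) w(1)] by simp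
  also have "\<dots> = (\<integral>g. (A u + A w) / 2 + c / 2 * \<bar>dotp I g (\<lambda>i. v u i - v w i)\<bar> \<partial>gaussian I)"
    using integrable_dotp[of I] \<open>finite I\<close> cc by (simp add: prob_space integral_abs_dotp l2_dist_def)
  \<comment> \<open>Whichever sign the modulus takes, one of \<open>u\<close> and \<open>w\<close>
    is inserted into the maximum \<open>M g\<close> and the other into \<open>M' g\<close>; by
    reflection both maxima have the same mean.\<close>
  also have "\<dots> \<le> (\<integral>g. (M g + M' g) / 2 \<partial>gaussian I)"
  proof (intro integral_mono)
    show "integrable (gaussian I) (\<lambda>g. (A u + A w) / 2 + c / 2 * \<bar>dotp I g (\<lambda>i. v u i - v w i)\<bar>)"
      using integrable_dotp[of I] by simp
    show "integrable (gaussian I) (\<lambda>g. (M g + M' g) / 2)" using int by simp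
    fix g
    have "A x + c * dotp I g (v x) \<le> M g" "A x - c * dotp I g (v x) \<le> M' g" if "x \<in> U" for x
      unfolding M_def M'_def using U that by auto
    note b = this[OF u(1)] this[OF w(1)]
    have e: "c / 2 * \<bar>dotp I g (\<lambda>i. v u i - v w i)\<bar> = \<bar>c * dotp I g (v u) - c * dotp I g (v w)\<bar> / 2"
      using \<open>0 \<le> c\<close> by (simp add: dotp_diff_right right_diff_distrib[symmetric] abs_mult)
    show "(A u + A w) / 2 + c / 2 * \<bar>dotp I g (\<lambda>i. v u i - v w i)\<bar> \<le> (M g + M' g) / 2"
      unfolding e unfolding abs_real_def using b by argo
  qed
  also have "\<dots> = (\<integral>g. M g \<partial>gaussian I)" using int M' by simp
  finally show ?thesis by (simp only: M_def c_def)
qed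

text \<open>Each sample point owns an independent block \<open>J \<times> {i}\<close> of Gaussian
  variables. The sign of the last point is replaced by its block while the other blocks are frozen
  in the offset, and Fubini merges the blocks.\<close>

lemma rademacher_avg_le_gaussian:
  assumes U: "finite U" "U \<noteq> {}" and "finite J" "0 \<le> L"
    and lip: "\<And>i u w. i < N \<Longrightarrow> u \<in> U \<Longrightarrow> w \<in> U \<Longrightarrow> l i u - l i w \<le> L * l2_dist (J \<times> {i}) (v u) (v w)"
  shows "rademacher_avg N l U A
    \<le> (\<integral>g. (MAX u\<in>U. A u + sqrt (2 * pi) * L * dotp (J \<times> {..<N}) g (v u)) \<partial>gaussian (J \<times> {..<N}))"
  using lip
proof (induction N arbitrary: A)
  case 0
  show ?case by (simp add: dotp_def prob_space.prob_space)
next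
  case (Suc N)
  let ?I = "J \<times> {..<N}" and ?K = "J \<times> {N}"
  define c where "c = sqrt (2 * pi) * L"
  have fin: "finite ?I" "finite ?K" "?I \<inter> ?K = {}" and un: "J \<times> {..<Suc N} = ?I \<union> ?K" using \<open>finite J\<close> by auto
  have int_f: "integrable (gaussian K) (\<lambda>g. MAX u\<in>U. A' u + c * dotp K g (v u))" for A' K
  proof -
    interpret prob_space "gaussian K" by simp
    show ?thesis using U integrable_dotp[of K] by (auto intro!: integrable_Max_image)
  qed
  have "rademacher_avg (Suc N) l U A
    \<le> ((\<integral>g. (MAX u\<in>U. A u + 2 * l N u + c * dotp ?I g (v u)) \<partial>gaussian ?I)
      + (\<integral>g. (MAX u\<in>U. A u - 2 * l N u + c * dotp ?I g (v u)) \<partial>gaussian ?I)) / 2"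
    using Suc.IH[of "\<lambda>u. A u + 2 * l N u"] Suc.IH[of "\<lambda>u. A u - 2 * l N u"] Suc.prems
    by (simp add: c_def)
  also have "\<dots> = (\<integral>g. ((MAX u\<in>U. A u + 2 * l N u + c * dotp ?I g (v u)) + (MAX u\<in>U. A u - 2 * l N u + c * dotp ?I g (v u))) / 2 \<partial>gaussian ?I)"
    using int_f[of ?I "\<lambda>u. A u + 2 * l N u"] int_f[of ?I "\<lambda>u. A u - 2 * l N u"] by simp
  also have "\<dots> \<le> (\<integral>g. (\<integral>g'. (MAX u\<in>U. A u + c * dotp (?I \<union> ?K) (merge ?I ?K (g, g')) (v u)) \<partial>gaussian ?K) \<partial>gaussian ?I)"
  proof (intro integral_mono)
    show "integrable (gaussian ?I) (\<lambda>g. ((MAX u\<in>U. A u + 2 * l N u + c * dotp ?I g (v u)) + (MAX u\<in>U. A u - 2 * l N u + c * dotp ?I g (v u))) / 2)"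
      using int_f[of ?I "\<lambda>u. A u + 2 * l N u"] int_f[of ?I "\<lambda>u. A u - 2 * l N u"] by simp
    show "integrable (gaussian ?I) (\<lambda>g. \<integral>g'. (MAX u\<in>U. A u + c * dotp (?I \<union> ?K) (merge ?I ?K (g, g')) (v u)) \<partial>gaussian ?K)"
    proof -
      interpret prob_space "gaussian ?I" by simp
      interpret K: prob_space "gaussian ?K" by simp
      interpret pair_sigma_finite "gaussian ?I" "gaussian ?K" ..
      have "distr (gaussian ?I \<Otimes>\<^sub>M gaussian ?K) (gaussian (?I \<union> ?K)) (merge ?I ?K) = gaussian (?I \<union> ?K)"
        by (rule std_normal_product.distr_merge[OF fin(3,1,2)])
      then have "integrable (distr (gaussian ?I \<Otimes>\<^sub>M gaussian ?K) (gaussian (?I \<union> ?K)) (merge ?I ?K))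
          (\<lambda>g. MAX u\<in>U. A u + c * dotp (?I \<union> ?K) g (v u))" using int_f[of "?I \<union> ?K" A] by (simp only:)
      from integrable_distr[OF measurable_merge this] show ?thesis by (rule integrable_fst')
    qed
    fix g
    have d: "dotp (?I \<union> ?K) (merge ?I ?K (g, g')) x = dotp ?I g x + dotp ?K g' x" for g' x
      unfolding dotp_def by (subst sum.union_disjoint) (use fin in \<open>auto intro!: arg_cong2[where f = "(+)"] sum.cong simp: merge_def\<close>)
    have "((MAX u\<in>U. (A u + c * dotp ?I g (v u)) + 2 * l N u) + (MAX u\<in>U. (A u + c * dotp ?I g (v u)) - 2 * l N u)) / 2
      \<le> (\<integral>g'. (MAX u\<in>U. (A u + c * dotp ?I g (v u)) + sqrt (2 * pi) * L * dotp ?K g' (v u)) \<partial>gaussian ?K)"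
      using Suc.prems by (intro contraction_one_coordinate U fin \<open>0 \<le> L\<close>) auto
    then show "((MAX u\<in>U. A u + 2 * l N u + c * dotp ?I g (v u)) + (MAX u\<in>U. A u - 2 * l N u + c * dotp ?I g (v u))) / 2
      \<le> (\<integral>g'. (MAX u\<in>U. A u + c * dotp (?I \<union> ?K) (merge ?I ?K (g, g')) (v u)) \<partial>gaussian ?K)"
      unfolding d by (simp add: c_def algebra_simps)
  qed
  also have "\<dots> = (\<integral>g. (MAX u\<in>U. A u + c * dotp (?I \<union> ?K) g (v u)) \<partial>gaussian (?I \<union> ?K))"
    by (rule std_normal_product.product_integral_fold[OF fin(3,1,2) int_f, symmetric])
  finally show ?case unfolding un c_def .
qed

lemma rademacher_avg_le_gaussian_width:
  assumes U: "finite U" "U \<noteq> {}" and "finite J" "0 \<le> L"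
    and lip: "\<And>i u w. i < N \<Longrightarrow> u \<in> U \<Longrightarrow> w \<in> U \<Longrightarrow> l i u - l i w \<le> L * l2_dist (J \<times> {i}) (v u) (v w)"
  shows "rademacher_avg N l U (\<lambda>_. 0) \<le> sqrt (2 * pi) * L * gaussian_width (J \<times> {..<N}) U v"
proof -
  have "(MAX u\<in>U. sqrt (2 * pi) * L * dotp I g (v u)) = sqrt (2 * pi) * L * (MAX u\<in>U. dotp I g (v u))" for g I
  proof -
    have "mono ((*) (sqrt (2 * pi) * L))" using \<open>0 \<le> L\<close> by (intro monoI mult_left_mono) auto
    from mono_Max_commute[OF this, of "(\<lambda>u. dotp I g (v u)) ` U"] show ?thesis
      using U by (simp add: image_image)
  qed
  then show ?thesis
    using rademacher_avg_le_gaussian[where l = l and v = v and A = "\<lambda>_. 0", OF assms] by (simp add: gaussian_width_def)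
qed

section \<open>Uniform deviations in a classification task\<close>

lemma restrict_in_Rn [simp]: "restrict v {..<q} \<in> space (Rn q)"
  by (simp add: Rn_def space_PiM)

text \<open>The Lipschitz bound concerns vectors extensional on \<open>{..<q}\<close>. Composing
  with \<open>restrict\<close> extends the loss to all functions, where the bound yields continuity
  in the product topology and thus Borel measurability; padding with zeros pulls this back to
  \<open>Rn q\<close>.\<close>

lemma borel_measurable_lipschitz_loss:
  assumes lip: "lipschitz_loss q L l" and y: "y \<in> cube q"
  shows "(\<lambda>v. l v y) \<in> borel_measurable (Rn q)"
proof -
  define F where "F v = l (restrict v {..<q}) y" for v
  have F_lip: "\<bar>F w - F v\<bar> \<le> L * L2_set (\<lambda>i. w i - v i) {..<q}" for v w
  proof -
    have "\<bar>F w - F v\<bar> \<le> L * euclid_dist q (restrict w {..<q}) (restrict v {..<q})"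
      using lip y unfolding lipschitz_loss_def F_def by simp
    also have "euclid_dist q (restrict w {..<q}) (restrict v {..<q}) = L2_set (\<lambda>i. w i - v i) {..<q}"
      unfolding euclid_dist_def by (intro L2_set_cong) auto
    finally show ?thesis .
  qed
  have "isCont F v" for v
  proof -
    have "continuous_on UNIV (\<lambda>w :: vec. L * L2_set (\<lambda>i. w i - v i) {..<q})"
      unfolding L2_set_def by (intro continuous_intros continuous_on_product_coordinates)
    then have "isCont (\<lambda>w :: vec. L * L2_set (\<lambda>i. w i - v i) {..<q}) v"
      by (simp add: continuous_on_eq_continuous_at)
    then have "((\<lambda>w :: vec. L * L2_set (\<lambda>i. w i - v i) {..<q}) \<longlongrightarrow> 0) (at v)"
      by (simp add: isCont_def L2_set_def)
    then have "((\<lambda>w. F w - F v) \<longlongrightarrow> 0) (at v)"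
      by (rule Lim_null_comparison[rotated]) (use F_lip in auto)
    then show ?thesis unfolding isCont_def by (rule LIM_zero_cancel)
  qed
  then have "F \<in> borel_measurable borel"
    by (intro borel_measurable_continuous_onI) (auto simp: continuous_on_eq_continuous_at)
  then have F_meas: "F \<in> borel_measurable (PiM UNIV (\<lambda>_. borel))"
    by (simp add: measurable_cong_sets[OF sets_PiM_equal_borel refl])
  have emb: "(\<lambda>v i. if i < q then v i else 0) \<in> Rn q \<rightarrow>\<^sub>M PiM UNIV (\<lambda>_. borel :: real measure)"
  proof (rule measurable_PiM_single')
    fix i :: nat
    show "(\<lambda>v. if i < q then v i else 0) \<in> borel_measurable (Rn q)"
      by (cases "i < q") (auto simp: Rn_def intro!: measurable_component_singleton)
  qed auto
  have "(\<lambda>v. F (\<lambda>i. if i < q then v i else 0)) \<in> borel_measurable (Rn q)"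
    by (rule measurable_compose[OF emb F_meas])
  also have "?this \<longleftrightarrow> ?thesis"
  proof (rule measurable_cong)
    fix v assume v: "v \<in> space (Rn q)"
    have "restrict (\<lambda>i. if i < q then v i else 0) {..<q} = v"
      using v by (auto simp: Rn_def space_PiM PiE_iff extensional_def)
    then show "F (\<lambda>i. if i < q then v i else 0) = l v y" by (simp add: F_def)
  qed
  finally show ?thesis .
qed

lemma one_hot_subset_cube: "one_hot q \<subseteq> cube q"
  by (auto simp: one_hot_def cube_def PiE_iff extensional_def split: if_splits)

lemma finite_one_hot: "finite (one_hot q)"
  by (simp add: one_hot_def)

text \<open>The pre-training and the downstream task are two instances, so that one deviation
  estimate serves both stages.\<close>

locale bounded_task =
  fixes d q :: nat and X :: "vec set" and P :: "(vec \<times> vec) measure"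
    and l :: "vec \<Rightarrow> vec \<Rightarrow> real" and B L :: real
  assumes task: "classification_task d q X P" and bounded: "bounded_loss q B l" and lipschitz: "lipschitz_loss q L l"
begin

sublocale prob_space P
  using task by (simp add: classification_task_def)

lemma X_subset: "X \<subseteq> space (Rn d)" and sets_P: "sets P = sets (input_space d X \<Otimes>\<^sub>M count_space (one_hot q))"
  using task by (simp_all add: classification_task_def)

lemma space_input_space: "space (input_space d X) = X"
  using X_subset by (auto simp: input_space_def space_restrict_space)

lemma space_P: "space P = X \<times> one_hot q"
  using sets_eq_imp_space_eq[OF sets_P] by (simp add: space_pair_measure space_input_space)

lemma L_nonneg: "0 \<le> L" using lipschitz by (simp add: lipschitz_loss_def)

definition ex_loss :: "(vec \<Rightarrow> vec) \<Rightarrow> vec \<times> vec \<Rightarrow> real" where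
  "ex_loss u z = l (u (fst z)) (snd z)"

lemma fst_measurable: "fst \<in> P \<rightarrow>\<^sub>M input_space d X"
  by (simp add: measurable_cong_sets[OF sets_P refl])

text \<open>Labels range over a finite set, so measurability in the prediction for each fixed label
  is enough.\<close>

lemma ex_loss_measurable:
  assumes "u \<in> Rn d \<rightarrow>\<^sub>M Rn q" shows "ex_loss u \<in> borel_measurable P"
proof -
  have "(\<lambda>z. l (u (fst z)) (snd z)) \<in> borel_measurable P"
  proof (rule measurable_compose_countable'[where f = "\<lambda>y z. l (u (fst z)) y" and g = snd and I = "one_hot q"])
    fix y assume "y \<in> one_hot q"
    then have "(\<lambda>v. l v y) \<in> borel_measurable (Rn q)"
      using borel_measurable_lipschitz_loss[OF lipschitz] one_hot_subset_cube by auto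
    moreover have "u \<in> input_space d X \<rightarrow>\<^sub>M Rn q"
      unfolding input_space_def by (rule measurable_restrict_space1[OF assms])
    ultimately show "(\<lambda>z. l (u (fst z)) y) \<in> borel_measurable P"
      using measurable_compose[OF measurable_compose[OF fst_measurable]] by blast
  next
    show "snd \<in> P \<rightarrow>\<^sub>M count_space (one_hot q)"
      by (simp add: measurable_cong_sets[OF sets_P refl])
  qed (simp add: finite_one_hot countable_finite)
  then show ?thesis by (simp add: ex_loss_def[abs_def])
qed

lemma in_Rn:
  assumes "u \<in> Rn d \<rightarrow>\<^sub>M Rn q" "z \<in> space P" shows "u (fst z) \<in> space (Rn q)" "snd z \<in> cube q" "fst z \<in> X"
  using measurable_space[OF assms(1)] assms(2) X_subset one_hot_subset_cube[of q] by (auto simp: space_P)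

lemma abs_ex_loss_le:
  assumes "u \<in> Rn d \<rightarrow>\<^sub>M Rn q" "z \<in> space P" shows "\<bar>ex_loss u z\<bar> \<le> B"
  using bounded in_Rn[OF assms] by (simp add: bounded_loss_def ex_loss_def)

lemma ex_loss_diff_le:
  assumes "u \<in> Rn d \<rightarrow>\<^sub>M Rn q" "u' \<in> Rn d \<rightarrow>\<^sub>M Rn q" "z \<in> space P"
  shows "\<bar>ex_loss u z - ex_loss u' z\<bar> \<le> L * euclid_dist q (u (fst z)) (u' (fst z))"
  using lipschitz in_Rn[OF assms(1,3)] in_Rn[OF assms(2,3)] by (simp add: lipschitz_loss_def ex_loss_def)

lemma ex_loss_integrable: "u \<in> Rn d \<rightarrow>\<^sub>M Rn q \<Longrightarrow> integrable P (ex_loss u)"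
  using ex_loss_measurable abs_ex_loss_le by (rule integrable_bounded)

lemma risk_eq: "risk P l u = (\<integral>z. ex_loss u z \<partial>P)"
  by (simp add: risk_def ex_loss_def)

lemma emp_risk_eq: "emp_risk N l S u = (\<Sum>i<N. ex_loss u (S i)) / real N"
  by (simp add: emp_risk_def ex_loss_def)

lemma B_nonneg: "0 \<le> B"
proof -
  have "restrict (\<lambda>_. 0) {..<q} \<in> cube q" by (auto simp: cube_def)
  then show ?thesis
    using bounded restrict_in_Rn[of "\<lambda>_. 0" q] unfolding bounded_loss_def by (meson abs_ge_zero order.trans)
qed

lemma abs_risk_le:
  assumes "u \<in> Rn d \<rightarrow>\<^sub>M Rn q" shows "\<bar>risk P l u\<bar> \<le> B"
proof -
  have "\<bar>risk P l u\<bar> \<le> (\<integral>z. \<bar>ex_loss u z\<bar> \<partial>P)" unfolding risk_eq by (rule integral_abs_bound)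
  also have "\<dots> \<le> (\<integral>z. B \<partial>P)"
    using ex_loss_integrable[OF assms] abs_ex_loss_le[OF assms] by (intro integral_mono) auto
  finally show ?thesis by (simp add: prob_space)
qed

section \<open>Empirical risks and their deviations\<close>

abbreviation sample_space :: "nat \<Rightarrow> sample measure" where
  "sample_space N \<equiv> PiM {..<N} (\<lambda>_. P)"

lemma sample_component: "S \<in> space (sample_space N) \<Longrightarrow> i < N \<Longrightarrow> S i \<in> space P"
  by (auto simp: space_PiM PiE_iff)

lemma abs_emp_risk_le:
  assumes "u \<in> Rn d \<rightarrow>\<^sub>M Rn q" "S \<in> space (sample_space N)" shows "\<bar>emp_risk N l S u\<bar> \<le> B"
proof (cases "N = 0")
  case False
  have "\<bar>\<Sum>i<N. ex_loss u (S i)\<bar> \<le> (\<Sum>i<N. \<bar>ex_loss u (S i)\<bar>)" by (rule sum_abs)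
  also have "\<dots> \<le> of_nat (card {..<N}) * B"
    using abs_ex_loss_le[OF assms(1)] sample_component[OF assms(2)] by (intro sum_bounded_above) auto
  finally show ?thesis using False by (simp add: emp_risk_eq divide_le_eq mult.commute)
qed (simp add: emp_risk_eq B_nonneg)

lemma emp_risk_measurable:
  assumes "u \<in> Rn d \<rightarrow>\<^sub>M Rn q" shows "(\<lambda>S. emp_risk N l S u) \<in> borel_measurable (sample_space N)"
  unfolding emp_risk_eq
  by (intro borel_measurable_divide borel_measurable_sum borel_measurable_const
      measurable_compose[OF _ ex_loss_measurable[OF assms]] measurable_component_singleton)

lemma emp_risk_integrable:
  assumes "u \<in> Rn d \<rightarrow>\<^sub>M Rn q" shows "integrable (sample_space N) (\<lambda>S. emp_risk N l S u)"
  using emp_risk_measurable[OF assms] abs_emp_risk_le[OF assms]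
  by (rule prob_space.integrable_bounded[OF prob_space_PiM_same])

lemma integral_emp_risk:
  assumes u: "u \<in> Rn d \<rightarrow>\<^sub>M Rn q" and "1 \<le> N"
  shows "(\<integral>S. emp_risk N l S u \<partial>sample_space N) = risk P l u"
proof -
  have int: "integrable (sample_space N) (\<lambda>S. ex_loss u (S i))" and eq: "(\<integral>S. ex_loss u (S i) \<partial>sample_space N) = risk P l u"
    if "i < N" for i
  proof -
    have d: "distr (sample_space N) P (\<lambda>S. S i) = P"
      using that by (intro distr_PiM_component prob_space_axioms) auto
    have m: "(\<lambda>S. S i) \<in> sample_space N \<rightarrow>\<^sub>M P" using that by (intro measurable_component_singleton) auto
    show "integrable (sample_space N) (\<lambda>S. ex_loss u (S i))"
      by (rule integrable_distr[OF m]) (simp add: d ex_loss_integrable[OF u])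
    show "(\<integral>S. ex_loss u (S i) \<partial>sample_space N) = risk P l u"
      using integral_distr[OF m ex_loss_measurable[OF u]] by (simp add: d risk_eq)
  qed
  then show ?thesis using \<open>1 \<le> N\<close> by (simp add: emp_risk_eq)
qed

lemma emp_risk_update:
  assumes "u \<in> Rn d \<rightarrow>\<^sub>M Rn q" "S \<in> space (sample_space N)" "i < N" "z \<in> space P"
  shows "\<bar>emp_risk N l S u - emp_risk N l (S(i := z)) u\<bar> \<le> 2 * B / N"
proof -
  have "(\<Sum>j<N. ex_loss u (S j)) - (\<Sum>j<N. ex_loss u ((S(i := z)) j)) = (\<Sum>j<N. ex_loss u (S j) - ex_loss u ((S(i := z)) j))"
    by (simp add: sum_subtractf)
  also have "\<dots> = (\<Sum>j\<in>{i}. ex_loss u (S j) - ex_loss u ((S(i := z)) j))"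
    using assms(3) by (intro sum.mono_neutral_right) auto
  finally have "emp_risk N l S u - emp_risk N l (S(i := z)) u = (ex_loss u (S i) - ex_loss u z) / N"
    unfolding emp_risk_eq by (simp only: diff_divide_distrib[symmetric]) simp
  moreover have "\<bar>ex_loss u (S i) - ex_loss u z\<bar> \<le> 2 * B"
    using abs_ex_loss_le[OF assms(1) assms(4)] abs_ex_loss_le[OF assms(1) sample_component[OF assms(2,3)]] by linarith
  ultimately show ?thesis by (simp add: divide_right_mono)
qed

abbreviation rad :: "nat \<Rightarrow> ('u \<Rightarrow> vec \<Rightarrow> vec) \<Rightarrow> 'u set \<Rightarrow> sample \<Rightarrow> real" where
  "rad N F U S \<equiv> rademacher_avg N (\<lambda>i u. ex_loss (F u) (S i)) U (\<lambda>_. 0)"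

text \<open>The second summand is the deviation, with opposite sign, of a comparison predictor. For
  \<open>u0\<close> fixed before the sample is drawn it has mean zero, so it leaves the expectation
  unchanged, and both parts of an empirical-minimization argument enter a single exponential
  moment.\<close>

definition deviation :: "nat \<Rightarrow> 'u set \<Rightarrow> ('u \<Rightarrow> vec \<Rightarrow> vec) \<Rightarrow> (vec \<Rightarrow> vec) \<Rightarrow> sample \<Rightarrow> real" where
  "deviation N U F u0 S = (MAX u\<in>U. risk P l (F u) - emp_risk N l S (F u)) + (emp_risk N l S u0 - risk P l u0)"

lemma deviation_measurable:
  assumes "finite U" "\<And>u. u \<in> U \<Longrightarrow> F u \<in> Rn d \<rightarrow>\<^sub>M Rn q" "u0 \<in> Rn d \<rightarrow>\<^sub>M Rn q"
  shows "deviation N U F u0 \<in> borel_measurable (sample_space N)"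
  unfolding deviation_def[abs_def]
  by (intro borel_measurable_add borel_measurable_diff borel_measurable_const borel_measurable_Max emp_risk_measurable assms)

text \<open>Replacing one example moves each of the two summands by at most
  \<open>2 * B / N\<close>, and \<open>N * (4 * B / N)\<^sup>2 / 8\<close> is the variance term
  \<open>2 * B\<^sup>2 / N\<close>. Symmetrization bounds the mean of the maximum by the sign
  average that enters \<open>\<mu>\<close>.\<close>

lemma exp_deviation_le:
  assumes U: "finite U" "U \<noteq> {}" and F: "\<And>u. u \<in> U \<Longrightarrow> F u \<in> Rn d \<rightarrow>\<^sub>M Rn q" and u0: "u0 \<in> Rn d \<rightarrow>\<^sub>M Rn q"
    and "1 \<le> N" "0 \<le> t"
    and \<mu>: "(\<integral>S. rad N F U S \<partial>sample_space N) / N \<le> \<mu>"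
  shows "(\<integral>\<^sup>+S. ennreal (exp (t * deviation N U F u0 S)) \<partial>sample_space N) \<le> ennreal (exp (t * \<mu> + 2 * t\<^sup>2 * B\<^sup>2 / N))"
proof -
  interpret S: prob_space "sample_space N" by (rule prob_space_PiM_same)
  have "0 < real N" using \<open>1 \<le> N\<close> by simp
  have dev_le: "\<bar>deviation N U F u0 S\<bar> \<le> 4 * B" if S: "S \<in> space (sample_space N)" for S
  proof -
    obtain u where u: "u \<in> U" "(MAX u\<in>U. risk P l (F u) - emp_risk N l S (F u)) = risk P l (F u) - emp_risk N l S (F u)"
      by (rule Max_image_obtain[OF U])
    show ?thesis unfolding deviation_def u(2)
      using abs_risk_le[OF F[OF u(1)]] abs_risk_le[OF u0] abs_emp_risk_le[OF F[OF u(1)] S] abs_emp_risk_le[OF u0 S] by linarith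
  qed
  have diff: "\<bar>deviation N U F u0 S - deviation N U F u0 (S(i := z))\<bar> \<le> 4 * B / N"
    if S: "S \<in> space (sample_space N)" "i < N" "z \<in> space P" for S i z
  proof -
    have eq: "2 * B / N + 2 * B / N = 4 * B / N" by simp
    note up = emp_risk_update[OF _ S]
    have "(MAX u\<in>U. risk P l (F u) - emp_risk N l S (F u)) \<le> (MAX u\<in>U. risk P l (F u) - emp_risk N l (S(i := z)) (F u)) + 2 * B / N"
      by (intro Max_image_diff_le U) (use up[OF F] in \<open>smt (verit)\<close>)
    moreover have "(MAX u\<in>U. risk P l (F u) - emp_risk N l (S(i := z)) (F u)) \<le> (MAX u\<in>U. risk P l (F u) - emp_risk N l S (F u)) + 2 * B / N"
      by (intro Max_image_diff_le U) (use up[OF F] in \<open>smt (verit)\<close>)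
    ultimately show ?thesis using up[OF u0] eq unfolding deviation_def by linarith
  qed
  have sum_eq: "(MAX u\<in>U. risk P l (F u) - emp_risk N l S (F u)) = (MAX u\<in>U. (\<Sum>i<N. risk P l (F u) - ex_loss (F u) (S i)) + 0) / N" for S
  proof -
    have "mono (\<lambda>x::real. x / N)" by (intro monoI divide_right_mono) auto
    from mono_Max_commute[OF this, of "(\<lambda>u. (\<Sum>i<N. risk P l (F u) - ex_loss (F u) (S i)) + 0) ` U"]
    have "(MAX u\<in>U. (\<Sum>i<N. risk P l (F u) - ex_loss (F u) (S i)) + 0) / N = (MAX u\<in>U. (\<Sum>i<N. risk P l (F u) - ex_loss (F u) (S i)) / N)"
      using U by (simp add: image_image)
    also have "\<dots> = (MAX u\<in>U. risk P l (F u) - emp_risk N l S (F u))"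
      using \<open>0 < real N\<close> by (simp add: emp_risk_eq sum_subtractf diff_divide_distrib)
    finally show ?thesis by simp
  qed
  have max_int: "integrable (sample_space N) (\<lambda>S. MAX u\<in>U. risk P l (F u) - emp_risk N l S (F u))"
    using F emp_risk_integrable by (intro integrable_Max_image U Bochner_Integration.integrable_diff S.integrable_const) auto
  have "(\<integral>S. deviation N U F u0 S \<partial>sample_space N) = (\<integral>S. (MAX u\<in>U. risk P l (F u) - emp_risk N l S (F u)) \<partial>sample_space N)"
    unfolding deviation_def using max_int emp_risk_integrable[OF u0, of N] integral_emp_risk[OF u0 \<open>1 \<le> N\<close>]
    by (simp add: S.prob_space)
  also have "\<dots> = (\<integral>S. (MAX u\<in>U. (\<Sum>i<N. risk P l (F u) - ex_loss (F u) (S i)) + 0) \<partial>sample_space N) / N"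
    unfolding sum_eq by simp
  also have "\<dots> \<le> (\<integral>S. rad N F U S \<partial>sample_space N) / N"
    unfolding risk_eq using F ex_loss_measurable abs_ex_loss_le
    by (intro divide_right_mono symmetrization[where l = "\<lambda>u. ex_loss (F u)" and A = "\<lambda>_. 0" and B = B] U) auto
  finally have mean: "(\<integral>S. deviation N U F u0 S \<partial>sample_space N) \<le> \<mu>" using \<mu> by linarith
  have "(\<integral>\<^sup>+S. ennreal (exp (t * deviation N U F u0 S)) \<partial>sample_space N)
    \<le> ennreal (exp (t * (\<integral>S. deviation N U F u0 S \<partial>sample_space N) + real N * t\<^sup>2 * (4 * B / N)\<^sup>2 / 8))"
    by (rule mcdiarmid_exponential[OF deviation_measurable[OF U(1) F u0] dev_le diff \<open>0 \<le> t\<close>])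
  also have "\<dots> \<le> ennreal (exp (t * \<mu> + 2 * t\<^sup>2 * B\<^sup>2 / N))"
  proof -
    have "real N * t\<^sup>2 * (4 * B / N)\<^sup>2 / 8 = 2 * t\<^sup>2 * B\<^sup>2 / N"
      using \<open>0 < real N\<close> by (simp add: field_simps power2_eq_square)
    then show ?thesis unfolding \<open>real N * t\<^sup>2 * (4 * B / N)\<^sup>2 / 8 = 2 * t\<^sup>2 * B\<^sup>2 / N\<close>
      using mean \<open>0 \<le> t\<close> by (intro ennreal_leI iffD2[OF exp_le_cancel_iff] add_right_mono mult_left_mono)
  qed
  finally show ?thesis .
qed

text \<open>The supremum is taken of the exponentials in \<open>ennreal\<close>, where it exists for
  every sample, is measurable as a countable supremum, and for \<open>0 \<le> t\<close> commutes
  with the integral along increasing classes.\<close>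

definition sup_exp_deviation :: "real \<Rightarrow> nat \<Rightarrow> (nat \<Rightarrow> 'u set) \<Rightarrow> ('u \<Rightarrow> vec \<Rightarrow> vec) \<Rightarrow> (vec \<Rightarrow> vec) \<Rightarrow> sample \<Rightarrow> ennreal" where
  "sup_exp_deviation t N U F u0 S = (SUP j. ennreal (exp (t * deviation N (U j) F u0 S)))"

lemma sup_exp_deviation_measurable:
  assumes "\<And>j. finite (U j)" "\<And>j u. u \<in> U j \<Longrightarrow> F u \<in> Rn d \<rightarrow>\<^sub>M Rn q" "u0 \<in> Rn d \<rightarrow>\<^sub>M Rn q"
  shows "sup_exp_deviation t N U F u0 \<in> borel_measurable (sample_space N)"
proof -
  have [measurable]: "deviation N (U j) F u0 \<in> borel_measurable (sample_space N)" for j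
    using assms by (intro deviation_measurable) auto
  show ?thesis unfolding sup_exp_deviation_def[abs_def] by measurable
qed

lemma nn_integral_sup_exp_deviation:
  assumes U: "\<And>j. finite (U j)" "\<And>j. U j \<noteq> {}" "incseq U"
    and F: "\<And>j u. u \<in> U j \<Longrightarrow> F u \<in> Rn d \<rightarrow>\<^sub>M Rn q" and u0: "u0 \<in> Rn d \<rightarrow>\<^sub>M Rn q"
    and "1 \<le> N" "0 \<le> t"
    and \<mu>: "\<And>j. (\<integral>S. rad N F (U j) S \<partial>sample_space N) / N \<le> \<mu>"
  shows "(\<integral>\<^sup>+S. sup_exp_deviation t N U F u0 S \<partial>sample_space N) \<le> ennreal (exp (t * \<mu> + 2 * t\<^sup>2 * B\<^sup>2 / N))"
proof -
  have meas: "deviation N (U j) F u0 \<in> borel_measurable (sample_space N)" for j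
    using U F u0 by (intro deviation_measurable) auto
  have "deviation N (U i) F u0 S \<le> deviation N (U j) F u0 S" if "i \<le> j" for i j S
    unfolding deviation_def using U incseqD[OF U(3) that] by (intro add_right_mono Max_mono) auto
  then have "incseq (\<lambda>j S. ennreal (exp (t * deviation N (U j) F u0 S)))"
    using \<open>0 \<le> t\<close> by (intro monoI le_funI ennreal_leI) (simp add: mult_left_mono)
  then have "(\<integral>\<^sup>+S. sup_exp_deviation t N U F u0 S \<partial>sample_space N)
      = (SUP j. \<integral>\<^sup>+S. ennreal (exp (t * deviation N (U j) F u0 S)) \<partial>sample_space N)"
    unfolding sup_exp_deviation_def using meas by (intro nn_integral_monotone_convergence_SUP) measurable
  also have "\<dots> \<le> ennreal (exp (t * \<mu> + 2 * t\<^sup>2 * B\<^sup>2 / N))"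
    using U F u0 \<open>1 \<le> N\<close> \<open>0 \<le> t\<close> \<mu> by (intro SUP_least exp_deviation_le) auto
  finally show ?thesis .
qed

text \<open>A finite stage reaches \<open>x\<close> only up to \<open>\<eta>\<close>; continuity of
  the exponential removes this loss.\<close>

lemma exp_le_sup_exp_deviation:
  assumes "0 \<le> t" and le: "\<And>\<eta>. 0 < \<eta> \<Longrightarrow> \<exists>j. x \<le> deviation N (U j) F u0 S + \<eta>"
  shows "ennreal (exp (t * x)) \<le> sup_exp_deviation t N U F u0 S"
proof (rule ennreal_le_epsilon)
  fix e :: real assume "0 < e"
  have "((\<lambda>\<eta>. exp (t * (x - \<eta>))) \<longlongrightarrow> exp (t * (x - 0))) (at_right 0)" by (intro tendsto_intros)
  moreover have "exp (t * x) - e < exp (t * (x - 0))" using \<open>0 < e\<close> by simp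
  ultimately have "eventually (\<lambda>\<eta>. exp (t * x) - e < exp (t * (x - \<eta>))) (at_right 0)" by (rule order_tendstoD(1))
  then obtain b where "0 < b" "\<And>\<eta>. 0 < \<eta> \<Longrightarrow> \<eta> < b \<Longrightarrow> exp (t * x) - e < exp (t * (x - \<eta>))"
    by (auto simp: eventually_at_right_field)
  then obtain \<eta> where \<eta>: "0 < \<eta>" "exp (t * x) - e < exp (t * (x - \<eta>))" using dense[of 0 b] by blast
  obtain j where "x \<le> deviation N (U j) F u0 S + \<eta>" using le[OF \<eta>(1)] by blast
  then have "exp (t * (x - \<eta>)) \<le> exp (t * deviation N (U j) F u0 S)" using \<open>0 \<le> t\<close> by (simp add: mult_left_mono)
  with \<eta> have "exp (t * x) \<le> exp (t * deviation N (U j) F u0 S) + e" by linarith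
  then have "ennreal (exp (t * x)) \<le> ennreal (exp (t * deviation N (U j) F u0 S)) + ennreal e"
    using \<open>0 < e\<close> by (simp add: ennreal_plus[symmetric] del: ennreal_plus)
  also have "\<dots> \<le> sup_exp_deviation t N U F u0 S + ennreal e"
    unfolding sup_exp_deviation_def by (intro add_right_mono SUP_upper) auto
  finally show "ennreal (exp (t * x)) \<le> sup_exp_deviation t N U F u0 S + ennreal e" .
qed

lemma tendsto_ex_loss:
  assumes s: "\<And>k. s k \<in> Rn d \<rightarrow>\<^sub>M Rn q" and u: "u \<in> Rn d \<rightarrow>\<^sub>M Rn q" and "z \<in> space P"
    and lim: "\<And>x j. x \<in> X \<Longrightarrow> j < q \<Longrightarrow> (\<lambda>k. s k x j) \<longlonglongrightarrow> u x j"
  shows "(\<lambda>k. ex_loss (s k) z) \<longlonglongrightarrow> ex_loss u z"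
proof -
  have "(\<lambda>k. L * euclid_dist q (s k (fst z)) (u (fst z))) \<longlonglongrightarrow> L * sqrt (\<Sum>j<q. (u (fst z) j - u (fst z) j)\<^sup>2)"
    unfolding euclid_dist_def L2_set_def
    by (intro tendsto_intros lim) (use in_Rn[OF u \<open>z \<in> space P\<close>] in auto)
  then have "(\<lambda>k. L * euclid_dist q (s k (fst z)) (u (fst z))) \<longlonglongrightarrow> 0" by simp
  then have "(\<lambda>k. ex_loss (s k) z - ex_loss u z) \<longlonglongrightarrow> 0"
    by (rule Lim_null_comparison[rotated]) (use ex_loss_diff_le[OF s u \<open>z \<in> space P\<close>] in auto)
  then show ?thesis by (rule LIM_zero_cancel)
qed

text \<open>A Lipschitz loss passes pointwise convergence on \<open>X\<close> to the empirical risk,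
  and dominated convergence passes it to the risk. As the sample is fixed here, the approximated
  predictor may itself depend on the sample, as the empirical minimizers do.\<close>

lemma risk_approximation:
  assumes s: "\<And>k. s k \<in> Rn d \<rightarrow>\<^sub>M Rn q" and u: "u \<in> Rn d \<rightarrow>\<^sub>M Rn q" and S: "S \<in> space (sample_space N)"
    and lim: "\<And>x j. x \<in> X \<Longrightarrow> j < q \<Longrightarrow> (\<lambda>k. s k x j) \<longlonglongrightarrow> u x j" and "0 < \<eta>"
  shows "\<exists>k. risk P l u - emp_risk N l S u \<le> risk P l (s k) - emp_risk N l S (s k) + \<eta>"
proof -
  have "(\<lambda>k. risk P l (s k)) \<longlonglongrightarrow> risk P l u" unfolding risk_eq
  proof (rule integral_dominated_convergence[where w = "\<lambda>_. B"])
    show "ex_loss u \<in> borel_measurable P" "\<And>k. ex_loss (s k) \<in> borel_measurable P"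
      using ex_loss_measurable s u by auto
    show "AE z in P. (\<lambda>k. ex_loss (s k) z) \<longlonglongrightarrow> ex_loss u z"
      using tendsto_ex_loss[OF s u _ lim] by (intro AE_I2) auto
    show "\<And>k. AE z in P. norm (ex_loss (s k) z) \<le> B" using abs_ex_loss_le[OF s] by (intro AE_I2) auto
  qed simp
  moreover have "(\<lambda>k. emp_risk N l S (s k)) \<longlonglongrightarrow> emp_risk N l S u" unfolding emp_risk_eq divide_inverse
    by (intro tendsto_intros tendsto_ex_loss[OF s u _ lim] sample_component[OF S]) auto
  ultimately have "(\<lambda>k. risk P l (s k) - emp_risk N l S (s k)) \<longlonglongrightarrow> risk P l u - emp_risk N l S u" by (rule tendsto_diff)
  then have "eventually (\<lambda>k. risk P l u - emp_risk N l S u - \<eta> < risk P l (s k) - emp_risk N l S (s k)) sequentially"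
    using \<open>0 < \<eta>\<close> by (intro order_tendstoD(1)) auto
  then obtain k where "risk P l u - emp_risk N l S u - \<eta> < risk P l (s k) - emp_risk N l S (s k)"
    by (auto simp: eventually_sequentially)
  then show ?thesis by (intro exI[of _ k]) linarith
qed

end

section \<open>Gaussian complexities\<close>

text \<open>No measurability of \<open>X\<close> is needed, because the nonnegative integral is a lower integral.\<close>

lemma eexpectation_ge:
  assumes f: "integrable M f" and le: "\<And>x. x \<in> space M \<Longrightarrow> ereal (f x) \<le> X x"
  shows "ereal (\<integral>x. f x \<partial>M) \<le> eexpectation M X"
proof -
  define a where "a = (\<integral>\<^sup>+x. ennreal (f x) \<partial>M)"
  define b where "b = (\<integral>\<^sup>+x. ennreal (- f x) \<partial>M)"
  have fin: "a \<noteq> \<infinity>" "b \<noteq> \<infinity>"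
    using real_integrable_def[of M f] f by (auto simp: a_def b_def)
  have "ereal (\<integral>x. f x \<partial>M) = ereal (enn2real a) - ereal (enn2real b)"
    using real_lebesgue_integral_def[OF f] by (simp add: a_def b_def)
  also have "\<dots> = enn2ereal a - enn2ereal b"
    using fin by (cases a; cases b) auto
  also have "\<dots> \<le> enn2ereal (\<integral>\<^sup>+x. e2ennreal (X x) \<partial>M) - enn2ereal (\<integral>\<^sup>+x. e2ennreal (- X x) \<partial>M)"
  proof (rule ereal_minus_mono)
    have "a \<le> (\<integral>\<^sup>+x. e2ennreal (X x) \<partial>M)" unfolding a_def
      using le by (intro nn_integral_mono) (metis e2ennreal_mono e2ennreal_ereal)
    then show "enn2ereal a \<le> enn2ereal (\<integral>\<^sup>+x. e2ennreal (X x) \<partial>M)" by (simp add: less_eq_ennreal.rep_eq)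
    have "(\<integral>\<^sup>+x. e2ennreal (- X x) \<partial>M) \<le> b" unfolding b_def
      using le by (intro nn_integral_mono) (metis e2ennreal_mono e2ennreal_ereal ereal_minus_le_minus uminus_ereal.simps(1))
    then show "enn2ereal (\<integral>\<^sup>+x. e2ennreal (- X x) \<partial>M) \<le> enn2ereal b" by (simp add: less_eq_ennreal.rep_eq)
  qed
  finally show ?thesis by (simp add: eexpectation_def)
qed

lemma eexpectation_nonneg_eq:
  assumes "\<And>x. x \<in> space M \<Longrightarrow> 0 \<le> X x"
  shows "eexpectation M X = enn2ereal (\<integral>\<^sup>+x. e2ennreal (X x) \<partial>M)"
proof -
  have "(\<integral>\<^sup>+x. e2ennreal (- X x) \<partial>M) = (\<integral>\<^sup>+x. 0 \<partial>M)"
    using assms by (intro nn_integral_cong e2ennreal_neg) (simp add: ereal_uminus_le_0_iff)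
  then show ?thesis by (simp add: eexpectation_def zero_ennreal.rep_eq)
qed

text \<open>The index is the pair (output coordinate, sample point), the order in which
  \<open>emp_gaussian_complexity\<close> indexes its Gaussian variables.\<close>

definition flatten :: "(nat \<Rightarrow> vec) \<Rightarrow> nat \<times> nat \<Rightarrow> real" where
  "flatten v p = v (snd p) (fst p)"

lemma L2_set_flatten: "L2_set (flatten v) ({..<q} \<times> {..<N}) = L2_set (\<lambda>i. euclid_norm q (v i)) {..<N}"
proof -
  have "(\<Sum>p\<in>{..<q} \<times> {..<N}. (flatten v p)\<^sup>2) = (\<Sum>i<N. \<Sum>j<q. (v i j)\<^sup>2)"
    unfolding sum.swap[of _ "{..<q}"] by (subst sum.cartesian_product) (simp add: flatten_def case_prod_beta')
  then show ?thesis by (simp add: L2_set_def euclid_norm_def sum_nonneg)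
qed

lemma l2_dist_flatten:
  "l2_dist ({..<q} \<times> {..<N}) (flatten v) (flatten w) = L2_set (\<lambda>i. euclid_dist q (v i) (w i)) {..<N}"
proof -
  have "l2_dist ({..<q} \<times> {..<N}) (flatten v) (flatten w) = L2_set (flatten (\<lambda>i j. v i j - w i j)) ({..<q} \<times> {..<N})"
    by (simp add: l2_dist_def flatten_def[abs_def])
  then show ?thesis unfolding L2_set_flatten by (simp add: euclid_norm_def euclid_dist_def)
qed

lemma l2_dist_flatten_single: "l2_dist ({..<q} \<times> {i}) (flatten v) (flatten w) = euclid_dist q (v i) (w i)"
proof -
  have "{..<q} \<times> {i} = (\<lambda>j. (j, i)) ` {..<q}" by auto
  then show ?thesis
    by (simp add: l2_dist_def euclid_dist_def L2_set_def sum.reindex inj_on_def flatten_def)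
qed

abbreviation width :: "nat \<Rightarrow> nat \<Rightarrow> 'u set \<Rightarrow> ('u \<Rightarrow> nat \<Rightarrow> vec) \<Rightarrow> real" where
  "width q N U v \<equiv> gaussian_width ({..<q} \<times> {..<N}) U (\<lambda>u. flatten (v u))"

text \<open>For each \<open>g\<close> the maximum over a finite subclass is an integrable minorant
  of the supremum over \<open>\<Q>\<close>, to which \<open>eexpectation_ge\<close> applies.\<close>

lemma width_le_emp_gaussian_complexity:
  assumes U: "finite U" "U \<noteq> {}" and F: "\<And>u. u \<in> U \<Longrightarrow> F u \<in> \<Q>"
  shows "ereal (width q N U (\<lambda>u i. F u (x i)) / N) \<le> emp_gaussian_complexity N q \<Q> x"
proof -
  let ?I = "{..<q} \<times> {..<N}"
  have "ereal (width q N U (\<lambda>u i. F u (x i)) / N)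
      = ereal (\<integral>g. (MAX u\<in>U. dotp ?I g (flatten (\<lambda>i. F u (x i)))) / N \<partial>gaussian ?I)"
    by (simp add: gaussian_width_def)
  also have "\<dots> \<le> emp_gaussian_complexity N q \<Q> x"
    unfolding emp_gaussian_complexity_def
  proof (rule eexpectation_ge)
    show "integrable (gaussian ?I) (\<lambda>g. (MAX u\<in>U. dotp ?I g (flatten (\<lambda>i. F u (x i)))) / N)"
      by (intro integrable_divide integrable_Max_dotp U)
    fix g
    obtain u where u: "u \<in> U" "(MAX u\<in>U. dotp ?I g (flatten (\<lambda>i. F u (x i)))) = dotp ?I g (flatten (\<lambda>i. F u (x i)))"
      by (rule Max_image_obtain[OF U])
    have "dotp ?I g (flatten (\<lambda>i. F u (x i))) = (\<Sum>j<q. \<Sum>i<N. g (j, i) * F u (x i) j)"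
      by (simp add: dotp_def flatten_def sum.cartesian_product case_prod_beta')
    then have "ereal ((MAX u\<in>U. dotp ?I g (flatten (\<lambda>i. F u (x i)))) / N) = ereal (1 / N * (\<Sum>j<q. \<Sum>i<N. g (j, i) * F u (x i) j))"
      using u by simp
    also have "\<dots> \<le> (SUP f\<in>\<Q>. ereal (1 / N * (\<Sum>j<q. \<Sum>i<N. g (j, i) * f (x i) j)))"
      by (rule SUP_upper[OF F[OF u(1)]])
    finally show "ereal ((MAX u\<in>U. dotp ?I g (flatten (\<lambda>i. F u (x i)))) / N)
      \<le> (SUP f\<in>\<Q>. ereal (1 / N * (\<Sum>j<q. \<Sum>i<N. g (j, i) * f (x i) j)))" .
  qed
  finally show ?thesis .
qed

lemma emp_gaussian_complexity_nonneg:
  assumes "\<Q> \<noteq> {}" shows "0 \<le> emp_gaussian_complexity N q \<Q> x"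
proof -
  obtain f where "f \<in> \<Q>" using assms by auto
  have "0 \<le> ereal (width q N {f} (\<lambda>f i. f (x i)) / N)"
    using gaussian_width_nonneg[of "{..<q} \<times> {..<N}" "{f}"] by simp
  also have "\<dots> \<le> emp_gaussian_complexity N q \<Q> x"
    using \<open>f \<in> \<Q>\<close> by (intro width_le_emp_gaussian_complexity) auto
  finally show ?thesis .
qed

lemma emp_gaussian_complexity_le_worst:
  assumes "h \<in> H" "\<And>i. i < N \<Longrightarrow> x i \<in> X"
  shows "emp_gaussian_complexity N q F (\<lambda>i. h (x i)) \<le> worst_gaussian_complexity N q F H X"
proof -
  \<comment> \<open>\<open>worst_gaussian_complexity\<close> ranges over extensional tuples, hence
    the restriction of \<open>x\<close>, which changes no value below \<open>N\<close>.\<close>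
  have "emp_gaussian_complexity N q F (\<lambda>i. h (x i)) = emp_gaussian_complexity N q F (\<lambda>i. h (restrict x {..<N} i))"
    unfolding emp_gaussian_complexity_def by simp
  also have "\<dots> \<le> worst_gaussian_complexity N q F H X"
    unfolding worst_gaussian_complexity_def using assms by (intro SUP_upper2[of h] SUP_upper) auto
  finally show ?thesis .
qed

lemma gaussian_complexity_eq_nn_integral:
  assumes "\<Q> \<noteq> {}"
  shows "gaussian_complexity N q \<Q> D = enn2ereal (\<integral>\<^sup>+x. e2ennreal (emp_gaussian_complexity N q \<Q> x) \<partial>PiM {..<N} (\<lambda>_. D))"
  unfolding gaussian_complexity_def
  using emp_gaussian_complexity_nonneg[OF assms] by (intro eexpectation_nonneg_eq)

text \<open>Joint measurability in the sample and the Gaussian vector survives integrating out the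
  latter.\<close>

lemma measurable_width:
  assumes U: "finite U" and F: "\<And>u. u \<in> U \<Longrightarrow> F u \<in> D \<rightarrow>\<^sub>M Rn q"
  shows "(\<lambda>x. width q N U (\<lambda>u i. F u (x i))) \<in> borel_measurable (PiM {..<N} (\<lambda>_. D))"
proof -
  let ?I = "{..<q} \<times> {..<N}" and ?D = "PiM {..<N} (\<lambda>_. D)"
  interpret G: prob_space "gaussian ?I" by simp
  have "(\<lambda>(x, g). MAX u\<in>U. dotp ?I g (flatten (\<lambda>i. F u (x i)))) \<in> borel_measurable (?D \<Otimes>\<^sub>M gaussian ?I)"
    unfolding dotp_def case_prod_beta'
  proof (intro borel_measurable_Max U borel_measurable_sum borel_measurable_times)
    fix u p assume u: "u \<in> U" and p: "p \<in> ?I"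
    show "(\<lambda>y. snd y p) \<in> borel_measurable (?D \<Otimes>\<^sub>M gaussian ?I)"
      by (rule measurable_compose[OF measurable_snd measurable_gaussian_component[OF p]])
    have "(\<lambda>x. x (snd p)) \<in> ?D \<rightarrow>\<^sub>M D" using p by (intro measurable_component_singleton) auto
    moreover have "(\<lambda>v. v (fst p)) \<in> borel_measurable (Rn q)"
      unfolding Rn_def using p by (intro measurable_component_singleton) auto
    ultimately have "(\<lambda>x. F u (x (snd p)) (fst p)) \<in> borel_measurable ?D"
      using measurable_compose[OF measurable_compose[OF _ F[OF u]]] by blast
    then show "(\<lambda>y. flatten (\<lambda>i. F u (fst y i)) p) \<in> borel_measurable (?D \<Otimes>\<^sub>M gaussian ?I)"
      unfolding flatten_def by (rule measurable_compose[OF measurable_fst])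
  qed
  then show ?thesis unfolding gaussian_width_def by (rule G.borel_measurable_lebesgue_integral)
qed

text \<open>With logarithms to base 2, \<open>k\<close> is at most \<open>2 log n + 1\<close>, hence
  at most \<open>3 log n\<close> for \<open>2 \<le> n\<close>, and \<open>3 / ln 2\<close> is at
  most 5. The case \<open>n = 1\<close> is separate, because \<open>ln 1 = 0\<close> leaves room for
  no scale at all.\<close>

lemma levels_exist:
  assumes "1 \<le> n"
  obtains k :: nat where "real k \<le> 5 * ln (real n)" "(real n)\<^sup>2 \<le> 2 ^ k"
proof (cases "n = 1")
  case True
  with that[of 0] show ?thesis by simp
next
  case False
  then have "2 \<le> n" using assms by simp
  have ln2: "(3 :: real) / 5 \<le> ln 2" using ln2_ge_two_thirds by linarith
  have "0 < ln (2 :: real)" by simp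
  define k where "k = nat \<lceil>2 * log 2 n\<rceil>"
  have "0 \<le> log 2 n" using \<open>2 \<le> n\<close> by simp
  then have k: "2 * log 2 n \<le> real k" "real k \<le> 2 * log 2 n + 1" unfolding k_def by linarith+
  have "1 \<le> log 2 n" using \<open>2 \<le> n\<close> by (subst le_log_iff) auto
  then have "real k \<le> 3 * log 2 n" using k by simp
  also have "\<dots> \<le> 5 * ln n"
  proof -
    have "3 * ln (real n) \<le> 5 * ln n * ln 2"
      using mult_left_mono[OF ln2, of "5 * ln n"] \<open>2 \<le> n\<close> by simp
    then show ?thesis by (simp add: log_def divide_le_eq)
  qed
  finally have "real k \<le> 5 * ln n" .
  moreover have "(real n)\<^sup>2 = 2 powr (2 * log 2 n)"
    using \<open>2 \<le> n\<close> by (simp add: powr_mult_base[symmetric] mult.commute[of 2] powr_powr[symmetric])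
  moreover have "\<dots> \<le> 2 powr real k" using k by (intro powr_mono) auto
  ultimately show ?thesis using that[of k] by (simp add: powr_realpow)
qed

section \<open>From sign averages to Gaussian complexities\<close>

context bounded_task
begin

lemma rademacher_le_width:
  assumes U: "finite U" "U \<noteq> {}" and F: "\<And>u. u \<in> U \<Longrightarrow> F u \<in> Rn d \<rightarrow>\<^sub>M Rn q" and S: "S \<in> space (sample_space N)"
  shows "rad N F U S \<le> 3 * L * width q N U (\<lambda>u i. F u (fst (S i)))"
proof -
  have "rad N F U S \<le> sqrt (2 * pi) * L * width q N U (\<lambda>u i. F u (fst (S i)))"
  proof (rule rademacher_avg_le_gaussian_width[OF U _ L_nonneg])
    fix i u w assume "i < N" "u \<in> U" "w \<in> U"
    then show "ex_loss (F u) (S i) - ex_loss (F w) (S i)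
        \<le> L * l2_dist ({..<q} \<times> {i}) (flatten (\<lambda>i. F u (fst (S i)))) (flatten (\<lambda>i. F w (fst (S i))))"
      unfolding l2_dist_flatten_single
      using ex_loss_diff_le[OF F F sample_component[OF S], of u w i] by simp
  qed simp
  also have "\<dots> \<le> 3 * L * width q N U (\<lambda>u i. F u (fst (S i)))"
  proof (intro mult_right_mono L_nonneg gaussian_width_nonneg U)
    \<comment> \<open>The crude bound \<open>pi < 4\<close> suffices, as 8 is below 9.\<close>
    have "2 * pi \<le> 3\<^sup>2" using pi_less_4 by simp
    then show "sqrt (2 * pi) \<le> 3" by (intro real_le_lsqrt) auto
  qed simp
  finally show ?thesis .
qed

lemma rademacher_integrable:
  assumes U: "finite U" "U \<noteq> {}" and F: "\<And>u. u \<in> U \<Longrightarrow> F u \<in> Rn d \<rightarrow>\<^sub>M Rn q"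
  shows "integrable (sample_space N) (\<lambda>S. rad N F U S)"
proof (rule prob_space.integrable_bounded[OF prob_space_PiM_same])
  show "(\<lambda>S. rad N F U S) \<in> borel_measurable (sample_space N)"
    using F by (intro measurable_rademacher_avg U measurable_compose[OF _ ex_loss_measurable] measurable_component_singleton) auto
  fix S assume S: "S \<in> space (sample_space N)"
  show "\<bar>rad N F U S\<bar> \<le> 0 + 2 * real N * B"
    by (intro abs_rademacher_avg_le U abs_ex_loss_le F sample_component[OF S]) auto
qed

text \<open>The bound holds for every sample and is uniform over the representations in
  \<open>\<H>\<close>. It can therefore be applied to \<open>h_hat S\<close> while only the
  downstream sample is random.\<close>

lemma rademacher_le_worst_complexity:
  assumes U: "finite U" "U \<noteq> {}" "U \<subseteq> \<F>" and \<F>: "\<F> \<subseteq> Rn r \<rightarrow>\<^sub>M Rn q" and h: "h \<in> \<H>" "h \<in> Rn d \<rightarrow>\<^sub>M Rn r"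
    and \<mu>: "ereal (3 * L) * worst_gaussian_complexity N q \<F> \<H> X \<le> ereal \<mu>"
  shows "(\<integral>S. rad N (\<lambda>f. f \<circ> h) U S \<partial>sample_space N) / N \<le> \<mu>"
proof -
  interpret S: prob_space "sample_space N" by (rule prob_space_PiM_same)
  have F: "f \<circ> h \<in> Rn d \<rightarrow>\<^sub>M Rn q" if "f \<in> U" for f using that U(3) \<F> h(2) by (auto intro!: measurable_comp)
  note int = rademacher_integrable[where F = "\<lambda>f. f \<circ> h" and N = N, OF U(1,2) F]
  have "rad N (\<lambda>f. f \<circ> h) U S / N \<le> \<mu>" if S: "S \<in> space (sample_space N)" for S
  proof -
    let ?w = "width q N U (\<lambda>f i. (f \<circ> h) (fst (S i)))"
    have "rad N (\<lambda>f. f \<circ> h) U S / N \<le> 3 * L * ?w / N"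
      using rademacher_le_width[OF U(1,2) F S] by (intro divide_right_mono) auto
    moreover have "ereal (3 * L * ?w / N) \<le> ereal \<mu>"
    proof -
      have "fst (S i) \<in> X" if "i < N" for i using sample_component[OF S that] by (auto simp: space_P)
      then have "ereal (?w / N) \<le> worst_gaussian_complexity N q \<F> \<H> X"
        using U(3) emp_gaussian_complexity_le_worst[OF h(1), of N "\<lambda>i. fst (S i)" X q \<F>] unfolding comp_def
        by (intro order.trans[OF width_le_emp_gaussian_complexity[OF U(1,2)]]) auto
      then have "ereal (3 * L) * ereal (?w / N) \<le> ereal (3 * L) * worst_gaussian_complexity N q \<F> \<H> X"
        using L_nonneg by (intro ereal_mult_left_mono) auto
      from order.trans[OF this \<mu>] show ?thesis by simp
    qed
    ultimately show ?thesis by simp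
  qed
  then have "(\<integral>S. rad N (\<lambda>f. f \<circ> h) U S / N \<partial>sample_space N) \<le> (\<integral>S. \<mu> \<partial>sample_space N)"
    using int by (intro integral_mono) auto
  then show ?thesis by (simp add: S.prob_space)
qed

end

text \<open>Functions with a common Lipschitz constant are determined by their values at rational
  points. These values map the class into \<open>nat \<times> nat \<Rightarrow> real\<close>, whose
  subsets are separable, and the common constant carries convergence from rational points to all
  points.\<close>

lemma pointwise_separable_lipschitz:
  assumes lip: "\<And>f. f \<in> F \<Longrightarrow> lipschitz_map r q L f"
  shows "pointwise_separable q (space (Rn r)) F"
proof -
  define D where "D = (\<Pi>\<^sub>E i\<in>{..<r}. (\<rat> :: real set))"
  have D: "countable D" unfolding D_def by (intro countable_PiE) (auto simp: countable_rat)
  have D_ne: "D \<noteq> {}" by (auto simp: D_def PiE_eq_empty_iff intro: Rats_0)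
  define \<rho> where "\<rho> f p = f (from_nat_into D (fst p)) (snd p)" for f :: "vec \<Rightarrow> vec" and p :: "nat \<times> nat"
  obtain T where T: "countable T" "T \<subseteq> \<rho> ` F" "\<rho> ` F \<subseteq> closure T"
    using separable[of "\<rho> ` F"] by metis
  define F0 where "F0 = inv_into F \<rho> ` T"
  have F0: "F0 \<subseteq> F" "countable F0" using T by (auto simp: F0_def intro: inv_into_into)
  have "\<exists>s. range s \<subseteq> F0 \<and> (\<forall>x\<in>space (Rn r). \<forall>j<q. (\<lambda>t. s t x j) \<longlonglongrightarrow> f x j)" if f: "f \<in> F" for f
  proof -
    have "\<rho> f \<in> closure T" using f T by auto
    then obtain \<sigma> where \<sigma>: "\<And>t. \<sigma> t \<in> T" "\<sigma> \<longlonglongrightarrow> \<rho> f" unfolding closure_sequential by auto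
    define s where "s t = inv_into F \<rho> (\<sigma> t)" for t
    have s: "s t \<in> F" "\<rho> (s t) = \<sigma> t" for t
    proof -
      have *: "\<sigma> t \<in> \<rho> ` F" using \<sigma>(1) T(2) by (rule subsetD[rotated])
      show "s t \<in> F" unfolding s_def by (rule inv_into_into[OF *])
      show "\<rho> (s t) = \<sigma> t" unfolding s_def by (rule f_inv_into_f[OF *])
    qed
    have on_D: "(\<lambda>t. s t y j) \<longlonglongrightarrow> f y j" if yD: "y \<in> D" for y j
    proof -
      obtain m where m: "from_nat_into D m = y" using from_nat_into_surj[OF D yD] by blast
      have "continuous_on UNIV (\<lambda>g :: nat \<times> nat \<Rightarrow> real. g (m, j))"
        by (rule continuous_on_product_coordinates)
      then have "isCont (\<lambda>g :: nat \<times> nat \<Rightarrow> real. g (m, j)) (\<rho> f)"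
        unfolding continuous_on_eq_continuous_at[OF open_UNIV] by blast
      from isCont_tendsto_compose[OF this \<sigma>(2)] have "(\<lambda>t. \<sigma> t (m, j)) \<longlonglongrightarrow> \<rho> f (m, j)" .
      then show ?thesis by (simp add: s(2)[symmetric] \<rho>_def m)
    qed
    have "(\<lambda>t. s t x j) \<longlonglongrightarrow> f x j" if x: "x \<in> space (Rn r)" and "j < q" for x j
    proof (rule LIMSEQ_I)
      fix e :: real assume "0 < e"
      have "0 \<le> L" using lip[OF f] by (simp add: lipschitz_map_def)
      \<comment> \<open>The added ones keep \<open>c\<close> positive when \<open>L\<close> or
        \<open>r\<close> vanishes. Three errors of at most \<open>e / 4\<close> then arise: moving
        from \<open>x\<close> to the rational point \<open>y\<close> under \<open>s t\<close> and
        under \<open>f\<close>, and comparing \<open>s t\<close> with \<open>f\<close> at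
        \<open>y\<close>.\<close>
      define c where "c = (L + 1) * (real r + 1)"
      define \<epsilon> where "\<epsilon> = e / 4 / c"
      have "0 < c" using \<open>0 \<le> L\<close> by (simp add: c_def)
      then have "0 < \<epsilon>" using \<open>0 < e\<close> by (simp add: \<epsilon>_def)
      have "\<forall>i. \<exists>a\<in>\<rat>. \<bar>x i - a\<bar> \<le> \<epsilon>"
      proof
        fix i
        obtain a where "a \<in> \<rat>" "x i - \<epsilon> < a" "a < x i + \<epsilon>" using Rats_dense_in_real[of "x i - \<epsilon>" "x i + \<epsilon>"] \<open>0 < \<epsilon>\<close> by auto
        then show "\<exists>a\<in>\<rat>. \<bar>x i - a\<bar> \<le> \<epsilon>" by (intro bexI[of _ a]) auto
      qed
      then obtain a where a: "\<And>i. a i \<in> \<rat>" "\<And>i. \<bar>x i - a i\<bar> \<le> \<epsilon>" by metis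
      define y where "y = restrict a {..<r}"
      have y: "y \<in> D" "y \<in> space (Rn r)" using a by (auto simp: y_def D_def)
      have "euclid_dist r x y \<le> (\<Sum>i<r. \<bar>x i - y i\<bar>)"
        unfolding euclid_dist_def by (rule L2_set_le_sum_abs)
      also have "\<dots> \<le> of_nat (card {..<r}) * \<epsilon>" using a by (intro sum_bounded_above) (auto simp: y_def)
      finally have dist_y: "euclid_dist r x y \<le> real r * \<epsilon>" by simp
      have near: "\<bar>g x j - g y j\<bar> \<le> e / 4" if "g \<in> F" for g
      proof -
        have "\<bar>g x j - g y j\<bar> \<le> euclid_dist q (g x) (g y)"
          unfolding euclid_dist_def
          using member_le_L2_set[of "{..<q}" j "\<lambda>i. \<bar>g x i - g y i\<bar>"] \<open>j < q\<close> by (simp add: L2_set_def)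
        also have "\<dots> \<le> L * euclid_dist r x y" using lip[OF that] x y by (simp add: lipschitz_map_def)
        also have "\<dots> \<le> (L + 1) * ((real r + 1) * \<epsilon>)"
          using dist_y \<open>0 \<le> L\<close> \<open>0 < \<epsilon>\<close> by (intro mult_mono) (auto simp: euclid_dist_def algebra_simps)
        also have "\<dots> = c * \<epsilon>" by (simp add: c_def mult.assoc)
        also have "\<dots> = e / 4" using \<open>0 < c\<close> by (simp add: \<epsilon>_def)
        finally show ?thesis .
      qed
      obtain t0 where t0: "\<And>t. t0 \<le> t \<Longrightarrow> \<bar>s t y j - f y j\<bar> < e / 4"
        using LIMSEQ_D[OF on_D[OF y(1)], of "e / 4" j] \<open>0 < e\<close> by auto
      have "norm (s t x j - f x j) < e" if "t0 \<le> t" for t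
        using near[OF s(1)[of t]] near[OF f] t0[OF that] \<open>0 < e\<close> unfolding real_norm_def abs_real_def
        by (auto split: if_splits)
      then show "\<exists>t0. \<forall>t\<ge>t0. norm (s t x j - f x j) < e" by blast
    qed
    moreover have "range s \<subseteq> F0" using \<sigma>(1) by (auto simp: s_def F0_def)
    ultimately show ?thesis by blast
  qed
  with F0 show ?thesis unfolding pointwise_separable_def by blast
qed

text \<open>Listed as a sequence, possibly with repetitions, the dense subclass is exhausted by
  finite initial parts.\<close>

lemma pointwise_separable_enumeration:
  assumes "pointwise_separable q X \<Q>" "\<Q> \<noteq> {}"
  obtains E :: "nat \<Rightarrow> vec \<Rightarrow> vec" where "range E \<subseteq> \<Q>"
    "\<forall>f\<in>\<Q>. \<exists>\<sigma>. \<forall>x\<in>X. \<forall>j<q. (\<lambda>t. E (\<sigma> t) x j) \<longlonglongrightarrow> f x j"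
proof -
  obtain Q0 where Q0: "Q0 \<subseteq> \<Q>" "countable Q0"
    "\<And>f. f \<in> \<Q> \<Longrightarrow> \<exists>s. range s \<subseteq> Q0 \<and> (\<forall>x\<in>X. \<forall>j<q. (\<lambda>t. s t x j) \<longlonglongrightarrow> f x j)"
    using assms(1) unfolding pointwise_separable_def by blast
  obtain f0 where "f0 \<in> \<Q>" using assms(2) by auto
  from Q0(3)[OF this] have "Q0 \<noteq> {}" by auto
  show ?thesis
  proof (rule that[of "from_nat_into Q0"])
    show "range (from_nat_into Q0) \<subseteq> \<Q>" using from_nat_into[OF \<open>Q0 \<noteq> {}\<close>] Q0(1) by auto
    show "\<forall>f\<in>\<Q>. \<exists>\<sigma>. \<forall>x\<in>X. \<forall>j<q. (\<lambda>t. from_nat_into Q0 (\<sigma> t) x j) \<longlonglongrightarrow> f x j"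
    proof
      fix f assume "f \<in> \<Q>"
      then obtain s where s: "range s \<subseteq> Q0" "\<forall>x\<in>X. \<forall>j<q. (\<lambda>t. s t x j) \<longlonglongrightarrow> f x j" using Q0(3) by blast
      have "from_nat_into Q0 (to_nat_on Q0 (s t)) = s t" for t
        using s(1) by (intro from_nat_into_to_nat_on Q0(2)) auto
      with s(2) show "\<exists>\<sigma>. \<forall>x\<in>X. \<forall>j<q. (\<lambda>t. from_nat_into Q0 (\<sigma> t) x j) \<longlonglongrightarrow> f x j"
        by (intro exI[of _ "\<lambda>t. to_nat_on Q0 (s t)"]) simp
    qed
  qed
qed

text \<open>\<open>gaussian_complexity\<close> integrates over inputs, whereas a sample also carries
  labels. The product of the input marginals is the image of the sample law when labels are
  dropped.\<close>

lemma nn_integral_input_marginal: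
  fixes N :: nat
  assumes "prob_space P" "fst \<in> P \<rightarrow>\<^sub>M input_space d X" and \<phi>: "\<phi> \<in> borel_measurable (PiM {..<N} (\<lambda>_. input_space d X))"
  shows "(\<integral>\<^sup>+x. \<phi> x \<partial>PiM {..<N} (\<lambda>_. input_marginal d X P)) = (\<integral>\<^sup>+S. \<phi> (\<lambda>i\<in>{..<N}. fst (S i)) \<partial>PiM {..<N} (\<lambda>_. P))"
proof -
  have sets: "sets (input_marginal d X P) = sets (input_space d X)" by (simp add: input_marginal_def)
  have m: "fst \<in> P \<rightarrow>\<^sub>M input_marginal d X P" using assms(2) by (simp add: measurable_cong_sets[OF refl sets])
  have pm: "prob_space (input_marginal d X P)"
    unfolding input_marginal_def by (rule prob_space.prob_space_distr[OF assms(1,2)])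
  have \<phi>': "\<phi> \<in> borel_measurable (PiM {..<N} (\<lambda>_. input_marginal d X P))"
    using \<phi> by (simp add: measurable_cong_sets[OF sets_PiM_cong[OF refl sets] refl])
  have "distr P (input_marginal d X P) fst = input_marginal d X P"
    unfolding input_marginal_def by (intro distr_cong) auto
  then have "PiM {..<N} (\<lambda>_. input_marginal d X P)
      = distr (PiM {..<N} (\<lambda>_. P)) (PiM {..<N} (\<lambda>_. input_marginal d X P)) (compose {..<N} fst)"
    using distr_PiM_finite_prob_space'[of "{..<N}" "\<lambda>_. P" "\<lambda>_. input_marginal d X P" fst] assms(1) pm m by simp
  moreover have "compose {..<N} fst \<in> PiM {..<N} (\<lambda>_. P) \<rightarrow>\<^sub>M PiM {..<N} (\<lambda>_. input_marginal d X P)"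
    unfolding compose_def using m by (intro measurable_restrict measurable_compose[OF measurable_component_singleton]) auto
  ultimately show ?thesis
    using nn_integral_distr[of "compose {..<N} fst" "PiM {..<N} (\<lambda>_. P)" "PiM {..<N} (\<lambda>_. input_marginal d X P)" \<phi>] \<phi>'
    by (simp add: compose_def)
qed

section \<open>The composed class of the pre-training stage\<close>

context bounded_task
begin

text \<open>For a fixed sample the vectors of \<open>n\<close> predictions have norm at most
  \<open>sqrt n * D\<close> in dimension \<open>q * n\<close>, so after \<open>k\<close> scales and
  division by \<open>n\<close> the remainder is \<open>sqrt q * D / 2 ^ k\<close>. The constant
  10025 is \<open>2005 * 5\<close>.\<close>

lemma rademacher_composition_le:
  assumes F: "finite F" "F \<noteq> {}" "\<And>f. f \<in> F \<Longrightarrow> f \<in> Rn r \<rightarrow>\<^sub>M Rn q" "\<And>f. f \<in> F \<Longrightarrow> lipschitz_map r q K f"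
    and A: "finite A" "A \<noteq> {}" "\<And>a. a \<in> A \<Longrightarrow> a \<in> Rn d \<rightarrow>\<^sub>M Rn r"
    and D: "\<And>x a f. x \<in> X \<Longrightarrow> a \<in> A \<Longrightarrow> f \<in> F \<Longrightarrow> euclid_norm q (f (a x)) \<le> D" "0 \<le> D"
    and "1 \<le> n" and S: "S \<in> space (sample_space n)" and "0 \<le> K"
    and wF: "\<And>a. a \<in> A \<Longrightarrow> width q n F (\<lambda>f i. f (a (fst (S i)))) / n \<le> \<gamma>" "0 \<le> \<gamma>"
  shows "rad n (\<lambda>u. fst u \<circ> snd u) (F \<times> A) S / n
    \<le> 3 * L * (10025 * ln n * (K * (width r n A (\<lambda>a i. a (fst (S i))) / n) + \<gamma>) + sqrt q * D / (real n)\<^sup>2)"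
proof -
  define x where "x i = fst (S i)" for i
  define wA where "wA = width r n A (\<lambda>a i. a (x i))"
  have "0 < real n" using \<open>1 \<le> n\<close> by simp
  have x: "x i \<in> X" if "i < n" for i using sample_component[OF S that] by (auto simp: x_def space_P)
  have "0 \<le> wA" unfolding wA_def using A by (intro gaussian_width_nonneg) auto
  have ln: "0 \<le> ln (real n)" using \<open>1 \<le> n\<close> by simp
  obtain k :: nat where k: "real k \<le> 5 * ln n" "(real n)\<^sup>2 \<le> 2 ^ k" using levels_exist[OF \<open>1 \<le> n\<close>] .
  have "gaussian_width ({..<q} \<times> {..<n}) (F \<times> A) (\<lambda>(f, a). flatten (\<lambda>i. f (a (x i))))
    \<le> 2005 * real k * (K * wA + n * \<gamma>) + sqrt n * D / 2 ^ k * sqrt (card ({..<q} \<times> {..<n}))"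
  proof (rule gaussian_width_composition[where J = "{..<r} \<times> {..<n}" and s = "\<lambda>a. flatten (\<lambda>i. a (x i))"])
    fix f a a' assume fa: "f \<in> F" "a \<in> A" "a' \<in> A"
    have "l2_dist ({..<q} \<times> {..<n}) (flatten (\<lambda>i. f (a (x i)))) (flatten (\<lambda>i. f (a' (x i))))
        \<le> L2_set (\<lambda>i. K * euclid_dist r (a (x i)) (a' (x i))) {..<n}"
      unfolding l2_dist_flatten
    proof (rule L2_set_mono)
      fix i assume "i \<in> {..<n}"
      then have "a (x i) \<in> space (Rn r)" "a' (x i) \<in> space (Rn r)"
        using x[of i] X_subset measurable_space[OF A(3)[OF fa(2)]] measurable_space[OF A(3)[OF fa(3)]] by auto
      then show "euclid_dist q (f (a (x i))) (f (a' (x i))) \<le> K * euclid_dist r (a (x i)) (a' (x i))"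
        using F(4)[OF fa(1)] by (simp add: lipschitz_map_def)
    qed (simp add: euclid_dist_def)
    then show "l2_dist ({..<q} \<times> {..<n}) (flatten (\<lambda>i. f (a (x i)))) (flatten (\<lambda>i. f (a' (x i))))
        \<le> K * l2_dist ({..<r} \<times> {..<n}) (flatten (\<lambda>i. a (x i))) (flatten (\<lambda>i. a' (x i)))"
      unfolding l2_dist_flatten L2_set_right_distrib[OF \<open>0 \<le> K\<close>] .
  next
    fix f a assume fa: "f \<in> F" "a \<in> A"
    have "L2_set (flatten (\<lambda>i. f (a (x i)))) ({..<q} \<times> {..<n}) \<le> L2_set (\<lambda>i. D) {..<n}"
      unfolding L2_set_flatten using D(1)[OF x fa(2,1)] by (intro L2_set_mono) (auto simp: euclid_norm_def)
    then show "L2_set (flatten (\<lambda>i. f (a (x i)))) ({..<q} \<times> {..<n}) \<le> sqrt n * D"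
      using D(2) by (simp add: L2_set_constant)
  next
    fix a assume "a \<in> A"
    then show "width q n F (\<lambda>f i. f (a (x i))) \<le> n * \<gamma>"
      using wF(1)[of a] \<open>0 < real n\<close> by (simp add: x_def divide_le_eq mult.commute)
  qed (use F A \<open>0 \<le> K\<close> \<open>0 \<le> wA\<close> wF(2) D(2) in \<open>auto simp: wA_def\<close>)
  also have "sqrt n * D / 2 ^ k * sqrt (card ({..<q} \<times> {..<n})) = real n * (sqrt q * D / 2 ^ k)"
    by (simp add: card_cartesian_product real_sqrt_mult)
  finally have w: "width q n (F \<times> A) (\<lambda>u i. (fst u \<circ> snd u) (x i)) \<le> 2005 * real k * (K * wA + n * \<gamma>) + real n * (sqrt q * D / 2 ^ k)"
    by (simp add: case_prod_beta')
  have "width q n (F \<times> A) (\<lambda>u i. (fst u \<circ> snd u) (x i)) / n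
      \<le> (2005 * real k * (K * wA + n * \<gamma>) + real n * (sqrt q * D / 2 ^ k)) / n"
    using w by (intro divide_right_mono) auto
  also have "\<dots> = 2005 * real k * (K * (wA / n) + \<gamma>) + sqrt q * D / 2 ^ k"
    using \<open>0 < real n\<close> by (simp add: field_simps)
  also have "\<dots> \<le> 2005 * (5 * ln n) * (K * (wA / n) + \<gamma>) + sqrt q * D / (real n)\<^sup>2"
    using k \<open>0 \<le> K\<close> \<open>0 \<le> wA\<close> wF(2) D(2) \<open>0 < real n\<close>
    by (intro add_mono mult_right_mono divide_left_mono mult_left_mono) auto
  finally have *: "width q n (F \<times> A) (\<lambda>u i. (fst u \<circ> snd u) (x i)) / n \<le> 10025 * ln n * (K * (wA / n) + \<gamma>) + sqrt q * D / (real n)\<^sup>2"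
    by simp
  have "rad n (\<lambda>u. fst u \<circ> snd u) (F \<times> A) S
      \<le> 3 * L * width q n (F \<times> A) (\<lambda>u i. (fst u \<circ> snd u) (x i))"
    unfolding x_def using F A by (intro rademacher_le_width S) (auto intro!: measurable_comp[where N = "Rn r"])
  then have "rad n (\<lambda>u. fst u \<circ> snd u) (F \<times> A) S / n
      \<le> 3 * L * (width q n (F \<times> A) (\<lambda>u i. (fst u \<circ> snd u) (x i)) / n)"
    using divide_right_mono[of _ _ "real n"] by fastforce
  also have "\<dots> \<le> 3 * L * (10025 * ln n * (K * (wA / n) + \<gamma>) + sqrt q * D / (real n)\<^sup>2)"
    using * L_nonneg by (intro mult_left_mono) auto
  finally show ?thesis by (simp add: wA_def x_def)
qed

text \<open>Averaging over the sample turns the width of \<open>A\<close> into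
  \<open>gaussian_complexity\<close>. The hypothesis on \<open>\<mu>\<close> makes a complexity
  finite only where its coefficient is nonzero, which forces the case distinctions.\<close>

lemma rademacher_composition_complexity:
  assumes F: "finite F" "F \<noteq> {}" "F \<subseteq> \<F>" and \<F>: "\<F> \<subseteq> Rn r \<rightarrow>\<^sub>M Rn q" "\<And>f. f \<in> \<F> \<Longrightarrow> lipschitz_map r q K f"
    and A: "finite A" "A \<noteq> {}" "A \<subseteq> \<H>" and \<H>: "\<H> \<subseteq> Rn d \<rightarrow>\<^sub>M Rn r"
    and D: "\<And>x a f. x \<in> X \<Longrightarrow> a \<in> \<H> \<Longrightarrow> f \<in> \<F> \<Longrightarrow> euclid_norm q (f (a x)) \<le> D" "0 \<le> D"
    and "1 \<le> n" "0 \<le> K" and c: "sqrt q * D / (real n)\<^sup>2 \<le> c"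
    and \<mu>: "ereal L * (ereal (ln n) * (ereal K * gaussian_complexity n r \<H> (input_marginal d X P)
        + worst_gaussian_complexity n q \<F> \<H> X) + ereal c) \<le> ereal \<mu>"
  shows "(\<integral>S. rad n (\<lambda>u. fst u \<circ> snd u) (F \<times> A) S \<partial>sample_space n) / n \<le> 30075 * \<mu>"
proof -
  interpret S: prob_space "sample_space n" by (rule prob_space_PiM_same)
  define R where "R S = rad n (\<lambda>u. fst u \<circ> snd u) (F \<times> A) S" for S
  define G where "G = gaussian_complexity n r \<H> (input_marginal d X P)"
  define W where "W = worst_gaussian_complexity n q \<F> \<H> X"
  define w where "w S = width r n A (\<lambda>a i. a (fst (S i))) / n" for S :: sample
  have ln: "0 \<le> ln (real n)" using \<open>1 \<le> n\<close> by simp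
  have F': "\<And>f. f \<in> F \<Longrightarrow> f \<in> Rn r \<rightarrow>\<^sub>M Rn q" "\<And>f. f \<in> F \<Longrightarrow> lipschitz_map r q K f" using F \<F> by auto
  have A': "\<And>a. a \<in> A \<Longrightarrow> a \<in> Rn d \<rightarrow>\<^sub>M Rn r" using A \<H> by auto
  have D': "euclid_norm q (f (a x)) \<le> D" if "x \<in> X" "a \<in> A" "f \<in> F" for x a f
    using that F(3) A(3) by (intro D(1)) auto
  have R_int: "integrable (sample_space n) R"
    unfolding R_def[abs_def] using F A F' A' by (intro rademacher_integrable) (auto intro!: measurable_comp[where N = "Rn r"])
  have pointwise: "R S / n \<le> 3 * L * (10025 * ln n * (K * w S + \<gamma>) + sqrt q * D / (real n)\<^sup>2)"
    if "S \<in> space (sample_space n)" "\<And>a. a \<in> A \<Longrightarrow> width q n F (\<lambda>f i. f (a (fst (S i)))) / n \<le> \<gamma>" "0 \<le> \<gamma>" for S \<gamma>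
    unfolding R_def w_def
    by (rule rademacher_composition_le)
       ((rule F(1,2) F' A(1,2) A' D' D(2) \<open>1 \<le> n\<close> \<open>0 \<le> K\<close> that | assumption)+)
  have w_nonneg: "0 \<le> w S" for S unfolding w_def using A by (intro divide_nonneg_nonneg gaussian_width_nonneg) auto
  have "0 \<le> c" using c D(2) by (smt (verit) divide_nonneg_nonneg mult_nonneg_nonneg real_sqrt_ge_zero of_nat_0_le_iff zero_le_power2)
  have wF: "ereal (width q n F (\<lambda>f i. f (a (fst (S i)))) / n) \<le> W" if "a \<in> A" "S \<in> space (sample_space n)" for a S
  proof -
    have "fst (S i) \<in> X" if "i < n" for i using sample_component[OF \<open>S \<in> _\<close> that] by (auto simp: space_P)
    then have "emp_gaussian_complexity n q \<F> (\<lambda>i. a (fst (S i))) \<le> W"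
      unfolding W_def using \<open>a \<in> A\<close> A(3) by (intro emp_gaussian_complexity_le_worst) auto
    with F show ?thesis by (intro order.trans[OF width_le_emp_gaussian_complexity[OF F(1,2)]]) auto
  qed
  have le_const: "(\<integral>S. R S \<partial>sample_space n) / n \<le> 30075 * \<mu>"
    if le: "\<And>S. S \<in> space (sample_space n) \<Longrightarrow> R S / n \<le> C * (K * w S) + b" and int: "integrable (sample_space n) (\<lambda>S. K * w S)"
      and fin: "C * (\<integral>S. K * w S \<partial>sample_space n) + b \<le> 30075 * \<mu>" for C b
  proof -
    have "(\<integral>S. R S / n \<partial>sample_space n) \<le> (\<integral>S. C * (K * w S) + b \<partial>sample_space n)"
      using R_int le int by (intro integral_mono Bochner_Integration.integrable_add integrable_mult_right S.integrable_const) auto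
    also have "\<dots> = C * (\<integral>S. K * w S \<partial>sample_space n) + b"
      using int by (subst Bochner_Integration.integral_add) (auto simp: S.prob_space)
    finally show ?thesis using fin by simp
  qed
  consider (zero) "L * ln n = 0" | (pos) "0 < L" "0 < ln (real n)" using L_nonneg ln by (cases "L = 0"; cases "ln (real n) = 0") auto
  then show ?thesis
  proof cases
    case zero
    have "L * c \<le> \<mu>" using zero \<mu> by (auto simp: zero_ereal_def[symmetric])
    have "R S / n \<le> 0 * (0 * w S) + 3 * L * c" if S: "S \<in> space (sample_space n)" for S
    proof -
      \<comment> \<open>No bound on the width of \<open>F\<close> that is uniform in
        \<open>S\<close> is at hand in this case, but the width is multiplied by
        \<open>L * ln n = 0\<close>. Any finite bound depending on \<open>S\<close> serves, and the
        sum over \<open>A\<close> is one.\<close>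
      define \<gamma> where "\<gamma> = (\<Sum>a\<in>A. width q n F (\<lambda>f i. f (a (fst (S i)))) / n)"
      have nn: "0 \<le> width q n F (\<lambda>f i. f (a (fst (S i)))) / n" for a
        using F by (intro divide_nonneg_nonneg gaussian_width_nonneg) auto
      have "R S / n \<le> 3 * L * (10025 * ln n * (K * w S + \<gamma>) + sqrt q * D / (real n)\<^sup>2)"
        using S nn A by (intro pointwise) (auto simp: \<gamma>_def intro!: member_le_sum sum_nonneg)
      also have "\<dots> = 30075 * (L * ln n) * (K * w S + \<gamma>) + 3 * L * (sqrt q * D / (real n)\<^sup>2)" by (simp add: algebra_simps)
      also have "\<dots> = 3 * L * (sqrt q * D / (real n)\<^sup>2)" using zero by simp
      also have "\<dots> \<le> 3 * L * c" using c L_nonneg by (intro mult_left_mono) auto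
      finally show ?thesis by simp
    qed
    then have "(\<integral>S. R S / n \<partial>sample_space n) \<le> (\<integral>S. 3 * L * c \<partial>sample_space n)"
      using R_int by (intro integral_mono) auto
    also have "\<dots> \<le> 30075 * \<mu>" using \<open>L * c \<le> \<mu>\<close> mult_nonneg_nonneg[OF L_nonneg \<open>0 \<le> c\<close>] by (simp add: S.prob_space)
    finally show ?thesis by (simp add: R_def)
  next
    case pos
    have "0 \<le> W"
    proof -
      obtain a where "a \<in> A" using A by auto
      obtain S where S: "S \<in> space (sample_space n)" using S.not_empty by blast
      have "0 \<le> ereal (width q n F (\<lambda>f i. f (a (fst (S i)))) / n)"
        using F gaussian_width_nonneg[of "{..<q} \<times> {..<n}" F] by simp
      also have "\<dots> \<le> W" by (rule wF[OF \<open>a \<in> A\<close> S])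
      finally show ?thesis .
    qed
    have H_ne: "\<H> \<noteq> {}" using A by auto
    have G_eq: "G = enn2ereal (\<integral>\<^sup>+x. e2ennreal (emp_gaussian_complexity n r \<H> x) \<partial>PiM {..<n} (\<lambda>_. input_marginal d X P))"
      unfolding G_def by (rule gaussian_complexity_eq_nn_integral[OF H_ne])
    then have "0 \<le> G" by simp
    then have "0 \<le> ereal K * G" using \<open>0 \<le> K\<close> by simp
    have fin: "ereal L * (ereal (ln n) * (ereal K * G + W) + ereal c) \<le> ereal \<mu>" using \<mu> by (simp add: G_def W_def)
    have "ereal K * G \<noteq> \<infinity>" "W \<noteq> \<infinity>" using fin pos \<open>0 \<le> W\<close> \<open>0 \<le> ereal K * G\<close> by (auto simp: ereal_mult_eq_PInfty)
    then obtain v \<gamma> where v: "ereal K * G = ereal v" and \<gamma>: "W = ereal \<gamma>" "0 \<le> v" "0 \<le> \<gamma>"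
      using \<open>0 \<le> W\<close> \<open>0 \<le> ereal K * G\<close> by (cases W; cases "ereal K * G") auto
    have real_fin: "L * (ln n * (v + \<gamma>) + c) \<le> \<mu>" using fin unfolding v \<gamma>(1) by simp
    have int: "integrable (sample_space n) (\<lambda>S. K * w S)" "(\<integral>S. K * w S \<partial>sample_space n) \<le> v"
    proof -
      \<comment> \<open>Finiteness of \<open>ereal K * G\<close> makes \<open>G\<close> finite only
        for \<open>K \<noteq> 0\<close>; for \<open>K = 0\<close> the product is 0 even if
        \<open>G\<close> is infinite.\<close>
      have "integrable (sample_space n) (\<lambda>S. K * w S) \<and> (\<integral>S. K * w S \<partial>sample_space n) \<le> v" if "K \<noteq> 0"
      proof -
        have "0 < K" using that \<open>0 \<le> K\<close> by simp
        then have Gv: "G = ereal (v / K)" using v \<open>0 \<le> G\<close> by (cases G) (auto simp: field_simps)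
        define \<phi> where "\<phi> x = width r n A (\<lambda>a i. a (x i)) / n" for x :: "nat \<Rightarrow> vec"
        have \<phi>_meas: "\<phi> \<in> borel_measurable (PiM {..<n} (\<lambda>_. input_space d X))"
          unfolding \<phi>_def[abs_def] input_space_def using A A'
          by (intro borel_measurable_divide measurable_width[where F = "\<lambda>a. a"] measurable_restrict_space1) auto
        have w_\<phi>: "w S = \<phi> (\<lambda>i\<in>{..<n}. fst (S i))" for S
          unfolding w_def \<phi>_def gaussian_width_def
          by (intro arg_cong2[where f = "(/)"] Bochner_Integration.integral_cong refl arg_cong[where f = Max] image_cong dotp_cong)
             (auto simp: flatten_def)
        have "(\<lambda>S. \<lambda>i\<in>{..<n}. fst (S i)) \<in> sample_space n \<rightarrow>\<^sub>M PiM {..<n} (\<lambda>_. input_space d X)"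
          using fst_measurable by (intro measurable_restrict measurable_compose[OF measurable_component_singleton]) auto
        from measurable_compose[OF this \<phi>_meas] have w_meas: "w \<in> borel_measurable (sample_space n)"
          unfolding w_\<phi>[abs_def] .
        have "(\<integral>\<^sup>+S. ennreal (w S) \<partial>sample_space n) = (\<integral>\<^sup>+x. ennreal (\<phi> x) \<partial>PiM {..<n} (\<lambda>_. input_marginal d X P))"
          unfolding w_\<phi> using \<phi>_meas by (intro nn_integral_input_marginal[symmetric] prob_space_axioms fst_measurable) measurable
        also have "\<dots> \<le> (\<integral>\<^sup>+x. e2ennreal (emp_gaussian_complexity n r \<H> x) \<partial>PiM {..<n} (\<lambda>_. input_marginal d X P))"
        proof (intro nn_integral_mono)
          fix x
          have "ereal (\<phi> x) \<le> emp_gaussian_complexity n r \<H> x"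
            unfolding \<phi>_def using A by (intro width_le_emp_gaussian_complexity) auto
          then show "ennreal (\<phi> x) \<le> e2ennreal (emp_gaussian_complexity n r \<H> x)"
            by (metis e2ennreal_mono e2ennreal_ereal)
        qed
        also have "\<dots> = ennreal (v / K)"
          using Gv unfolding G_eq by (metis e2ennreal_enn2ereal e2ennreal_ereal)
        finally have le: "(\<integral>\<^sup>+S. ennreal (w S) \<partial>sample_space n) \<le> ennreal (v / K)" .
        have w_int: "integrable (sample_space n) w"
          using w_meas w_nonneg le_less_trans[OF le ennreal_less_top] by (intro integrableI_bounded) simp_all
        have "ennreal (\<integral>S. w S \<partial>sample_space n) \<le> ennreal (v / K)"
          using nn_integral_eq_integral[OF w_int] w_nonneg le by simp
        then have "(\<integral>S. w S \<partial>sample_space n) \<le> v / K" using \<gamma> \<open>0 < K\<close> by (subst (asm) ennreal_le_iff) auto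
        with w_int \<open>0 < K\<close> show ?thesis by (simp add: le_divide_eq mult.commute)
      qed
      then show "integrable (sample_space n) (\<lambda>S. K * w S)" "(\<integral>S. K * w S \<partial>sample_space n) \<le> v"
        using \<gamma> by (cases "K = 0"; simp)+
    qed
    have "R S / n \<le> (30075 * (L * ln n)) * (K * w S) + (30075 * (L * ln n) * \<gamma> + 3 * L * c)"
      if S: "S \<in> space (sample_space n)" for S
    proof -
      have "R S / n \<le> 3 * L * (10025 * ln n * (K * w S + \<gamma>) + sqrt q * D / (real n)\<^sup>2)"
        using S wF[OF _ S] \<gamma> by (intro pointwise) auto
      also have "\<dots> \<le> 3 * L * (10025 * ln n * (K * w S + \<gamma>) + c)" using c L_nonneg by (intro mult_left_mono) auto
      finally show ?thesis by (simp add: algebra_simps)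
    qed
    moreover have "30075 * (L * ln n) * (\<integral>S. K * w S \<partial>sample_space n) + (30075 * (L * ln n) * \<gamma> + 3 * L * c) \<le> 30075 * \<mu>"
    proof -
      have "30075 * (L * ln n) * (\<integral>S. K * w S \<partial>sample_space n) \<le> 30075 * (L * ln n) * v"
        using int(2) pos by (intro mult_left_mono) auto
      moreover have "0 \<le> L * c" using L_nonneg \<open>0 \<le> c\<close> by simp
      moreover have "30075 * (L * (ln n * (v + \<gamma>) + c)) \<le> 30075 * \<mu>" using real_fin by simp
      ultimately show ?thesis by (simp add: algebra_simps)
    qed
    ultimately have "(\<integral>S. R S \<partial>sample_space n) / n \<le> 30075 * \<mu>" using int(1) by (intro le_const)
    then show ?thesis by (simp add: R_def)
  qed
qed

end

section \<open>The transfer learning risk\<close>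

lemma cINF_epsilon:
  fixes g :: "'a \<Rightarrow> real"
  assumes "A \<noteq> {}" "bdd_below (g ` A)" "0 < \<epsilon>"
  obtains a where "a \<in> A" "g a < (INF a\<in>A. g a) + \<epsilon>"
  using assms by (metis cINF_less_iff less_add_same_cancel1)

context transfer_learning
begin

sublocale pre: bounded_task d "k - 1" Xp P lp Bp Lp
  using tasks pretraining_loss by unfold_locales auto

sublocale down: bounded_task d "k' - 1" Xd Q ld Bd Ld
  using tasks downstream_loss by unfold_locales auto

lemma nu_pos: "0 < \<nu>"
  and nu_le: "h' \<in> H \<Longrightarrow> worst_rep_difference Q ld Fd h' h \<le> rep_difference P lp Fp fp h' h / \<nu>"
  using diversity by (auto simp: diversity_parameter_def is_arg_max_def)

lemma measurable_classes:
  "h' \<in> H \<Longrightarrow> h' \<in> Rn d \<rightarrow>\<^sub>M Rn r" "f \<in> Fp \<Longrightarrow> f \<in> Rn r \<rightarrow>\<^sub>M Rn (k - 1)" "f' \<in> Fd \<Longrightarrow> f' \<in> Rn r \<rightarrow>\<^sub>M Rn (k' - 1)"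
  "f \<in> Fp \<Longrightarrow> h' \<in> H \<Longrightarrow> f \<circ> h' \<in> Rn d \<rightarrow>\<^sub>M Rn (k - 1)" "f' \<in> Fd \<Longrightarrow> h' \<in> H \<Longrightarrow> f' \<circ> h' \<in> Rn d \<rightarrow>\<^sub>M Rn (k' - 1)"
  using classes by (auto intro!: measurable_comp[where N = "Rn r"])

lemma LF_nonneg: "0 \<le> LF"
  using lipschitz_predictors realizable(2) by (auto simp: lipschitz_map_def)

lemma Dp_nonneg: "0 \<le> Dp"
proof -
  obtain z where "z \<in> space P" using pre.not_empty by blast
  then have "euclid_norm (k - 1) (fp (h (fst z))) \<le> Dp"
    using bounded_pretraining realizable by (auto simp: pre.space_P)
  moreover have "0 \<le> euclid_norm (k - 1) (fp (h (fst z)))" by (simp add: euclid_norm_def)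
  ultimately show ?thesis by (rule order.trans[rotated])
qed

lemma pre_rep_difference_eq:
  assumes "h' \<in> H" shows "rep_difference P lp Fp fp h' h = (INF f\<in>Fp. risk P lp (f \<circ> h') - risk P lp (fp \<circ> h))"
  unfolding rep_difference_def pre.risk_eq
  by (intro INF_cong refl, subst Bochner_Integration.integral_diff[symmetric])
     (use assms realizable measurable_classes pre.ex_loss_integrable in \<open>auto simp: pre.ex_loss_def\<close>)

lemma down_rep_difference_eq:
  assumes "h' \<in> H" "f \<in> Fd" shows "rep_difference Q ld Fd f h' h = (INF f'\<in>Fd. risk Q ld (f' \<circ> h') - risk Q ld (f \<circ> h))"
  unfolding rep_difference_def down.risk_eq
  by (intro INF_cong refl, subst Bochner_Integration.integral_diff[symmetric])
     (use assms realizable measurable_classes down.ex_loss_integrable in \<open>auto simp: down.ex_loss_def\<close>)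

lemma risk_gd: "risk Q ld gd = risk Q ld (fd \<circ> h)"
  unfolding risk_def
  by (intro Bochner_Integration.integral_cong refl) (use realizable(5) down.X_subset in \<open>auto simp: down.space_P\<close>)

lemma down_bdd_below: "h' \<in> H \<Longrightarrow> bdd_below ((\<lambda>f'. risk Q ld (f' \<circ> h') - c) ` Fd)"
proof (rule bdd_belowI2)
  fix f assume "h' \<in> H" "f \<in> Fd"
  then show "- Bd - c \<le> risk Q ld (f \<circ> h') - c" using down.abs_risk_le[OF measurable_classes(5)[of f h']] by linarith
qed

text \<open>\<open>fd\<close> is optimal on top of \<open>h\<close> because \<open>gd\<close>
  minimizes over all measurable predictors, so it competes in the supremum controlled by
  \<open>\<nu>\<close>. That supremum is taken in \<open>real\<close>, hence its boundedness by
  \<open>2 * Bd\<close> has to be shown.\<close>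

lemma down_rep_difference_le:
  assumes "h' \<in> H" shows "rep_difference Q ld Fd fd h' h \<le> rep_difference P lp Fp fp h' h / \<nu>"
proof -
  define opt where "opt = {f. is_arg_min (\<lambda>f. risk Q ld (f \<circ> h)) (\<lambda>f. f \<in> Fd) f}"
  have "fd \<in> opt"
    using optimal(2) realizable(1,3) measurable_classes(5)
    unfolding opt_def optimal_predictor_def is_arg_min_def risk_gd by blast
  moreover have "bdd_above ((\<lambda>f. rep_difference Q ld Fd f h' h) ` opt)"
  proof (rule bdd_aboveI2)
    fix f assume "f \<in> opt"
    then have f: "f \<in> Fd" by (simp add: opt_def is_arg_min_def)
    have "rep_difference Q ld Fd f h' h \<le> risk Q ld (fd \<circ> h') - risk Q ld (f \<circ> h)"
      unfolding down_rep_difference_eq[OF assms f] using realizable(3) by (intro cINF_lower down_bdd_below assms)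
    then show "rep_difference Q ld Fd f h' h \<le> 2 * Bd"
      using down.abs_risk_le[OF measurable_classes(5)[OF realizable(3) assms]] down.abs_risk_le[OF measurable_classes(5)[OF f realizable(1)]]
      by linarith
  qed
  ultimately have "rep_difference Q ld Fd fd h' h \<le> worst_rep_difference Q ld Fd h' h"
    unfolding worst_rep_difference_def opt_def by (intro cSUP_upper)
  with nu_le[OF assms] show ?thesis by simp
qed

lemma h_hat_in: "S \<in> space (pre.sample_space n) \<Longrightarrow> h_hat S \<in> H"
  using erm(1) by (auto simp: erm_representation_def is_arg_min_def)

lemma f_hat_in: "S \<in> space (pre.sample_space n) \<Longrightarrow> T \<in> space (down.sample_space m) \<Longrightarrow> f_hat S T \<in> Fd"
  and f_hat_min: "S \<in> space (pre.sample_space n) \<Longrightarrow> T \<in> space (down.sample_space m) \<Longrightarrow> f \<in> Fd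
    \<Longrightarrow> emp_risk m ld T (f_hat S T \<circ> h_hat S) \<le> emp_risk m ld T (f \<circ> h_hat S)"
  using erm(2) by (auto simp: erm_predictor_def is_arg_min_def not_less)

text \<open>Empirical optimality compares \<open>h_hat S\<close> with \<open>fp \<circ> h\<close>,
  and adding and subtracting empirical risks leaves a uniform deviation. Half of
  \<open>\<eta>\<close> pays for an infimum over \<open>Fp\<close> that may not be attained, the
  other half for replacing the composition by a member of the countable subclass.\<close>

lemma rep_difference_le_deviation:
  fixes Ep Eh :: "nat \<Rightarrow> vec \<Rightarrow> vec"
  assumes Ep: "range Ep \<subseteq> Fp" "\<And>f. f \<in> Fp \<Longrightarrow> \<exists>\<sigma>. \<forall>x\<in>space (Rn r). \<forall>j<k - 1. (\<lambda>t. Ep (\<sigma> t) x j) \<longlonglongrightarrow> f x j"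
    and Eh: "range Eh \<subseteq> H" "\<And>f. f \<in> H \<Longrightarrow> \<exists>\<sigma>. \<forall>x\<in>Xp. \<forall>j<r. (\<lambda>t. Eh (\<sigma> t) x j) \<longlonglongrightarrow> f x j"
    and S: "S \<in> space (pre.sample_space n)" and "0 < \<eta>"
  shows "\<exists>j. rep_difference P lp Fp fp (h_hat S) h
    \<le> pre.deviation n ((Ep ` {..j}) \<times> (Eh ` {..j})) (\<lambda>u. fst u \<circ> snd u) (fp \<circ> h) S + \<eta>"
proof -
  note hat = h_hat_in[OF S]
  have bdd: "bdd_below ((\<lambda>f. emp_risk n lp S (f \<circ> h')) ` Fp)" if "h' \<in> H" for h'
  proof (rule bdd_belowI2)
    fix f assume "f \<in> Fp"
    then show "- Bp \<le> emp_risk n lp S (f \<circ> h')"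
      using pre.abs_emp_risk_le[OF measurable_classes(4)[OF _ that] S, of f] by linarith
  qed
  have "Fp \<noteq> {}" using realizable(2) by auto
  have "0 < \<eta> / 2" using \<open>0 < \<eta>\<close> by simp
  obtain f where f: "f \<in> Fp" "emp_risk n lp S (f \<circ> h_hat S) < (INF f\<in>Fp. emp_risk n lp S (f \<circ> h_hat S)) + \<eta> / 2"
    by (rule cINF_epsilon[OF \<open>Fp \<noteq> {}\<close> bdd[OF hat] \<open>0 < \<eta> / 2\<close>])
  have "(INF f\<in>Fp. emp_risk n lp S (f \<circ> h_hat S)) \<le> (INF f\<in>Fp. emp_risk n lp S (f \<circ> h))"
    using erm(1) S realizable(1) by (auto simp: erm_representation_def is_arg_min_def not_less)
  also have "\<dots> \<le> emp_risk n lp S (fp \<circ> h)" by (rule cINF_lower[OF bdd[OF realizable(1)] realizable(2)])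
  finally have emp: "emp_risk n lp S (f \<circ> h_hat S) \<le> emp_risk n lp S (fp \<circ> h) + \<eta> / 2" using f(2) by linarith
  have "rep_difference P lp Fp fp (h_hat S) h \<le> risk P lp (f \<circ> h_hat S) - risk P lp (fp \<circ> h)"
    unfolding pre_rep_difference_eq[OF hat]
  proof (rule cINF_lower[OF _ f(1)], rule bdd_belowI2)
    fix f assume "f \<in> Fp"
    then show "- Bp - risk P lp (fp \<circ> h) \<le> risk P lp (f \<circ> h_hat S) - risk P lp (fp \<circ> h)"
      using pre.abs_risk_le[OF measurable_classes(4)[OF _ hat], of f] by linarith
  qed
  moreover obtain j where "risk P lp (f \<circ> h_hat S) - emp_risk n lp S (f \<circ> h_hat S)
      \<le> (MAX u\<in>(Ep ` {..j}) \<times> (Eh ` {..j}). risk P lp (fst u \<circ> snd u) - emp_risk n lp S (fst u \<circ> snd u)) + \<eta> / 2"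
  proof -
    obtain \<sigma> where \<sigma>: "\<And>x j. x \<in> space (Rn r) \<Longrightarrow> j < k - 1 \<Longrightarrow> (\<lambda>t. Ep (\<sigma> t) x j) \<longlonglongrightarrow> f x j"
      using Ep(2)[OF f(1)] by blast
    obtain \<tau> where \<tau>: "\<And>x j. x \<in> Xp \<Longrightarrow> j < r \<Longrightarrow> (\<lambda>t. Eh (\<tau> t) x j) \<longlonglongrightarrow> h_hat S x j"
      using Eh(2)[OF hat] by blast
    have in_Ep: "Ep i \<in> Fp" and in_Eh: "Eh i \<in> H" for i using Ep(1) Eh(1) by auto
    \<comment> \<open>Both factors vary at once. The constant \<open>LF\<close> common to all
      \<open>Ep (\<sigma> t)\<close> controls the change of argument, after which only the
      convergence of the predictors at the fixed point \<open>h_hat S x\<close> is left.\<close>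
    have lim: "(\<lambda>t. (Ep (\<sigma> t) \<circ> Eh (\<tau> t)) x j) \<longlonglongrightarrow> (f \<circ> h_hat S) x j" if "x \<in> Xp" "j < k - 1" for x j
    proof -
      have xs: "h' x \<in> space (Rn r)" if "h' \<in> H" for h'
        using measurable_space[OF measurable_classes(1)[OF that]] \<open>x \<in> Xp\<close> pre.X_subset by auto
      have "(\<lambda>t. LF * euclid_dist r (Eh (\<tau> t) x) (h_hat S x)) \<longlonglongrightarrow> LF * sqrt (\<Sum>i<r. (h_hat S x i - h_hat S x i)\<^sup>2)"
        unfolding euclid_dist_def L2_set_def by (intro tendsto_intros \<tau>) (use that in auto)
      then have "(\<lambda>t. LF * euclid_dist r (Eh (\<tau> t) x) (h_hat S x)) \<longlonglongrightarrow> 0" by simp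
      moreover have "norm (Ep (\<sigma> t) (Eh (\<tau> t) x) j - Ep (\<sigma> t) (h_hat S x) j) \<le> LF * euclid_dist r (Eh (\<tau> t) x) (h_hat S x)" for t
      proof -
        have "\<bar>Ep (\<sigma> t) (Eh (\<tau> t) x) j - Ep (\<sigma> t) (h_hat S x) j\<bar> \<le> euclid_dist (k - 1) (Ep (\<sigma> t) (Eh (\<tau> t) x)) (Ep (\<sigma> t) (h_hat S x))"
          unfolding euclid_dist_def
          using member_le_L2_set[of "{..<k - 1}" j "\<lambda>i. \<bar>Ep (\<sigma> t) (Eh (\<tau> t) x) i - Ep (\<sigma> t) (h_hat S x) i\<bar>"] that(2)
          by (simp add: L2_set_def)
        also have "\<dots> \<le> LF * euclid_dist r (Eh (\<tau> t) x) (h_hat S x)"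
          using lipschitz_predictors in_Ep xs[OF in_Eh] xs[OF hat] by (simp add: lipschitz_map_def)
        finally show ?thesis by (simp only: real_norm_def)
      qed
      ultimately have "(\<lambda>t. Ep (\<sigma> t) (Eh (\<tau> t) x) j - Ep (\<sigma> t) (h_hat S x) j) \<longlonglongrightarrow> 0"
        by (rule Lim_null_comparison[OF always_eventually[OF allI], rotated])
      from tendsto_add[OF this \<sigma>[OF xs[OF hat] that(2)]] show ?thesis by simp
    qed
    have "\<exists>t. risk P lp (f \<circ> h_hat S) - emp_risk n lp S (f \<circ> h_hat S)
        \<le> risk P lp (Ep (\<sigma> t) \<circ> Eh (\<tau> t)) - emp_risk n lp S (Ep (\<sigma> t) \<circ> Eh (\<tau> t)) + \<eta> / 2"
      using in_Ep in_Eh f(1) hat measurable_classes(4) S lim \<open>0 < \<eta> / 2\<close> by (intro pre.risk_approximation) auto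
    then obtain t where t: "risk P lp (f \<circ> h_hat S) - emp_risk n lp S (f \<circ> h_hat S)
        \<le> risk P lp (Ep (\<sigma> t) \<circ> Eh (\<tau> t)) - emp_risk n lp S (Ep (\<sigma> t) \<circ> Eh (\<tau> t)) + \<eta> / 2" by blast
    define j where "j = max (\<sigma> t) (\<tau> t)"
    have "(Ep (\<sigma> t), Eh (\<tau> t)) \<in> (Ep ` {..j}) \<times> (Eh ` {..j})" by (auto simp: j_def)
    then have "risk P lp (Ep (\<sigma> t) \<circ> Eh (\<tau> t)) - emp_risk n lp S (Ep (\<sigma> t) \<circ> Eh (\<tau> t))
      \<le> (MAX u\<in>(Ep ` {..j}) \<times> (Eh ` {..j}). risk P lp (fst u \<circ> snd u) - emp_risk n lp S (fst u \<circ> snd u))"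
      by (intro Max_ge) (auto intro!: image_eqI[where x = "(Ep (\<sigma> t), Eh (\<tau> t))"])
    with t show thesis by (intro that[of j]) linarith
  qed
  ultimately show ?thesis using emp unfolding pre.deviation_def by (intro exI[of _ j]) linarith
qed

lemma excess_le_deviation:
  fixes Ed :: "nat \<Rightarrow> vec \<Rightarrow> vec"
  assumes Ed: "range Ed \<subseteq> Fd" "\<And>f. f \<in> Fd \<Longrightarrow> \<exists>\<sigma>. \<forall>x\<in>space (Rn r). \<forall>j<k' - 1. (\<lambda>t. Ed (\<sigma> t) x j) \<longlonglongrightarrow> f x j"
    and S: "S \<in> space (pre.sample_space n)" and T: "T \<in> space (down.sample_space m)" and "0 < \<eta>"
    and f: "f \<in> Fd" "risk Q ld (f \<circ> h_hat S) - risk Q ld gd \<le> c"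
  shows "\<exists>j. risk Q ld (f_hat S T \<circ> h_hat S) - risk Q ld gd - c
    \<le> down.deviation m (Ed ` {..j}) (\<lambda>f. f \<circ> h_hat S) (f \<circ> h_hat S) T + \<eta>"
proof -
  note hat = h_hat_in[OF S]
  note fhat = f_hat_in[OF S T]
  obtain \<sigma> where \<sigma>: "\<And>x j. x \<in> space (Rn r) \<Longrightarrow> j < k' - 1 \<Longrightarrow> (\<lambda>t. Ed (\<sigma> t) x j) \<longlonglongrightarrow> f_hat S T x j"
    using Ed(2)[OF fhat] by blast
  have in_Ed: "Ed i \<in> Fd" for i using Ed(1) by auto
  have lim: "(\<lambda>t. (Ed (\<sigma> t) \<circ> h_hat S) x j) \<longlonglongrightarrow> (f_hat S T \<circ> h_hat S) x j" if "x \<in> Xd" "j < k' - 1" for x j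
    using \<sigma>[OF _ that(2)] measurable_space[OF measurable_classes(1)[OF hat]] that(1) down.X_subset by auto
  have "\<exists>t. risk Q ld (f_hat S T \<circ> h_hat S) - emp_risk m ld T (f_hat S T \<circ> h_hat S)
      \<le> risk Q ld (Ed (\<sigma> t) \<circ> h_hat S) - emp_risk m ld T (Ed (\<sigma> t) \<circ> h_hat S) + \<eta>"
    using in_Ed fhat hat measurable_classes(5) T lim \<open>0 < \<eta>\<close> by (intro down.risk_approximation) auto
  then obtain t where t: "risk Q ld (f_hat S T \<circ> h_hat S) - emp_risk m ld T (f_hat S T \<circ> h_hat S)
      \<le> risk Q ld (Ed (\<sigma> t) \<circ> h_hat S) - emp_risk m ld T (Ed (\<sigma> t) \<circ> h_hat S) + \<eta>" by blast
  have "risk Q ld (Ed (\<sigma> t) \<circ> h_hat S) - emp_risk m ld T (Ed (\<sigma> t) \<circ> h_hat S)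
    \<le> (MAX f\<in>Ed ` {..\<sigma> t}. risk Q ld (f \<circ> h_hat S) - emp_risk m ld T (f \<circ> h_hat S))"
    by (intro Max_ge) auto
  then show ?thesis using t f(2) f_hat_min[OF S T f(1)] unfolding down.deviation_def by (intro exI[of _ "\<sigma> t"]) linarith
qed

text \<open>With \<open>S\<close> frozen, the excess is at most \<open>a / \<nu>\<close> plus a
  downstream deviation, up to an arbitrarily small error. Integrating over \<open>T\<close> thus
  pulls out \<open>exp (t / \<nu> * a)\<close>, a pre-training moment at parameter
  \<open>t / \<nu>\<close>. The outer integral is taken of \<open>Gp\<close>, which dominates this
  factor and is measurable as a countable supremum, while \<open>a\<close> is an infimum evaluated
  at the selected \<open>h_hat S\<close>.\<close>

lemma exp_excess_risk_le:
  assumes "0 \<le> t"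
    and wp: "ereal Lp * (ereal (ln n) * (ereal LF * gaussian_complexity n r H (input_marginal d Xp P)
        + worst_gaussian_complexity n (k - 1) Fp H Xp) + ereal (sqrt k * Dp / (real n)\<^sup>2)) = ereal wp"
    and wd: "ereal Ld * worst_gaussian_complexity m (k' - 1) Fd H Xd = ereal wd"
  shows "(\<integral>\<^sup>+\<omega>. ennreal (exp (t * (case \<omega> of (S, T) \<Rightarrow> risk Q ld (f_hat S T \<circ> h_hat S) - risk Q ld gd)))
      \<partial>(pre.sample_space n \<Otimes>\<^sub>M down.sample_space m))
    \<le> ennreal (exp (t * (30075 * wp / \<nu> + 3 * wd) + 2 * t\<^sup>2 * (Bp / (\<nu> * sqrt n) + Bd / sqrt m)\<^sup>2))"
proof -
  interpret PS: prob_space "pre.sample_space n" by (rule pre.prob_space_PiM_same)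
  interpret QS: prob_space "down.sample_space m" by (rule down.prob_space_PiM_same)
  interpret pair_prob_space "pre.sample_space n" "down.sample_space m" ..
  define Z where "Z S T = risk Q ld (f_hat S T \<circ> h_hat S) - risk Q ld gd" for S T
  have Z_meas: "(\<lambda>(S, T). Z S T) \<in> borel_measurable (pre.sample_space n \<Otimes>\<^sub>M down.sample_space m)"
    unfolding Z_def using random_risk by (simp add: case_prod_beta')
  have ne: "Fp \<noteq> {}" "H \<noteq> {}" "Fd \<noteq> {}" using realizable by auto
  obtain Ed :: "nat \<Rightarrow> vec \<Rightarrow> vec" where Ed: "range Ed \<subseteq> Fd" "\<forall>f\<in>Fd. \<exists>\<sigma>. \<forall>x\<in>space (Rn r). \<forall>j<k' - 1. (\<lambda>t. Ed (\<sigma> t) x j) \<longlonglongrightarrow> f x j"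
    by (rule pointwise_separable_enumeration[OF separable(2) ne(3)])
  obtain Eh :: "nat \<Rightarrow> vec \<Rightarrow> vec" where Eh: "range Eh \<subseteq> H" "\<forall>f\<in>H. \<exists>\<sigma>. \<forall>x\<in>Xp. \<forall>j<r. (\<lambda>t. Eh (\<sigma> t) x j) \<longlonglongrightarrow> f x j"
    by (rule pointwise_separable_enumeration[OF separable(1) ne(2)])
  have sep: "pointwise_separable (k - 1) (space (Rn r)) Fp"
    using lipschitz_predictors by (intro pointwise_separable_lipschitz) auto
  obtain Ep :: "nat \<Rightarrow> vec \<Rightarrow> vec" where Ep: "range Ep \<subseteq> Fp" "\<forall>f\<in>Fp. \<exists>\<sigma>. \<forall>x\<in>space (Rn r). \<forall>j<k - 1. (\<lambda>t. Ep (\<sigma> t) x j) \<longlonglongrightarrow> f x j"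
    by (rule pointwise_separable_enumeration[OF sep ne(1)])
  note Ed = Ed(1) bspec[OF Ed(2)] and Eh = Eh(1) bspec[OF Eh(2)] and Ep = Ep(1) bspec[OF Ep(2)]
  define Up where "Up j = (Ep ` {..j}) \<times> (Eh ` {..j})" for j :: nat
  define Ud where "Ud j = Ed ` {..j}" for j :: nat
  have Up: "finite (Up j)" "Up j \<noteq> {}" "Up j \<subseteq> Fp \<times> H" for j using Ep(1) Eh(1) by (auto simp: Up_def)
  have Ud: "finite (Ud j)" "Ud j \<noteq> {}" "Ud j \<subseteq> Fd" for j using Ed(1) by (auto simp: Ud_def)
  have incs: "incseq Up" "incseq Ud"
    unfolding Up_def Ud_def by (intro monoI Sigma_mono image_mono; auto)+
  define Gp where "Gp = pre.sup_exp_deviation (t / \<nu>) n Up (\<lambda>u. fst u \<circ> snd u) (fp \<circ> h)"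
  define bd where "bd = t * (3 * wd) + 2 * t\<^sup>2 * Bd\<^sup>2 / m"
  define bp where "bp = t / \<nu> * (30075 * wp) + 2 * (t / \<nu>)\<^sup>2 * Bp\<^sup>2 / n"
  have t\<nu>: "0 \<le> t / \<nu>" using \<open>0 \<le> t\<close> nu_pos by simp
  have Gp_meas: "Gp \<in> borel_measurable (pre.sample_space n)"
    unfolding Gp_def
  proof (rule pre.sup_exp_deviation_measurable[OF Up(1)])
    show "fst u \<circ> snd u \<in> Rn d \<rightarrow>\<^sub>M Rn (k - 1)" if "u \<in> Up j" for j u
      using that Up(3)[of j] measurable_classes(4) by auto
    show "fp \<circ> h \<in> Rn d \<rightarrow>\<^sub>M Rn (k - 1)" using realizable measurable_classes(4) by auto
  qed
  have Gp_le: "(\<integral>\<^sup>+S. Gp S \<partial>pre.sample_space n) \<le> ennreal (exp bp)"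
    unfolding Gp_def bp_def
  proof (rule pre.nn_integral_sup_exp_deviation[OF Up(1,2) incs(1) _ _ sizes(3) t\<nu>])
    show "fst u \<circ> snd u \<in> Rn d \<rightarrow>\<^sub>M Rn (k - 1)" if "u \<in> Up j" for j u
      using that Up(3)[of j] measurable_classes(4) by auto
    show "fp \<circ> h \<in> Rn d \<rightarrow>\<^sub>M Rn (k - 1)" using realizable measurable_classes(4) by auto
    show "(\<integral>S. pre.rad n (\<lambda>u. fst u \<circ> snd u) (Up j) S \<partial>pre.sample_space n) / n \<le> 30075 * wp" for j
      unfolding Up_def
    proof (rule pre.rademacher_composition_complexity[where \<F> = Fp and \<H> = H and D = Dp and K = LF and r = r and c = "sqrt k * Dp / (real n)\<^sup>2"])
      \<comment> \<open>Predictions have \<open>k - 1\<close> coordinates; the remainder is enlarged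
        to the \<open>sqrt k\<close> of the statement.\<close>
      show "sqrt (real (k - 1)) * Dp / (real n)\<^sup>2 \<le> sqrt (real k) * Dp / (real n)\<^sup>2"
        using Dp_nonneg by (intro divide_right_mono mult_right_mono) auto
    qed (use Ep(1) Eh(1) classes lipschitz_predictors bounded_pretraining Dp_nonneg sizes LF_nonneg wp in auto)
  qed
  have inner: "(\<integral>\<^sup>+T. ennreal (exp (t * Z S T)) \<partial>down.sample_space m) \<le> Gp S * ennreal (exp bd)"
    if S: "S \<in> space (pre.sample_space n)" for S
  proof -
    note hat = h_hat_in[OF S]
    define a where "a = rep_difference P lp Fp fp (h_hat S) h"
    have ZS_meas: "Z S \<in> borel_measurable (down.sample_space m)"
      using measurable_compose[OF measurable_Pair1'[OF S] Z_meas] by simp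
    have "ennreal (exp (t / \<nu> * a)) \<le> Gp S"
      unfolding Gp_def a_def Up_def
      by (intro pre.exp_le_sup_exp_deviation t\<nu> rep_difference_le_deviation Ep Eh S)
    \<comment> \<open>The infimum over \<open>Fd\<close> may not be attained, so a predictor within
      \<open>\<epsilon>\<close> of it is used, and \<open>\<epsilon>\<close> tends to 0 only after
      the integration. This predictor depends on \<open>S\<close> but not on \<open>T\<close>, so
      its own deviation has mean zero.\<close>
    have eps: "(\<integral>\<^sup>+T. ennreal (exp (t * Z S T)) \<partial>down.sample_space m) \<le> ennreal (exp (t * (a / \<nu> + \<epsilon>) + bd))" if "0 < \<epsilon>" for \<epsilon>
    proof -
      obtain f where f: "f \<in> Fd" "risk Q ld (f \<circ> h_hat S) - risk Q ld (fd \<circ> h) < rep_difference Q ld Fd fd (h_hat S) h + \<epsilon>"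
        unfolding down_rep_difference_eq[OF hat realizable(3)]
        by (rule cINF_epsilon[OF ne(3) down_bdd_below[OF hat] \<open>0 < \<epsilon>\<close>])
      define c where "c = a / \<nu> + \<epsilon>"
      have fc: "risk Q ld (f \<circ> h_hat S) - risk Q ld gd \<le> c"
        using f(2) down_rep_difference_le[OF hat] unfolding risk_gd c_def a_def by linarith
      have "(\<integral>\<^sup>+T. ennreal (exp (t * (Z S T - c))) \<partial>down.sample_space m)
          \<le> (\<integral>\<^sup>+T. down.sup_exp_deviation t m Ud (\<lambda>f. f \<circ> h_hat S) (f \<circ> h_hat S) T \<partial>down.sample_space m)"
        unfolding Z_def Ud_def
        by (intro nn_integral_mono down.exp_le_sup_exp_deviation \<open>0 \<le> t\<close> excess_le_deviation Ed S f(1) fc)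
      also have "\<dots> \<le> ennreal (exp bd)"
        unfolding bd_def
      proof (rule down.nn_integral_sup_exp_deviation[OF Ud(1,2) incs(2) _ _ sizes(4) \<open>0 \<le> t\<close>])
        show "u \<circ> h_hat S \<in> Rn d \<rightarrow>\<^sub>M Rn (k' - 1)" if "u \<in> Ud j" for j u
          using that Ud(3)[of j] measurable_classes(5) hat by auto
        show "f \<circ> h_hat S \<in> Rn d \<rightarrow>\<^sub>M Rn (k' - 1)" using f(1) hat measurable_classes(5) by auto
        show "(\<integral>T. down.rad m (\<lambda>f. f \<circ> h_hat S) (Ud j) T \<partial>down.sample_space m) / m \<le> 3 * wd" for j
        proof (rule down.rademacher_le_worst_complexity[OF Ud classes(3) hat measurable_classes(1)[OF hat]])
          have "ereal (3 * Ld) * worst_gaussian_complexity m (k' - 1) Fd H Xd = ereal 3 * (ereal Ld * worst_gaussian_complexity m (k' - 1) Fd H Xd)"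
            by (simp add: mult.assoc[symmetric])
          then show "ereal (3 * Ld) * worst_gaussian_complexity m (k' - 1) Fd H Xd \<le> ereal (3 * wd)" unfolding wd by simp
        qed
      qed
      finally have "ennreal (exp (t * c)) * (\<integral>\<^sup>+T. ennreal (exp (t * (Z S T - c))) \<partial>down.sample_space m) \<le> ennreal (exp (t * c)) * ennreal (exp bd)"
        by (rule mult_left_mono) simp
      also have "ennreal (exp (t * c)) * (\<integral>\<^sup>+T. ennreal (exp (t * (Z S T - c))) \<partial>down.sample_space m)
          = (\<integral>\<^sup>+T. ennreal (exp (t * c)) * ennreal (exp (t * (Z S T - c))) \<partial>down.sample_space m)"
      proof (intro nn_integral_cmult[symmetric])
        have "(\<lambda>T. t * (Z S T - c)) \<in> borel_measurable (down.sample_space m)"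
          by (intro borel_measurable_times borel_measurable_diff borel_measurable_const ZS_meas)
        then show "(\<lambda>T. ennreal (exp (t * (Z S T - c)))) \<in> borel_measurable (down.sample_space m)" by measurable
      qed
      also have "\<dots> = (\<integral>\<^sup>+T. ennreal (exp (t * Z S T)) \<partial>down.sample_space m)"
        by (intro nn_integral_cong) (simp add: ennreal_mult[symmetric] exp_add[symmetric] algebra_simps)
      finally show ?thesis by (simp add: ennreal_mult[symmetric] exp_add[symmetric] c_def)
    qed
    have lim: "(\<lambda>i. ennreal (exp (t * (a / \<nu> + inverse (real (Suc i))) + bd))) \<longlonglongrightarrow> ennreal (exp (t * (a / \<nu> + 0) + bd))"
      by (intro tendsto_intros LIMSEQ_inverse_real_of_nat)
    have "(\<integral>\<^sup>+T. ennreal (exp (t * Z S T)) \<partial>down.sample_space m) \<le> ennreal (exp (t * (a / \<nu> + 0) + bd))"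
      by (rule LIMSEQ_le_const[OF lim]) (use eps in auto)
    also have "\<dots> = ennreal (exp (t / \<nu> * a)) * ennreal (exp bd)" by (simp add: ennreal_mult[symmetric] exp_add[symmetric])
    also have "\<dots> \<le> Gp S * ennreal (exp bd)" using \<open>ennreal (exp (t / \<nu> * a)) \<le> Gp S\<close> by (intro mult_right_mono) auto
    finally show ?thesis .
  qed
  have "(\<integral>\<^sup>+\<omega>. ennreal (exp (t * (case \<omega> of (S, T) \<Rightarrow> Z S T))) \<partial>(pre.sample_space n \<Otimes>\<^sub>M down.sample_space m))
      = (\<integral>\<^sup>+S. (\<integral>\<^sup>+T. ennreal (exp (t * Z S T)) \<partial>down.sample_space m) \<partial>pre.sample_space n)"
    using Z_meas by (subst QS.nn_integral_fst[symmetric]) (auto simp: case_prod_beta')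
  also have "\<dots> \<le> (\<integral>\<^sup>+S. Gp S * ennreal (exp bd) \<partial>pre.sample_space n)" by (intro nn_integral_mono inner)
  also have "\<dots> = (\<integral>\<^sup>+S. Gp S \<partial>pre.sample_space n) * ennreal (exp bd)" using Gp_meas by (intro nn_integral_multc)
  also have "\<dots> \<le> ennreal (exp bp) * ennreal (exp bd)" using Gp_le by (intro mult_right_mono) auto
  also have "\<dots> = ennreal (exp (bp + bd))" by (simp add: ennreal_mult[symmetric] exp_add)
  also have "\<dots> \<le> ennreal (exp (t * (30075 * wp / \<nu> + 3 * wd) + 2 * t\<^sup>2 * (Bp / (\<nu> * sqrt n) + Bd / sqrt m)\<^sup>2))"
  proof -
    \<comment> \<open>Bounding \<open>x\<^sup>2 + y\<^sup>2\<close> by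
      \<open>(x + y)\<^sup>2\<close> replaces the two scales by their sum, which produces the two
      confidence terms of the statement.\<close>
    define x where "x = Bp / (\<nu> * sqrt n)"
    define y where "y = Bd / sqrt m"
    have "0 \<le> x" "0 \<le> y" using pre.B_nonneg down.B_nonneg nu_pos by (auto simp: x_def y_def)
    then have "x\<^sup>2 + y\<^sup>2 \<le> (x + y)\<^sup>2" by (simp add: power2_sum)
    then have "2 * t\<^sup>2 * (x\<^sup>2 + y\<^sup>2) \<le> 2 * t\<^sup>2 * (x + y)\<^sup>2" by (intro mult_left_mono) auto
    moreover have "2 * (t / \<nu>)\<^sup>2 * Bp\<^sup>2 / n = 2 * t\<^sup>2 * x\<^sup>2" "2 * t\<^sup>2 * Bd\<^sup>2 / m = 2 * t\<^sup>2 * y\<^sup>2"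
      by (simp_all add: x_def y_def power_divide power_mult_distrib)
    ultimately have "bp + bd \<le> t * (30075 * wp / \<nu> + 3 * wd) + 2 * t\<^sup>2 * (x + y)\<^sup>2"
      unfolding bp_def bd_def by (simp add: algebra_simps)
    then show ?thesis unfolding x_def y_def by (intro ennreal_leI) simp
  qed
  finally show ?thesis by (simp add: Z_def)
qed

end

text \<open>At the threshold \<open>\<mu> + 3 * s * x\<close>, Chernoff's exponent
  \<open>2 * (t * s)\<^sup>2 - 3 * x * (t * s)\<close> is minimal at
  \<open>t * s = 3 * x / 4\<close>, with value \<open>- (9 / 8) * x\<^sup>2\<close>. Any factor of
  at least \<open>sqrt 8\<close> in place of 3 would reach \<open>- x\<^sup>2\<close>.\<close>

lemma (in prob_space) chernoff_quadratic:
  fixes Z :: "'a \<Rightarrow> real"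
  assumes Z: "Z \<in> borel_measurable M" and "0 < s" "0 < x" and \<delta>: "exp (- x\<^sup>2) \<le> \<delta>"
    and mgf: "\<And>t. 0 \<le> t \<Longrightarrow> (\<integral>\<^sup>+\<omega>. ennreal (exp (t * Z \<omega>)) \<partial>M) \<le> ennreal (exp (t * \<mu> + 2 * t\<^sup>2 * s\<^sup>2))"
  shows "1 - \<delta> \<le> prob {\<omega>\<in>space M. Z \<omega> \<le> \<mu> + 3 * s * x}"
proof -
  define b where "b = \<mu> + 3 * s * x"
  define t where "t = 3 * x / (4 * s)"
  have t: "0 < t" using \<open>0 < s\<close> \<open>0 < x\<close> by (simp add: t_def)
  have "emeasure M {\<omega>\<in>space M. \<not> Z \<omega> \<le> b} = (\<integral>\<^sup>+\<omega>. indicator {\<omega>\<in>space M. \<not> Z \<omega> \<le> b} \<omega> \<partial>M)"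
    using Z by (intro nn_integral_indicator[symmetric]) measurable
  also have "\<dots> \<le> (\<integral>\<^sup>+\<omega>. ennreal (exp (- t * b)) * ennreal (exp (t * Z \<omega>)) \<partial>M)"
  proof (intro nn_integral_mono)
    fix \<omega>
    have "(1::ennreal) \<le> ennreal (exp (- t * b)) * ennreal (exp (t * Z \<omega>))" if "\<not> Z \<omega> \<le> b"
    proof -
      have "0 \<le> t * (Z \<omega> - b)" using t that by simp
      then have "1 \<le> exp (- t * b) * exp (t * Z \<omega>)" by (simp add: exp_add[symmetric] algebra_simps)
      then show ?thesis by (simp add: ennreal_mult[symmetric] ennreal_ge_1)
    qed
    then show "indicator {\<omega>\<in>space M. \<not> Z \<omega> \<le> b} \<omega> \<le> ennreal (exp (- t * b)) * ennreal (exp (t * Z \<omega>))"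
      by (auto simp: indicator_def)
  qed
  also have "\<dots> = ennreal (exp (- t * b)) * (\<integral>\<^sup>+\<omega>. ennreal (exp (t * Z \<omega>)) \<partial>M)"
    using Z by (intro nn_integral_cmult) measurable
  also have "\<dots> \<le> ennreal (exp (- t * b)) * ennreal (exp (t * \<mu> + 2 * t\<^sup>2 * s\<^sup>2))"
    using t by (intro mult_left_mono mgf) auto
  also have "\<dots> = ennreal (exp (- (9 / 8) * x\<^sup>2))"
  proof -
    have ts: "t * s = 3 * x / 4" using \<open>0 < s\<close> by (simp add: t_def)
    have "2 * (t * s)\<^sup>2 - 3 * x * (t * s) = - (9 / 8) * x\<^sup>2" unfolding ts by (simp add: power2_eq_square)
    then have "- t * b + (t * \<mu> + 2 * t\<^sup>2 * s\<^sup>2) = - (9 / 8) * x\<^sup>2"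
      by (simp add: b_def algebra_simps power_mult_distrib)
    then show ?thesis by (simp only: ennreal_mult[symmetric] exp_ge_zero exp_add[symmetric])
  qed
  also have "\<dots> \<le> ennreal \<delta>"
  proof (rule ennreal_leI)
    have "exp (- (9 / 8) * x\<^sup>2) \<le> exp (- x\<^sup>2)" by simp
    with \<delta> show "exp (- (9 / 8) * x\<^sup>2) \<le> \<delta>" by linarith
  qed
  finally have "prob {\<omega>\<in>space M. \<not> Z \<omega> \<le> b} \<le> \<delta>"
    using order.trans[OF exp_ge_zero \<delta>] by (simp add: emeasure_eq_measure ennreal_le_iff)
  moreover have "prob {\<omega>\<in>space M. \<not> Z \<omega> \<le> b} = 1 - prob {\<omega>\<in>space M. Z \<omega> \<le> b}"
    using Z by (intro prob_neg) measurable
  ultimately show ?thesis by (simp add: b_def)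
qed

lemma ereal_affine_eq_infinity:
  fixes a b :: ereal
  assumes "0 \<le> a" "0 \<le> b" "a = \<infinity> \<or> b = \<infinity>" "0 < C" "0 < c"
  shows "ereal C * (ereal c * (a + ereal x) + b + ereal y) = \<infinity>"
  using assms by (cases a; cases b) auto

text \<open>If \<open>Wp\<close> or \<open>Wd\<close> is infinite, so is the right-hand side, and
  the claim is trivial. Otherwise Chernoff's bound applies with scale \<open>s\<close>, unless
  \<open>s = 0\<close>; in that case \<open>Bd = 0\<close>, all downstream risks vanish, and so does
  the excess.\<close>

lemma (in transfer_learning) transfer_risk_bound:
  assumes "0 < \<delta>" "\<delta> < 1"
  defines "M \<equiv> PiM {..<n} (\<lambda>_. P) \<Otimes>\<^sub>M PiM {..<m} (\<lambda>_. Q)"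
  shows "1 - \<delta> \<le> measure M {\<omega>\<in>space M.
           (case \<omega> of (S, T) \<Rightarrow>
             ereal (risk Q ld (f_hat S T \<circ> h_hat S) - risk Q ld gd)
             \<le> ereal 40000 *
               (ereal (1 / \<nu>) *
                  (ereal Lp *
                     (ereal (ln (real n)) *
                        (ereal LF * gaussian_complexity n r H (input_marginal d Xp P)
                          + worst_gaussian_complexity n (k - 1) Fp H Xp)
                      + ereal (sqrt (real k) * Dp / (real n)\<^sup>2))
                   + ereal (Bp * sqrt (ln (1 / \<delta>) / real n)))
                + ereal Ld * worst_gaussian_complexity m (k' - 1) Fd H Xd
                + ereal (Bd * sqrt (ln (1 / \<delta>) / real m))))}"
    (is "_ \<le> measure M {\<omega>\<in>space M. case \<omega> of (S, T) \<Rightarrow> ereal (?Z S T) \<le> ?rhs}")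
proof -
  interpret PS: prob_space "pre.sample_space n" by (rule pre.prob_space_PiM_same)
  interpret QS: prob_space "down.sample_space m" by (rule down.prob_space_PiM_same)
  interpret M: pair_prob_space "pre.sample_space n" "down.sample_space m" ..
  interpret MM: prob_space M unfolding M_def by (rule M.prob_space_axioms)
  define Wp where "Wp = ereal Lp * (ereal (ln n) * (ereal LF * gaussian_complexity n r H (input_marginal d Xp P)
      + worst_gaussian_complexity n (k - 1) Fp H Xp) + ereal (sqrt k * Dp / (real n)\<^sup>2))"
  define Wd where "Wd = ereal Ld * worst_gaussian_complexity m (k' - 1) Fd H Xd"
  define x where "x = sqrt (ln (1 / \<delta>))"
  define s where "s = Bp / (\<nu> * sqrt n) + Bd / sqrt m"
  define \<beta> where "\<beta> = Bp * sqrt (ln (1 / \<delta>) / n)"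
  define \<beta>' where "\<beta>' = Bd * sqrt (ln (1 / \<delta>) / m)"
  have "0 < x" using assms(1,2) by (simp add: x_def)
  have B: "0 \<le> Bp" "0 \<le> Bd" by (rule pre.B_nonneg down.B_nonneg)+
  have ln: "0 \<le> ln (real n)" "0 < real n" "0 < real m" using sizes by auto
  have \<beta>: "0 \<le> \<beta>" "0 \<le> \<beta>'" using B assms(1,2) by (auto simp: \<beta>_def \<beta>'_def)
  have sx: "s * x = \<beta> / \<nu> + \<beta>'"
    by (simp add: s_def x_def \<beta>_def \<beta>'_def real_sqrt_divide algebra_simps)
  have worst_nonneg: "0 \<le> worst_gaussian_complexity N q F H X" if FX: "F \<noteq> {}" "X \<noteq> {}" for N q F X
  proof -
    obtain y where "y \<in> X" using FX(2) by auto
    have "0 \<le> emp_gaussian_complexity N q F (\<lambda>i. h ((\<lambda>_. y) i))" using FX by (intro emp_gaussian_complexity_nonneg)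
    also have "\<dots> \<le> worst_gaussian_complexity N q F H X"
      using realizable(1) \<open>y \<in> X\<close> by (intro emp_gaussian_complexity_le_worst) auto
    finally show ?thesis .
  qed
  have ne: "Fp \<noteq> {}" "H \<noteq> {}" "Fd \<noteq> {}" "Xp \<noteq> {}" "Xd \<noteq> {}"
    using realizable pre.not_empty down.not_empty pre.space_P down.space_P by auto
  have Wp: "0 \<le> Wp"
    unfolding Wp_def gaussian_complexity_eq_nn_integral[OF ne(2)]
    using worst_nonneg[OF ne(1,4)] pre.L_nonneg LF_nonneg ln Dp_nonneg
    by (intro ereal_0_le_mult add_nonneg_nonneg) auto
  have Wd: "0 \<le> Wd" unfolding Wd_def using worst_nonneg[OF ne(3,5)] down.L_nonneg by (intro ereal_0_le_mult) auto
  define R where "R = ?rhs"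
  have rhs: "R = ereal 40000 * (ereal (1 / \<nu>) * (Wp + ereal \<beta>) + Wd + ereal \<beta>')"
    by (simp only: R_def Wp_def Wd_def \<beta>_def \<beta>'_def)
  have "1 - \<delta> \<le> measure M {\<omega>\<in>space M. case \<omega> of (S, T) \<Rightarrow> ereal (?Z S T) \<le> R}"
  proof (cases "Wp = \<infinity> \<or> Wd = \<infinity>")
    case True
    have "ereal 40000 * (ereal (1 / \<nu>) * (Wp + ereal \<beta>) + Wd + ereal \<beta>') = \<infinity>"
      using True nu_pos by (intro ereal_affine_eq_infinity Wp Wd) auto
    then have "R = \<infinity>" unfolding rhs .
    then have "{\<omega>\<in>space M. case \<omega> of (S, T) \<Rightarrow> ereal (?Z S T) \<le> R} = space M" by auto
    then show ?thesis using assms(1) MM.prob_space by simp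
  next
    case False
    then obtain wp wd where w: "Wp = ereal wp" "Wd = ereal wd" "0 \<le> wp" "0 \<le> wd"
      using Wp Wd by (cases Wp; cases Wd) auto
    define b where "b = 30075 * wp / \<nu> + 3 * wd + 3 * s * x"
    have b_le: "ereal b \<le> R"
    proof -
      define p where "p = wp / \<nu>"
      define u where "u = \<beta> / \<nu>"
      have pu: "0 \<le> p" "0 \<le> u" using w \<beta> nu_pos by (auto simp: p_def u_def)
      \<comment> \<open>The pre-training complexity enters with 30075, the downstream complexity and
        both confidence terms with 3, so 40000 dominates every coefficient.\<close>
      have "b = 30075 * p + 3 * wd + 3 * (u + \<beta>')" by (simp add: b_def p_def u_def flip: sx)
      also have "\<dots> \<le> 40000 * p + 40000 * u + 40000 * wd + 40000 * \<beta>'"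
        using w(3,4) \<beta> pu by simp
      also have "\<dots> = 40000 * (1 / \<nu> * (wp + \<beta>) + wd + \<beta>')"
        by (simp add: p_def u_def algebra_simps add_divide_distrib)
      finally have "b \<le> 40000 * (1 / \<nu> * (wp + \<beta>) + wd + \<beta>')" .
      then show ?thesis unfolding rhs w by simp
    qed
    have Z_meas: "(\<lambda>(S, T). ?Z S T) \<in> borel_measurable M"
      unfolding M_def using random_risk by (simp add: case_prod_beta')
    have "1 - \<delta> \<le> measure M {\<omega>\<in>space M. (case \<omega> of (S, T) \<Rightarrow> ?Z S T) \<le> b}"
    proof (cases "s = 0")
      case True
      then have "Bd = 0"
        using B nu_pos ln by (auto simp: s_def add_nonneg_eq_0_iff)
      have "?Z S T \<le> b" if "(S, T) \<in> space M" for S T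
      proof -
        have "S \<in> space (pre.sample_space n)" "T \<in> space (down.sample_space m)" using that by (auto simp: M_def space_pair_measure)
        then have "f_hat S T \<circ> h_hat S \<in> Rn d \<rightarrow>\<^sub>M Rn (k' - 1)" "fd \<circ> h \<in> Rn d \<rightarrow>\<^sub>M Rn (k' - 1)"
          using measurable_classes(5) h_hat_in f_hat_in realizable by auto
        from this[THEN down.abs_risk_le] have "?Z S T = 0" using \<open>Bd = 0\<close> by (simp add: risk_gd)
        then show ?thesis using True w nu_pos by (simp add: b_def)
      qed
      then have "{\<omega>\<in>space M. (case \<omega> of (S, T) \<Rightarrow> ?Z S T) \<le> b} = space M" by auto
      then show ?thesis using assms(1) MM.prob_space by simp
    next
      case False
      moreover have "0 \<le> s"
        unfolding s_def using B nu_pos by (intro add_nonneg_nonneg divide_nonneg_nonneg mult_nonneg_nonneg) auto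
      ultimately have "0 < s" by simp
      \<comment> \<open>By the choice of \<open>x\<close> this is in fact an equality.\<close>
      have \<delta>: "exp (- x\<^sup>2) \<le> \<delta>" using assms(1,2) by (simp add: x_def ln_div)
      show ?thesis unfolding b_def
        by (rule MM.chernoff_quadratic[OF Z_meas \<open>0 < s\<close> \<open>0 < x\<close> \<delta>], unfold M_def s_def,
            rule exp_excess_risk_le[OF _ w(1)[unfolded Wp_def] w(2)[unfolded Wd_def]])
    qed
    also have "\<dots> \<le> measure M {\<omega>\<in>space M. case \<omega> of (S, T) \<Rightarrow> ereal (?Z S T) \<le> R}"
    proof (rule MM.finite_measure_mono)
      show "{\<omega>\<in>space M. (case \<omega> of (S, T) \<Rightarrow> ?Z S T) \<le> b} \<subseteq> {\<omega>\<in>space M. case \<omega> of (S, T) \<Rightarrow> ereal (?Z S T) \<le> R}"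
      proof safe
        fix S T assume "?Z S T \<le> b"
        then have "ereal (?Z S T) \<le> ereal b" by simp
        then show "ereal (?Z S T) \<le> R" using b_le by (rule order.trans)
      qed
      have "(\<lambda>\<omega>. ereal (case \<omega> of (S, T) \<Rightarrow> ?Z S T)) \<in> borel_measurable M"
        using Z_meas by measurable
      then have "{\<omega>\<in>space M. ereal (case \<omega> of (S, T) \<Rightarrow> ?Z S T) \<le> R} \<in> sets M" by measurable
      then show "{\<omega>\<in>space M. case \<omega> of (S, T) \<Rightarrow> ereal (?Z S T) \<le> R} \<in> sets M" by (simp add: case_prod_beta')
    qed
    finally show ?thesis .
  qed
  then show ?thesis unfolding R_def .
qed

theorem theorem4p2:
  shows "\<exists>C::real. 0 < C \<and>
    (\<forall>d r k k' n m Xp Xd P Q lp ld H Fp Fd Bp Bd Lp Ld LF Dp Dd gp gd h fp fd \<nu> h_hat f_hat.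
      transfer_learning d r k k' n m Xp Xd P Q lp ld H Fp Fd Bp Bd Lp Ld LF Dp Dd
        gp gd h fp fd \<nu> h_hat f_hat \<longrightarrow>
      (\<forall>\<delta>::real. 0 < \<delta> \<and> \<delta> < 1 \<longrightarrow>
        (let M = PiM {..<n} (\<lambda>_. P) \<Otimes>\<^sub>M PiM {..<m} (\<lambda>_. Q) in
         1 - \<delta> \<le> measure M {\<omega>\<in>space M.
           (case \<omega> of (S, T) \<Rightarrow>
             ereal (risk Q ld (f_hat S T \<circ> h_hat S) - risk Q ld gd)
             \<le> ereal C *
               (ereal (1 / \<nu>) *
                  (ereal Lp *
                     (ereal (ln (real n)) *
                        (ereal LF * gaussian_complexity n r H (input_marginal d Xp P)
                          + worst_gaussian_complexity n (k - 1) Fp H Xp)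
                      + ereal (sqrt (real k) * Dp / (real n)\<^sup>2))
                   + ereal (Bp * sqrt (ln (1 / \<delta>) / real n)))
                + ereal Ld * worst_gaussian_complexity m (k' - 1) Fd H Xd
                + ereal (Bd * sqrt (ln (1 / \<delta>) / real m))))})))"
  unfolding Let_def
  by (intro exI[of _ 40000] conjI allI impI, simp, elim conjE, rule transfer_learning.transfer_risk_bound)

end
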